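(* Let $d\ge 1$, let $(G_i)_{i\ge 1}$ be independent standard Gaussian random variables, and consider a sequence $$F_n=\sum_{i_1<\cdots<i_d} a_n(i_1,\dots,i_d)\,G_{i_1}\cdots G_{i_d},\qquad n\in\mathbb N,$$ where for each $n$ only finitely many of the real coefficients $a_n(i_1,\dots,i_d)$ are nonzero and $\mathbf E[F_n^2]=1$. Then the following are equivalent: (i) $(F_n)$ is asymptotically normal, i.e. $F_n$ converges in law to $\mathcal N(0,1)$ as $n\to\infty$; (ii) for some $k\in\{\lfloor d/2\rfloor,\dots,d-1\}$, $\tilde\rho_k(F_n)\to 0$ as $n\to\infty$.
   Context: For $k\in\mathbb N$ and a homogeneous polynomial $F=\sum_{i_1<\cdots<i_d}a_{i_1,\dots,i_d}G_{i_1}\cdots G_{i_d}$ (finitely many nonzero coefficients), the semi-norm $\tilde\rho_k$ is $$\tilde\rho_k(F)=\sup\Big\{\Big\|\sum_{i\ge1}\partial_{G_i}F\,\partial_{G_i}X\Big\|_{L^2}: X=\sum_{i_1<\cdots<i_k}b_{i_1,\dots,i_k}G_{i_1}\cdots G_{i_k},\ \|X\|_{L^2}\le 1\Big\},$$ where $X$ ranges over such sums with finitely many nonzero real coefficients, $\partial_{G_i}$ is the partial derivative with respect to $G_i$, and for $k=0$ the $X$ are constants (so $\tilde\rho_0=0$). *)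

theory Defs
  imports "HOL-Probability.Probability" "HOL-Library.Ramsey"
begin

text \<open>
  An increasing tuple \<open>i\<^sub>1 < \<dots> < i\<^sub>d\<close> of indices \<open>\<ge> 1\<close> is encoded by the \<open>d\<close>-element set
  \<open>{i\<^sub>1, \<dots>, i\<^sub>d}\<close>, i.e. by an element of \<^term>\<open>nsets {1..} d :: nat set set\<close>. A polynomial is
  the function it induces on real sequences.
\<close>

definition fin_coeffs :: "nat \<Rightarrow> (nat set \<Rightarrow> real) \<Rightarrow> bool" where
  "fin_coeffs d a \<longleftrightarrow> finite {I \<in> nsets {1..} d. a I \<noteq> 0}"

definition hom_poly :: "nat \<Rightarrow> (nat set \<Rightarrow> real) \<Rightarrow> (nat \<Rightarrow> real) \<Rightarrow> real" where
  "hom_poly d a x = (\<Sum>I \<in> {I \<in> nsets {1..} d. a I \<noteq> 0}. a I * (\<Prod>i\<in>I. x i))"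

definition partial_deriv :: "nat \<Rightarrow> ((nat \<Rightarrow> real) \<Rightarrow> real) \<Rightarrow> (nat \<Rightarrow> real) \<Rightarrow> real" where
  "partial_deriv i P x = deriv (\<lambda>t. P (x(i := t))) (x i)"

text \<open>
  The sum is infinite only formally: a polynomial with finitely many nonzero coefficients has
  finitely many nonvanishing partial derivatives.
\<close>

definition grad_prod ::
  "((nat \<Rightarrow> real) \<Rightarrow> real) \<Rightarrow> ((nat \<Rightarrow> real) \<Rightarrow> real) \<Rightarrow> (nat \<Rightarrow> real) \<Rightarrow> real" where
  "grad_prod P Q x = (\<Sum>\<^sub>\<infinity>i\<in>{1..}. partial_deriv i P x * partial_deriv i Q x)"

definition at_vars ::
  "(nat \<Rightarrow> 'a \<Rightarrow> real) \<Rightarrow> ((nat \<Rightarrow> real) \<Rightarrow> real) \<Rightarrow> 'a \<Rightarrow> real" where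
  "at_vars G P \<omega> = P (\<lambda>i. G i \<omega>)"

definition L2_norm :: "'a measure \<Rightarrow> ('a \<Rightarrow> real) \<Rightarrow> real" where
  "L2_norm M Y = sqrt (\<integral>\<omega>. (Y \<omega>)\<^sup>2 \<partial>M)"

text \<open>
  The supremum is taken in \<^typ>\<open>ennreal\<close>, where it needs no boundedness side condition.
\<close>

definition rho_tilde ::
  "'a measure \<Rightarrow> (nat \<Rightarrow> 'a \<Rightarrow> real) \<Rightarrow> nat \<Rightarrow> ((nat \<Rightarrow> real) \<Rightarrow> real) \<Rightarrow> ennreal" where
  "rho_tilde M G k P =
     (SUP b \<in> {b. fin_coeffs k b \<and> L2_norm M (at_vars G (hom_poly k b)) \<le> 1}.
        ennreal (L2_norm M (at_vars G (grad_prod P (hom_poly k b)))))"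

end

theory Submission
  imports Defs
begin

text \<open>
  Write \<open>F = \<Sum>\<^sub>I a\<^sub>I G\<^sub>I\<close>, \<open>X = \<Sum>\<^sub>J b\<^sub>J G\<^sub>J\<close> and \<open>\<Gamma>(F, X) = \<Sum>\<^sub>i \<partial>\<^sub>i F \<partial>\<^sub>i X\<close>. Splitting \<open>G\<^sub>i\<^sup>2 = 1 + (G\<^sub>i\<^sup>2 - 1)\<close> gives
  \<open>F X = \<Sum>\<^sub>c Y\<^sub>c\<close> and \<open>\<Gamma>(F, X) = \<Sum>\<^sub>c c Y\<^sub>c\<close>, where \<open>Y\<^sub>c\<close> is built from the order-\<open>c\<close> contraction of the
  coefficients and the \<open>Y\<^sub>c\<close> are mutually orthogonal. View \<open>a\<close> as a matrix \<open>f\<^sub>c\<close> indexed by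
  \<open>c\<close>-sets and \<open>(d - c)\<close>-sets; \<open>f\<^sub>c\<close> and \<open>f\<^sub>d\<^sub>-\<^sub>c\<close> are transposes of each other.

  Multiplying \<open>X\<close> by variables that do not occur in \<open>F\<close> shows that \<open>\<rho>\<^sub>r(F)\<close> increases with \<open>r\<close>, and
  \<open>\<rho>\<^sub>r(F)\<close> bounds the operator norm of \<open>f\<^sub>r\<close>. So if \<open>\<rho>\<^sub>k(F)\<close> is small, then the operator norms of all
  \<open>f\<^sub>r\<close> with \<open>1 \<le> r \<le> k\<close> are small, and transposition covers all \<open>1 \<le> r < d\<close> because
  \<open>k \<ge> \<lfloor>d / 2\<rfloor>\<close>. Hence the variance of \<open>\<Gamma>(F, F)\<close> is small, and Gaussian integration by parts shows that
  the characteristic function of \<open>F\<close> almost solves \<open>\<phi>' = - t \<phi>\<close>.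

  Conversely, hypercontractivity bounds the sixth moments, so convergence in law forces
  \<open>\<^bold>E F\<^sup>4 \<rightarrow> 3\<close>. The components \<open>Y\<^sub>0\<close> and \<open>Y\<^sub>d\<close> of \<open>F\<^sup>2\<close> already give
  \<open>\<^bold>E F\<^sup>4 \<ge> 3 + \<Sum>\<^sub>0\<^sub><\<^sub>r\<^sub><\<^sub>d \<parallel>f\<^sub>r f\<^sub>r\<^sup>T\<parallel>\<^sup>2\<close> (Hilbert--Schmidt norms), so all operator
  norms, and with them \<open>\<rho>\<^sub>d\<^sub>-\<^sub>1(F)\<close>, tend to 0.
\<close>

section \<open>Coefficient matrices and contractions\<close>

definition split_coeff :: "('b set \<Rightarrow> real) \<Rightarrow> 'b set \<Rightarrow> 'b set \<Rightarrow> real" where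
  "split_coeff a A C = (if A \<inter> C = {} then a (A \<union> C) else 0)"

fun contraction ::
  "'b set \<Rightarrow> nat \<Rightarrow> ('b set \<Rightarrow> real) \<Rightarrow> ('b set \<Rightarrow> real) \<Rightarrow> 'b set \<times> 'b set \<Rightarrow> real" where
  "contraction V c a b (A, B) = (\<Sum>C\<in>nsets V c. split_coeff a A C * split_coeff b B C)"

definition sq_norm :: "'b set \<Rightarrow> nat \<Rightarrow> ('b set \<Rightarrow> real) \<Rightarrow> real" where
  "sq_norm V d a = (\<Sum>I\<in>nsets V d. (a I)\<^sup>2)"

text \<open>
  The squared Hilbert--Schmidt norm of \<open>f f\<^sup>T\<close>, where \<open>f\<close> is \<^term>\<open>split_coeff a\<close> with rows
  indexed by \<open>r\<close>-sets.
\<close>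

definition contraction_energy :: "'b set \<Rightarrow> nat \<Rightarrow> ('b set \<Rightarrow> real) \<Rightarrow> nat \<Rightarrow> real" where
  "contraction_energy V d a r =
    (\<Sum>p\<in>nsets V r \<times> nsets V r. (contraction V (d - r) a a p)\<^sup>2)"

fun gram :: "'b set \<times> 'b set \<Rightarrow> 'b set \<times> 'b set \<Rightarrow> real" where
  "gram (I, J) (K, L) = (if I \<union> J = K \<union> L \<and> I \<inter> J = K \<inter> L then 2 ^ card (I \<inter> J) else 0)"

lemma mem_nsets_iff: "I \<in> nsets V d \<longleftrightarrow> I \<subseteq> V \<and> finite I \<and> card I = d"
  by (auto simp: nsets_def)

lemma split_coeff_commute: "split_coeff a A C = split_coeff a C A"
  by (auto simp: split_coeff_def Int_commute Un_commute)

lemma split_coeff_power2: "(split_coeff a A C)\<^sup>2 = split_coeff (\<lambda>I. (a I)\<^sup>2) A C"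
  by (simp add: split_coeff_def)

lemma sq_norm_nonneg: "sq_norm V d a \<ge> 0"
  unfolding sq_norm_def by (intro sum_nonneg) simp

lemma contraction_energy_nonneg: "contraction_energy V d a r \<ge> 0"
  unfolding contraction_energy_def by (intro sum_nonneg) simp

lemma gram_nonneg: "gram p q \<ge> 0"
  by (cases p; cases q) simp

lemma gram_commute: "gram p q = gram q p"
  by (cases p; cases q) auto

lemma gram_eq_0_if_card_neq:
  assumes "finite A" "finite B" "finite A'" "finite B'" "card A + card B \<noteq> card A' + card B'"
  shows "gram (A, B) (A', B') = 0"
  using assms card_Un_Int[of A B] card_Un_Int[of A' B'] by auto

lemma sum_Pow_eq_sum_nsets:
  fixes h :: "'b set \<Rightarrow> 'c::comm_monoid_add"
  assumes "finite X" "card X \<le> k"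
  shows "(\<Sum>C\<in>Pow X. h C) = (\<Sum>c\<le>k. \<Sum>C\<in>nsets X c. h C)"
proof -
  have "(\<Sum>c\<le>k. \<Sum>C\<in>nsets X c. h C) = (\<Sum>c\<le>k. \<Sum>C\<in>{C \<in> Pow X. card C = c}. h C)"
    using assms by (intro sum.cong refl) (auto simp: mem_nsets_iff dest: finite_subset)
  also have "\<dots> = (\<Sum>C\<in>Pow X. h C)"
    using assms by (intro sum.group) (auto intro: order_trans[OF card_mono])
  finally show ?thesis by simp
qed

lemma sum_split_coeff:
  assumes fin_V: "finite V" and C_mem: "C \<in> nsets V c" and "c \<le> d"
  shows "(\<Sum>A\<in>nsets V (d - c). split_coeff a A C * g A) =
    (\<Sum>I\<in>nsets V d. if C \<subseteq> I then a I * g (I - C) else 0)"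
proof -
  have finite_nsets: "finite (nsets V m)" for m
    using fin_V by (rule finite_imp_finite_nsets)
  have "(\<Sum>A\<in>nsets V (d - c). split_coeff a A C * g A) =
      (\<Sum>A\<in>{A \<in> nsets V (d - c). A \<inter> C = {}}. a (A \<union> C) * g A)"
    unfolding split_coeff_def by (subst sum.inter_filter[OF finite_nsets]) (auto intro!: sum.cong)
  also have "\<dots> = (\<Sum>I\<in>{I \<in> nsets V d. C \<subseteq> I}. a I * g (I - C))"
  proof (rule sum.reindex_bij_witness[where i = "\<lambda>I. I - C" and j = "\<lambda>A. A \<union> C"])
    fix A assume A_mem: "A \<in> {A \<in> nsets V (d - c). A \<inter> C = {}}"
    then show "A \<union> C - C = A" by blast
    with A_mem show "a (A \<union> C) * g (A \<union> C - C) = a (A \<union> C) * g A" by simp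
    show "A \<union> C \<in> {I \<in> nsets V d. C \<subseteq> I}"
      using A_mem C_mem \<open>c \<le> d\<close> by (auto simp: mem_nsets_iff card_Un_disjoint)
  next
    fix I assume I_mem: "I \<in> {I \<in> nsets V d. C \<subseteq> I}"
    then show "I - C \<union> C = I" by blast
    show "I - C \<in> {A \<in> nsets V (d - c). A \<inter> C = {}}"
      using I_mem C_mem by (auto simp: mem_nsets_iff card_Diff_subset)
  qed
  also have "\<dots> = (\<Sum>I\<in>nsets V d. if C \<subseteq> I then a I * g (I - C) else 0)"
    by (rule sum.inter_filter[OF finite_nsets])
  finally show ?thesis .
qed

lemma sum_sum_split_coeff:
  assumes fin_V: "finite V" and "U \<subseteq> V" "c \<le> d"
  shows "(\<Sum>C\<in>nsets U c. \<Sum>A\<in>nsets V (d - c). split_coeff a A C * g A C) =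
    (\<Sum>I\<in>nsets V d. \<Sum>C\<in>nsets (U \<inter> I) c. a I * g (I - C) C)"
proof -
  have "(\<Sum>C\<in>nsets U c. \<Sum>A\<in>nsets V (d - c). split_coeff a A C * g A C) =
      (\<Sum>C\<in>nsets U c. \<Sum>I\<in>nsets V d. if C \<subseteq> I then a I * g (I - C) C else 0)"
    using assms nsets_mono[OF \<open>U \<subseteq> V\<close>, of c] by (intro sum.cong refl sum_split_coeff) auto
  also have "\<dots> = (\<Sum>I\<in>nsets V d. \<Sum>C\<in>nsets U c. if C \<subseteq> I then a I * g (I - C) C else 0)"
    by (rule sum.swap)
  also have "\<dots> = (\<Sum>I\<in>nsets V d. \<Sum>C\<in>{C \<in> nsets U c. C \<subseteq> I}. a I * g (I - C) C)"
    using finite_subset[OF \<open>U \<subseteq> V\<close> fin_V]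
    by (intro sum.cong refl sum.inter_filter[symmetric] finite_imp_finite_nsets)
  also have "\<dots> = (\<Sum>I\<in>nsets V d. \<Sum>C\<in>nsets (U \<inter> I) c. a I * g (I - C) C)"
    by (intro sum.cong refl) (auto simp: mem_nsets_iff)
  finally show ?thesis .
qed

lemma sum_split_coeff_squares:
  assumes "finite V" and "c \<le> d"
  shows "(\<Sum>A\<in>nsets V (d - c). \<Sum>C\<in>nsets V c. (split_coeff a A C)\<^sup>2) =
    real (d choose c) * sq_norm V d a"
proof -
  have "(\<Sum>A\<in>nsets V (d - c). \<Sum>C\<in>nsets V c. (split_coeff a A C)\<^sup>2) =
      (\<Sum>C\<in>nsets V c. \<Sum>A\<in>nsets V (d - c). split_coeff (\<lambda>I. (a I)\<^sup>2) A C * 1)"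
    by (subst sum.swap) (simp add: split_coeff_power2)
  also have "\<dots> = (\<Sum>I\<in>nsets V d. \<Sum>C\<in>nsets (V \<inter> I) c. (a I)\<^sup>2 * 1)"
    using assms by (intro sum_sum_split_coeff) auto
  also have "\<dots> = (\<Sum>I\<in>nsets V d. real (d choose c) * (a I)\<^sup>2)"
    by (intro sum.cong refl) (simp add: mem_nsets_iff Int_absorb1)
  finally show ?thesis
    by (simp add: sq_norm_def sum_distrib_left)
qed

lemma sum_contraction_mult:
  assumes "finite V" and "c \<le> d" "c \<le> k"
  shows "(\<Sum>p\<in>nsets V (d - c) \<times> nsets V (k - c). contraction V c a b p * h p) =
    (\<Sum>I\<in>nsets V d. \<Sum>J\<in>nsets V k. \<Sum>C\<in>nsets (I \<inter> J) c. a I * b J * h (I - C, J - C))"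
proof -
  have "(\<Sum>p\<in>nsets V (d - c) \<times> nsets V (k - c). contraction V c a b p * h p) =
      (\<Sum>A\<in>nsets V (d - c). \<Sum>B\<in>nsets V (k - c). \<Sum>C\<in>nsets V c.
        split_coeff a A C * split_coeff b B C * h (A, B))"
    by (simp add: sum.cartesian_product' sum_distrib_right)
  also have "\<dots> = (\<Sum>A\<in>nsets V (d - c). \<Sum>C\<in>nsets V c. \<Sum>B\<in>nsets V (k - c).
        split_coeff a A C * split_coeff b B C * h (A, B))"
    by (intro sum.cong refl sum.swap)
  also have "\<dots> = (\<Sum>C\<in>nsets V c. \<Sum>A\<in>nsets V (d - c).
      split_coeff a A C * (\<Sum>B\<in>nsets V (k - c). split_coeff b B C * h (A, B)))"
    by (subst sum.swap) (simp only: sum_distrib_left mult.assoc)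
  also have "\<dots> = (\<Sum>I\<in>nsets V d. \<Sum>C\<in>nsets (V \<inter> I) c.
      a I * (\<Sum>B\<in>nsets V (k - c). split_coeff b B C * h (I - C, B)))"
    using assms by (intro sum_sum_split_coeff) auto
  also have "\<dots> = (\<Sum>I\<in>nsets V d. a I *
      (\<Sum>C\<in>nsets I c. \<Sum>B\<in>nsets V (k - c). split_coeff b B C * h (I - C, B)))"
    by (intro sum.cong refl) (simp add: mem_nsets_iff Int_absorb1 sum_distrib_left)
  also have "\<dots> = (\<Sum>I\<in>nsets V d. a I *
      (\<Sum>J\<in>nsets V k. \<Sum>C\<in>nsets (I \<inter> J) c. b J * h (I - C, J - C)))"
    using assms by (intro sum.cong refl arg_cong2[where f = "(*)"] sum_sum_split_coeff)
      (auto simp: mem_nsets_iff)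
  finally show ?thesis
    by (simp add: sum_distrib_left mult.assoc)
qed

definition splits :: "'b set \<Rightarrow> 'b set \<Rightarrow> 'b set \<Rightarrow> bool" where
  "splits I A C \<longleftrightarrow> A \<inter> C = {} \<and> A \<union> C = I"

lemma sum_mult_of_bool_splits:
  assumes "finite V" "A \<subseteq> V" "C \<subseteq> V"
  shows "(\<Sum>I\<in>nsets V d. a I * of_bool (splits I A C)) =
    (if card A + card C = d then split_coeff a A C else 0)"
proof (cases "A \<inter> C = {}")
  case True
  then have "A \<union> C \<in> nsets V d \<longleftrightarrow> card A + card C = d"
    using assms finite_subset[of _ V] by (auto simp: mem_nsets_iff card_Un_disjoint)
  moreover have "a I * of_bool (splits I A C) = (if A \<union> C = I then a I else 0)" for I
    using True by (auto simp: splits_def)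
  ultimately show ?thesis
    using True assms by (simp add: split_coeff_def finite_imp_finite_nsets)
qed (simp add: split_coeff_def splits_def)

text \<open>
  The entry of the Gram matrix counts the ways to distribute the elements of \<open>I\<close> and of \<open>J\<close> over
  \<open>K\<close> and \<open>L\<close>: only the common elements leave a choice, which of their two copies goes to \<open>K\<close>.
\<close>

lemma gram_eq_card_splits:
  assumes fin_IJ: "finite I" "finite J"
  shows "gram (I, J) (K, L) =
    real (card {(R, A). R \<subseteq> I \<and> A \<subseteq> J \<and> splits K R A \<and> splits L (I - R) (J - A)})"
    (is "_ = real (card ?T)")
proof (cases "I \<union> J = K \<union> L \<and> I \<inter> J = K \<inter> L")
  case True
  let ?f = "\<lambda>U. ((I - J) \<inter> K \<union> U, (J - I) \<inter> K \<union> (I \<inter> J - U))"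
  have "bij_betw ?f (Pow (I \<inter> J)) ?T"
  proof (rule bij_betw_byWitness[where f' = "\<lambda>(R, A). R \<inter> J"])
    show "\<forall>U\<in>Pow (I \<inter> J). (case ?f U of (R, A) \<Rightarrow> R \<inter> J) = U"
      by auto
    show "\<forall>z\<in>?T. ?f (case z of (R, A) \<Rightarrow> R \<inter> J) = z"
      using True by (auto simp: splits_def)
    show "?f ` Pow (I \<inter> J) \<subseteq> ?T"
      using True by (auto simp: splits_def)
    show "(\<lambda>(R, A). R \<inter> J) ` ?T \<subseteq> Pow (I \<inter> J)"
      by auto
  qed
  then have "card (Pow (I \<inter> J)) = card ?T"
    by (rule bij_betw_same_card)
  then have "2 ^ card (I \<inter> J) = card ?T"
    using card_Pow[of "I \<inter> J"] fin_IJ by (metis finite_Int)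
  then show ?thesis
    using True by (metis gram.simps numeral_power_eq_of_nat_cancel_iff)
next
  case False
  then have empty: "?T = {}"
    unfolding splits_def by blast
  show ?thesis
    unfolding gram.simps if_not_P[OF False] empty by simp
qed

lemma gram_eq_sum_splits:
  assumes "finite I" "finite J"
  shows "gram (I, J) (K, L) =
    (\<Sum>R\<in>Pow I. \<Sum>A\<in>Pow J. of_bool (splits K R A) * of_bool (splits L (I - R) (J - A)))"
proof -
  have "{(R, A). R \<subseteq> I \<and> A \<subseteq> J \<and> splits K R A \<and> splits L (I - R) (J - A)} =
      Pow I \<times> Pow J \<inter> {(R, A). splits K R A \<and> splits L (I - R) (J - A)}"
    by auto
  then show ?thesis
    using assms unfolding gram_eq_card_splits[OF assms] sum.cartesian_product of_bool_conj[symmetric]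
    by (simp add: split_def)
qed

lemma sum_gram_mult_coeffs:
  assumes fin_V: "finite V" and I_mem: "I \<in> nsets V d" and J_mem: "J \<in> nsets V d"
  shows "(\<Sum>K\<in>nsets V d. \<Sum>L\<in>nsets V d. a K * a L * gram (I, J) (K, L)) =
    (\<Sum>r\<le>d. \<Sum>R\<in>nsets I r. \<Sum>A\<in>nsets J (d - r). split_coeff a R A * split_coeff a (I - R) (J - A))"
proof -
  have IJ_props: "finite I" "finite J" "I \<subseteq> V" "J \<subseteq> V" "card I = d" "card J = d"
    using I_mem J_mem by (auto simp: mem_nsets_iff)
  let ?s = "\<lambda>K R A. a K * of_bool (splits K R A)"
  have "(\<Sum>K\<in>nsets V d. \<Sum>L\<in>nsets V d. a K * a L * gram (I, J) (K, L)) =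
      (\<Sum>(K, L)\<in>nsets V d \<times> nsets V d. \<Sum>(R, A)\<in>Pow I \<times> Pow J. ?s K R A * ?s L (I - R) (J - A))"
    unfolding gram_eq_sum_splits[OF IJ_props(1,2)]
    by (simp add: sum.cartesian_product' sum_distrib_left mult_ac)
  also have "\<dots> = (\<Sum>(R, A)\<in>Pow I \<times> Pow J. \<Sum>(K, L)\<in>nsets V d \<times> nsets V d. ?s K R A * ?s L (I - R) (J - A))"
    unfolding split_def by (rule sum.swap)
  also have "\<dots> = (\<Sum>R\<in>Pow I. \<Sum>A\<in>Pow J.
      (\<Sum>K\<in>nsets V d. ?s K R A) * (\<Sum>L\<in>nsets V d. ?s L (I - R) (J - A)))"
    by (simp only: sum.cartesian_product' prod.case fst_conv snd_conv sum_product)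
  also have "\<dots> = (\<Sum>R\<in>Pow I. \<Sum>A\<in>Pow J.
      if card A = d - card R then split_coeff a R A * split_coeff a (I - R) (J - A) else 0)"
  proof (intro sum.cong refl)
    fix R A assume RA_mem: "R \<in> Pow I" "A \<in> Pow J"
    then have "card R \<le> d" "card A \<le> d" "card (I - R) = d - card R" "card (J - A) = d - card A"
      using IJ_props card_mono[of I R] card_mono[of J A] finite_subset[of R I] finite_subset[of A J]
      by (auto simp: card_Diff_subset)
    then show "(\<Sum>K\<in>nsets V d. ?s K R A) * (\<Sum>L\<in>nsets V d. ?s L (I - R) (J - A)) =
        (if card A = d - card R then split_coeff a R A * split_coeff a (I - R) (J - A) else 0)"
      using fin_V RA_mem IJ_props by (subst (1 2) sum_mult_of_bool_splits) auto
  qed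
  also have "\<dots> = (\<Sum>R\<in>Pow I. \<Sum>A\<in>nsets J (d - card R). split_coeff a R A * split_coeff a (I - R) (J - A))"
    using IJ_props by (subst sum.inter_filter[symmetric])
      (auto intro!: sum.cong simp: mem_nsets_iff dest: finite_subset)
  also have "\<dots> = (\<Sum>r\<le>d. \<Sum>R\<in>nsets I r. \<Sum>A\<in>nsets J (d - card R).
      split_coeff a R A * split_coeff a (I - R) (J - A))"
    using IJ_props by (intro sum_Pow_eq_sum_nsets) auto
  finally show ?thesis
    by (simp add: mem_nsets_iff)
qed

lemma contraction_energy_eq_sum_splits:
  assumes "finite V" and "r \<le> d"
  shows "contraction_energy V d a r = (\<Sum>I\<in>nsets V d. \<Sum>J\<in>nsets V d. a I * a J *
    (\<Sum>R\<in>nsets I r. \<Sum>A\<in>nsets J (d - r). split_coeff a R A * split_coeff a (I - R) (J - A)))"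
proof -
  let ?f = "split_coeff a"
  have "contraction_energy V d a r = (\<Sum>R\<in>nsets V r. \<Sum>B\<in>nsets V r. \<Sum>S\<in>nsets V (d - r). \<Sum>A\<in>nsets V (d - r).
      ?f S R * (?f B A * (?f R A * ?f S B)))"
    by (simp add: contraction_energy_def sum.cartesian_product' power2_eq_square sum_product
        split_coeff_commute mult_ac)
  also have "\<dots> = (\<Sum>R\<in>nsets V r. \<Sum>S\<in>nsets V (d - r). \<Sum>B\<in>nsets V r. \<Sum>A\<in>nsets V (d - r).
      ?f S R * (?f B A * (?f R A * ?f S B)))"
    by (intro sum.cong refl sum.swap)
  also have "\<dots> = (\<Sum>R\<in>nsets V r. \<Sum>S\<in>nsets V (d - r). \<Sum>A\<in>nsets V (d - r). \<Sum>B\<in>nsets V r.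
      ?f S R * (?f B A * (?f R A * ?f S B)))"
    by (intro sum.cong refl sum.swap)
  also have "\<dots> = (\<Sum>R\<in>nsets V r. \<Sum>S\<in>nsets V (d - r). ?f S R *
      (\<Sum>A\<in>nsets V (d - r). \<Sum>B\<in>nsets V (d - (d - r)). ?f B A * (?f R A * ?f S B)))"
    using \<open>r \<le> d\<close> by (simp add: sum_distrib_left)
  also have "\<dots> = (\<Sum>I\<in>nsets V d. \<Sum>R\<in>nsets (V \<inter> I) r. a I *
      (\<Sum>A\<in>nsets V (d - r). \<Sum>B\<in>nsets V (d - (d - r)). ?f B A * (?f R A * ?f (I - R) B)))"
    using assms by (intro sum_sum_split_coeff) auto
  also have "\<dots> = (\<Sum>I\<in>nsets V d. \<Sum>R\<in>nsets (V \<inter> I) r. a I *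
      (\<Sum>J\<in>nsets V d. \<Sum>A\<in>nsets (V \<inter> J) (d - r). a J * (?f R A * ?f (I - R) (J - A))))"
    using assms by (intro sum.cong refl arg_cong2[where f = "(*)"] sum_sum_split_coeff) auto
  also have "\<dots> = (\<Sum>I\<in>nsets V d. \<Sum>R\<in>nsets I r. a I *
      (\<Sum>J\<in>nsets V d. \<Sum>A\<in>nsets J (d - r). a J * (?f R A * ?f (I - R) (J - A))))"
    by (simp add: mem_nsets_iff Int_absorb1)
  also have "\<dots> = (\<Sum>I\<in>nsets V d. \<Sum>J\<in>nsets V d. \<Sum>R\<in>nsets I r. a I *
      (\<Sum>A\<in>nsets J (d - r). a J * (?f R A * ?f (I - R) (J - A))))"
    unfolding sum_distrib_left by (intro sum.cong refl sum.swap)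
  finally show ?thesis
    by (simp add: sum_distrib_left mult_ac)
qed

theorem sum_gram_eq_sum_contraction_energy:
  assumes fin_V: "finite V"
  shows "(\<Sum>p\<in>nsets V d \<times> nsets V d. \<Sum>q\<in>nsets V d \<times> nsets V d.
      contraction V 0 a a p * contraction V 0 a a q * gram p q) = (\<Sum>r\<le>d. contraction_energy V d a r)"
proof -
  have "(\<Sum>p\<in>nsets V d \<times> nsets V d. \<Sum>q\<in>nsets V d \<times> nsets V d.
      contraction V 0 a a p * contraction V 0 a a q * gram p q) =
    (\<Sum>I\<in>nsets V d. \<Sum>J\<in>nsets V d. a I * a J *
      (\<Sum>K\<in>nsets V d. \<Sum>L\<in>nsets V d. a K * a L * gram (I, J) (K, L)))"
    by (simp add: sum.cartesian_product' split_coeff_def sum_distrib_left mult_ac del: gram.simps)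
  also have "\<dots> = (\<Sum>I\<in>nsets V d. \<Sum>J\<in>nsets V d. \<Sum>r\<le>d. a I * a J *
      (\<Sum>R\<in>nsets I r. \<Sum>A\<in>nsets J (d - r). split_coeff a R A * split_coeff a (I - R) (J - A)))"
    using fin_V by (intro sum.cong refl, subst sum_gram_mult_coeffs) (simp_all add: sum_distrib_left)
  also have "\<dots> = (\<Sum>I\<in>nsets V d. \<Sum>r\<le>d. \<Sum>J\<in>nsets V d. a I * a J *
      (\<Sum>R\<in>nsets I r. \<Sum>A\<in>nsets J (d - r). split_coeff a R A * split_coeff a (I - R) (J - A)))"
    by (intro sum.cong refl sum.swap)
  also have "\<dots> = (\<Sum>r\<le>d. contraction_energy V d a r)"
    using fin_V by (subst sum.swap) (simp add: contraction_energy_eq_sum_splits)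
  finally show ?thesis .
qed

lemma contraction_energy_extreme:
  "contraction_energy V d a 0 = (sq_norm V d a)\<^sup>2" "contraction_energy V d a d = (sq_norm V d a)\<^sup>2"
  by (simp_all add: contraction_energy_def sq_norm_def split_coeff_def sum.cartesian_product'
      power2_eq_square sum_product mult_ac)

section \<open>Operator norms of coefficient matrices\<close>

definition matrix_bound :: "'b set \<Rightarrow> 'c set \<Rightarrow> ('b \<Rightarrow> 'c \<Rightarrow> real) \<Rightarrow> real \<Rightarrow> bool" where
  "matrix_bound X Y f K \<longleftrightarrow>
    (\<forall>v. (\<Sum>x\<in>X. (\<Sum>y\<in>Y. f x y * v y)\<^sup>2) \<le> K * (\<Sum>y\<in>Y. (v y)\<^sup>2))"

definition contraction_bound :: "'b set \<Rightarrow> nat \<Rightarrow> ('b set \<Rightarrow> real) \<Rightarrow> nat \<Rightarrow> real \<Rightarrow> bool" where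
  "contraction_bound V d a c K \<longleftrightarrow> matrix_bound (nsets V (d - c)) (nsets V c) (split_coeff a) K"

lemma matrix_bound_mono:
  assumes "matrix_bound X Y f K" "K \<le> K'"
  shows "matrix_bound X Y f K'"
  using assms unfolding matrix_bound_def
  by (meson mult_right_mono order_trans sum_nonneg zero_le_power2)

lemma matrix_boundI_unit:
  fixes f :: "'b \<Rightarrow> 'c \<Rightarrow> real"
  assumes "finite Y" and unit: "\<And>v. (\<Sum>y\<in>Y. (v y)\<^sup>2) = 1 \<Longrightarrow> (\<Sum>x\<in>X. (\<Sum>y\<in>Y. f x y * v y)\<^sup>2) \<le> K"
  shows "matrix_bound X Y f K"
  unfolding matrix_bound_def
proof
  fix v :: "'c \<Rightarrow> real"
  define s where "s = (\<Sum>y\<in>Y. (v y)\<^sup>2)"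
  show "(\<Sum>x\<in>X. (\<Sum>y\<in>Y. f x y * v y)\<^sup>2) \<le> K * s"
  proof (cases "s = 0")
    case True
    then have "v y = 0" if "y \<in> Y" for y
      using that \<open>finite Y\<close> by (simp add: s_def sum_nonneg_eq_0_iff)
    with True show ?thesis by simp
  next
    case False
    moreover have "s \<ge> 0"
      unfolding s_def by (intro sum_nonneg) simp
    ultimately have "s > 0" by simp
    then have "(\<Sum>y\<in>Y. (v y / sqrt s)\<^sup>2) = 1"
      by (simp add: power_divide s_def[symmetric] flip: sum_divide_distrib)
    then have "(\<Sum>x\<in>X. (\<Sum>y\<in>Y. f x y * (v y / sqrt s))\<^sup>2) \<le> K"
      by (rule unit)
    also have "(\<Sum>x\<in>X. (\<Sum>y\<in>Y. f x y * (v y / sqrt s))\<^sup>2) = (\<Sum>x\<in>X. (\<Sum>y\<in>Y. f x y * v y)\<^sup>2) / s"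
      using \<open>s > 0\<close> by (simp add: power_divide flip: sum_divide_distrib)
    finally show ?thesis
      using \<open>s > 0\<close> by (simp add: divide_le_eq)
  qed
qed

lemma matrix_bound_transpose:
  fixes f :: "'b \<Rightarrow> 'c \<Rightarrow> real"
  assumes bound: "matrix_bound X Y f K" and "K \<ge> 0"
  shows "matrix_bound Y X (\<lambda>y x. f x y) K"
  unfolding matrix_bound_def
proof
  fix w :: "'b \<Rightarrow> real"
  define v where "v y = (\<Sum>x\<in>X. f x y * w x)" for y
  define s where "s = (\<Sum>y\<in>Y. (v y)\<^sup>2)"
  have "s = (\<Sum>y\<in>Y. \<Sum>x\<in>X. v y * (f x y * w x))"
    unfolding s_def power2_eq_square
    by (intro sum.cong refl) (simp add: v_def flip: sum_distrib_left)
  also have "\<dots> = (\<Sum>x\<in>X. w x * (\<Sum>y\<in>Y. f x y * v y))"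
    by (subst sum.swap) (simp add: sum_distrib_left mult_ac)
  finally have "s\<^sup>2 \<le> (\<Sum>x\<in>X. (w x)\<^sup>2) * (\<Sum>x\<in>X. (\<Sum>y\<in>Y. f x y * v y)\<^sup>2)"
    using Cauchy_Schwarz_ineq_sum[of w _ X] by simp
  also have "\<dots> \<le> (\<Sum>x\<in>X. (w x)\<^sup>2) * (K * s)"
    using bound unfolding s_def matrix_bound_def by (intro mult_left_mono sum_nonneg) auto
  finally have square_le: "s * s \<le> (K * (\<Sum>x\<in>X. (w x)\<^sup>2)) * s"
    by (simp add: power2_eq_square mult_ac)
  have "s \<ge> 0" "K * (\<Sum>x\<in>X. (w x)\<^sup>2) \<ge> 0"
    unfolding s_def using \<open>K \<ge> 0\<close> by (auto intro!: sum_nonneg mult_nonneg_nonneg)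
  with square_le have "s \<le> K * (\<Sum>x\<in>X. (w x)\<^sup>2)"
    by (cases "s = 0") (auto simp: mult_le_cancel_right)
  then show "(\<Sum>y\<in>Y. (\<Sum>x\<in>X. f x y * w x)\<^sup>2) \<le> K * (\<Sum>x\<in>X. (w x)\<^sup>2)"
    by (simp add: s_def v_def)
qed

lemma matrix_bound_hilbert_schmidt:
  fixes f :: "'b \<Rightarrow> 'c \<Rightarrow> real"
  shows "matrix_bound X Y f (sqrt (\<Sum>y\<in>Y. \<Sum>z\<in>Y. (\<Sum>x\<in>X. f x y * f x z)\<^sup>2))"
  unfolding matrix_bound_def
proof
  fix v :: "'c \<Rightarrow> real"
  let ?N = "\<lambda>y z. \<Sum>x\<in>X. f x y * f x z"
  have "(\<Sum>x\<in>X. (\<Sum>y\<in>Y. f x y * v y)\<^sup>2) = (\<Sum>x\<in>X. \<Sum>y\<in>Y. \<Sum>z\<in>Y. v y * v z * (f x y * f x z))"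
    by (simp add: power2_eq_square sum_product mult_ac)
  also have "\<dots> = (\<Sum>y\<in>Y. \<Sum>x\<in>X. \<Sum>z\<in>Y. v y * v z * (f x y * f x z))"
    by (rule sum.swap)
  also have "\<dots> = (\<Sum>y\<in>Y. \<Sum>z\<in>Y. v y * v z * ?N y z)"
    unfolding sum_distrib_left by (intro sum.cong refl sum.swap)
  also have "\<dots> = (\<Sum>(y, z)\<in>Y \<times> Y. (v y * v z) * ?N y z)"
    by (simp add: sum.cartesian_product)
  also have "\<dots> \<le> sqrt ((\<Sum>(y, z)\<in>Y \<times> Y. (v y * v z)\<^sup>2) * (\<Sum>(y, z)\<in>Y \<times> Y. (?N y z)\<^sup>2))"
    using Cauchy_Schwarz_ineq_sum[of "\<lambda>(y, z). v y * v z" "\<lambda>(y, z). ?N y z" "Y \<times> Y"]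
    by (intro real_le_rsqrt) (simp add: split_def)
  also have "(\<Sum>(y, z)\<in>Y \<times> Y. (v y * v z)\<^sup>2) = (\<Sum>y\<in>Y. (v y)\<^sup>2)\<^sup>2"
    by (simp add: power_mult_distrib power2_eq_square[of "sum _ _"] sum_product flip: sum.cartesian_product)
  also have "sqrt (\<dots> * (\<Sum>(y, z)\<in>Y \<times> Y. (?N y z)\<^sup>2)) =
      sqrt (\<Sum>y\<in>Y. \<Sum>z\<in>Y. (?N y z)\<^sup>2) * (\<Sum>y\<in>Y. (v y)\<^sup>2)"
    by (simp add: real_sqrt_mult sum_nonneg sum.cartesian_product)
  finally show "(\<Sum>x\<in>X. (\<Sum>y\<in>Y. f x y * v y)\<^sup>2) \<le>
      sqrt (\<Sum>y\<in>Y. \<Sum>z\<in>Y. (?N y z)\<^sup>2) * (\<Sum>y\<in>Y. (v y)\<^sup>2)" .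
qed

lemma contraction_bound_transpose:
  assumes "contraction_bound V d a c K" "c \<le> d" "K \<ge> 0"
  shows "contraction_bound V d a (d - c) K"
  using matrix_bound_transpose[of "nsets V (d - c)" "nsets V c" "split_coeff a" K] assms
  by (simp add: contraction_bound_def split_coeff_commute)

lemma contraction_bound_energy: "contraction_bound V d a c (sqrt (contraction_energy V d a c))"
  using matrix_bound_hilbert_schmidt[of "nsets V (d - c)" "nsets V c" "split_coeff a"]
  by (simp add: contraction_bound_def contraction_energy_def sum.cartesian_product' split_coeff_commute)

lemma sum_contraction_squares_le:
  assumes fin_V: "finite V" and "c \<le> k" and "K \<ge> 0" and bound: "contraction_bound V d a c K"
  shows "(\<Sum>p\<in>nsets V (d - c) \<times> nsets V (k - c). (contraction V c a b p)\<^sup>2) \<le> K * 2 ^ k * sq_norm V k b"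
proof -
  have "(\<Sum>p\<in>nsets V (d - c) \<times> nsets V (k - c). (contraction V c a b p)\<^sup>2) =
      (\<Sum>B\<in>nsets V (k - c). \<Sum>A\<in>nsets V (d - c). (\<Sum>C\<in>nsets V c. split_coeff a A C * split_coeff b B C)\<^sup>2)"
    by (subst sum.swap) (simp add: sum.cartesian_product')
  also have "\<dots> \<le> (\<Sum>B\<in>nsets V (k - c). K * (\<Sum>C\<in>nsets V c. (split_coeff b B C)\<^sup>2))"
    using bound unfolding contraction_bound_def matrix_bound_def by (intro sum_mono) auto
  also have "\<dots> = K * (real (k choose c) * sq_norm V k b)"
    using fin_V \<open>c \<le> k\<close> by (simp add: sum_split_coeff_squares flip: sum_distrib_left)
  also have "\<dots> \<le> K * (2 ^ k * sq_norm V k b)"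
    using \<open>K \<ge> 0\<close> binomial_le_pow2[of k c]
    by (intro mult_left_mono mult_right_mono sq_norm_nonneg)
      (simp_all add: numeral_power_le_of_nat_cancel_iff)
  finally show ?thesis by simp
qed

lemma quadratic_form_le_row_sum:
  fixes q :: "'b \<Rightarrow> 'b \<Rightarrow> real"
  assumes nonneg: "\<And>x y. q x y \<ge> 0" and sym: "\<And>x y. q x y = q y x"
    and row: "\<And>x. x \<in> Z \<Longrightarrow> (\<Sum>y\<in>Z. q x y) \<le> N"
  shows "(\<Sum>x\<in>Z. \<Sum>y\<in>Z. u x * u y * q x y) \<le> N * (\<Sum>x\<in>Z. (u x)\<^sup>2)"
proof -
  have "(\<Sum>x\<in>Z. \<Sum>y\<in>Z. u x * u y * q x y) \<le> (\<Sum>x\<in>Z. \<Sum>y\<in>Z. ((u x)\<^sup>2 + (u y)\<^sup>2) / 2 * q x y)"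
  proof (intro sum_mono mult_right_mono nonneg)
    show "u x * u y \<le> ((u x)\<^sup>2 + (u y)\<^sup>2) / 2" for x y
      using sum_squares_bound[of "u x" "u y"] by simp
  qed
  also have "\<dots> = (\<Sum>x\<in>Z. \<Sum>y\<in>Z. (u x)\<^sup>2 * q x y) / 2 + (\<Sum>x\<in>Z. \<Sum>y\<in>Z. (u y)\<^sup>2 * q x y) / 2"
    by (simp add: sum_divide_distrib add_divide_distrib distrib_right flip: sum.distrib)
  also have "(\<Sum>x\<in>Z. \<Sum>y\<in>Z. (u y)\<^sup>2 * q x y) = (\<Sum>x\<in>Z. \<Sum>y\<in>Z. (u x)\<^sup>2 * q x y)"
    by (subst sum.swap) (simp add: sym)
  also have "(\<Sum>x\<in>Z. \<Sum>y\<in>Z. (u x)\<^sup>2 * q x y) / 2 + (\<Sum>x\<in>Z. \<Sum>y\<in>Z. (u x)\<^sup>2 * q x y) / 2 =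
      (\<Sum>x\<in>Z. (u x)\<^sup>2 * (\<Sum>y\<in>Z. q x y))"
    by (simp add: sum_distrib_left)
  also have "\<dots> \<le> (\<Sum>x\<in>Z. (u x)\<^sup>2 * N)"
    by (intro sum_mono mult_left_mono row) auto
  finally show ?thesis
    by (simp add: sum_distrib_left mult_ac)
qed

lemma sum_gram_le:
  assumes "finite P" "finite A" "finite B" "card A + card B \<le> n"
  shows "(\<Sum>q\<in>P. gram (A, B) q) \<le> 8 ^ n"
proof -
  let ?W = "Pow (A \<union> B) \<times> Pow (A \<union> B)"
  have card_le: "card (A \<inter> B) \<le> n" "card (A \<union> B) \<le> n"
    using assms card_Un_le[of A B] card_mono[of A "A \<inter> B"] by auto
  have "(\<Sum>q\<in>P. gram (A, B) q) = (\<Sum>q\<in>P \<inter> ?W. gram (A, B) q)"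
    using \<open>finite P\<close> by (intro sum.mono_neutral_right) (auto split: if_splits)
  also have "\<dots> \<le> (\<Sum>q\<in>?W. gram (A, B) q)"
    using assms by (intro sum_mono2 gram_nonneg) auto
  also have "\<dots> \<le> (\<Sum>q\<in>?W. 2 ^ n)"
  proof (rule sum_mono)
    show "gram (A, B) q \<le> 2 ^ n" for q
      using card_le(1) by (cases q) auto
  qed
  also have "\<dots> = 2 ^ card (A \<union> B) * 2 ^ card (A \<union> B) * 2 ^ n"
    using assms by (simp add: card_cartesian_product card_Pow)
  also have "\<dots> \<le> 2 ^ n * 2 ^ n * 2 ^ n"
    using card_le by (intro mult_right_mono mult_mono power_increasing) auto
  also have "\<dots> = (8 :: real) ^ n"
    by (simp flip: power_mult_distrib)
  finally show ?thesis .
qed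

section \<open>Multilinear polynomials\<close>

definition multilinear_poly :: "nat set set \<Rightarrow> (nat set \<Rightarrow> real) \<Rightarrow> (nat \<Rightarrow> real) \<Rightarrow> real" where
  "multilinear_poly S a x = (\<Sum>I\<in>S. a I * (\<Prod>i\<in>I. x i))"

definition deletion :: "'b \<Rightarrow> 'b set set \<Rightarrow> 'b set set" where
  "deletion i S = {I \<in> S. i \<notin> I}"

definition link :: "'b \<Rightarrow> 'b set set \<Rightarrow> 'b set set" where
  "link i S = {I. i \<notin> I \<and> insert i I \<in> S}"

lemma deletion_subset_Pow: "S \<subseteq> Pow V \<Longrightarrow> deletion i S \<subseteq> Pow (V - {i})"
  by (auto simp: deletion_def)

lemma link_subset_Pow: "S \<subseteq> Pow V \<Longrightarrow> link i S \<subseteq> Pow (V - {i})"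
  by (auto simp: link_def)

lemma nsets_subset_Pow: "nsets V d \<subseteq> Pow V"
  by (auto simp: mem_nsets_iff)

lemma nsets_Times_subset: "nsets V p \<times> nsets V q \<subseteq> Pow V \<times> Pow V"
  by (intro Sigma_mono nsets_subset_Pow)

lemma sum_deletion_link:
  assumes "finite S"
  shows "(\<Sum>I\<in>S. h I) = (\<Sum>I\<in>deletion i S. h I) + (\<Sum>I\<in>link i S. h (insert i I))"
proof -
  have "(\<Sum>I\<in>link i S. h (insert i I)) = (\<Sum>I\<in>{I \<in> S. i \<in> I}. h I)"
    by (rule sum.reindex_bij_witness[where i = "\<lambda>I. I - {i}" and j = "insert i"])
      (auto simp: link_def insert_absorb)
  moreover have "(\<Sum>I\<in>S. h I) = (\<Sum>I\<in>deletion i S \<union> {I \<in> S. i \<in> I}. h I)"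
    by (intro sum.cong) (auto simp: deletion_def)
  moreover have "\<dots> = (\<Sum>I\<in>deletion i S. h I) + (\<Sum>I\<in>{I \<in> S. i \<in> I}. h I)"
    using assms by (intro sum.union_disjoint) (auto simp: deletion_def)
  ultimately show ?thesis by simp
qed

lemma multilinear_poly_cong:
  assumes "S \<subseteq> Pow V" "\<And>i. i \<in> V \<Longrightarrow> x i = y i"
  shows "multilinear_poly S a x = multilinear_poly S a y"
  unfolding multilinear_poly_def
  using assms by (intro sum.cong refl arg_cong2[where f = "(*)"] prod.cong) auto

lemma multilinear_poly_decompose:
  assumes "finite V" "S \<subseteq> Pow V"
  shows "multilinear_poly S a x = multilinear_poly (deletion i S) a x +
    x i * multilinear_poly (link i S) (\<lambda>I. a (insert i I)) x"
proof -
  have fin_S: "finite S"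
    using assms by (meson finite_Pow_iff finite_subset)
  have "(\<Prod>j\<in>insert i I. x j) = x i * (\<Prod>j\<in>I. x j)" if "I \<in> link i S" for I
    using that link_subset_Pow[OF assms(2), of i] finite_subset[of I V] assms(1)
    by (subst prod.insert) (auto simp: link_def)
  then show ?thesis
    unfolding multilinear_poly_def sum_deletion_link[OF fin_S, of _ i]
    by (simp add: sum_distrib_left mult_ac)
qed

lemma DERIV_multilinear_poly:
  assumes "finite V" "S \<subseteq> Pow V"
  shows "((\<lambda>t. multilinear_poly S a (x(i := t))) has_real_derivative
    multilinear_poly (link i S) (\<lambda>I. a (insert i I)) x) (at s)"
proof -
  have "multilinear_poly S a (x(i := t)) = multilinear_poly (deletion i S) a x +
      t * multilinear_poly (link i S) (\<lambda>I. a (insert i I)) x" for t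
    unfolding multilinear_poly_decompose[OF assms, of a _ i]
    using multilinear_poly_cong[OF deletion_subset_Pow[OF assms(2)], where x = "x(i := t)" and y = x]
      multilinear_poly_cong[OF link_subset_Pow[OF assms(2)], where x = "x(i := t)" and y = x]
    by simp
  then show ?thesis
    by (auto intro!: derivative_eq_intros)
qed

lemma partial_deriv_multilinear_poly:
  assumes "finite V" "S \<subseteq> Pow V"
  shows "partial_deriv i (multilinear_poly S a) = multilinear_poly (link i S) (\<lambda>I. a (insert i I))"
  unfolding partial_deriv_def by (intro ext DERIV_imp_deriv DERIV_multilinear_poly[OF assms])

lemma partial_deriv_multilinear_poly_eq_0:
  assumes "finite V" "S \<subseteq> Pow V" "i \<notin> V"
  shows "partial_deriv i (multilinear_poly S a) x = 0"
proof -
  have "link i S = {}"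
    using assms by (auto simp: link_def)
  then show ?thesis
    using assms by (simp add: partial_deriv_multilinear_poly multilinear_poly_def)
qed

lemma partial_deriv_multilinear_poly_eq_sum:
  assumes "finite V" "S \<subseteq> Pow V"
  shows "partial_deriv i (multilinear_poly S a) x =
    (\<Sum>I\<in>S. if i \<in> I then a I * (\<Prod>j\<in>I - {i}. x j) else 0)"
proof -
  have "finite S"
    using assms by (meson finite_Pow_iff finite_subset)
  then show ?thesis
    unfolding partial_deriv_multilinear_poly[OF assms] multilinear_poly_def
    by (subst sum_deletion_link[of S _ i]) (auto simp: deletion_def link_def intro!: sum.cong)
qed

lemma mult_partial_deriv_multilinear_poly:
  assumes "finite V" "S \<subseteq> Pow V"
  shows "x i * partial_deriv i (multilinear_poly S a) x =
    (\<Sum>I\<in>S. if i \<in> I then a I * (\<Prod>j\<in>I. x j) else 0)"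
proof -
  have "x i * (a I * (\<Prod>j\<in>I - {i}. x j)) = a I * (\<Prod>j\<in>I. x j)" if "I \<in> S" "i \<in> I" for I
    using that assms finite_subset[of I V] by (subst prod.remove[of I i]) auto
  then show ?thesis
    unfolding partial_deriv_multilinear_poly_eq_sum[OF assms] sum_distrib_left
    by (intro sum.cong refl) simp
qed

lemma euler_homogeneous:
  assumes fin_V: "finite V"
  shows "(\<Sum>i\<in>V. x i * partial_deriv i (multilinear_poly (nsets V d) a) x) =
    real d * multilinear_poly (nsets V d) a x"
proof -
  have "(\<Sum>i\<in>V. x i * partial_deriv i (multilinear_poly (nsets V d) a) x) =
      (\<Sum>I\<in>nsets V d. \<Sum>i\<in>V. if i \<in> I then a I * (\<Prod>j\<in>I. x j) else 0)"
    unfolding mult_partial_deriv_multilinear_poly[OF fin_V nsets_subset_Pow] by (rule sum.swap)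
  also have "\<dots> = (\<Sum>I\<in>nsets V d. real d * (a I * (\<Prod>j\<in>I. x j)))"
  proof (rule sum.cong[OF refl])
    fix I assume "I \<in> nsets V d"
    then have "{i \<in> V. i \<in> I} = I" "card I = d"
      by (auto simp: mem_nsets_iff)
    then show "(\<Sum>i\<in>V. if i \<in> I then a I * (\<Prod>j\<in>I. x j) else 0) = real d * (a I * (\<Prod>j\<in>I. x j))"
      using fin_V by (simp flip: sum.inter_filter)
  qed
  finally show ?thesis
    by (simp add: multilinear_poly_def sum_distrib_left)
qed

lemma grad_prod_multilinear_poly:
  assumes "finite V" "V \<subseteq> {1..}" "S \<subseteq> Pow V"
  shows "grad_prod (multilinear_poly S a) Q x =
    (\<Sum>i\<in>V. partial_deriv i (multilinear_poly S a) x * partial_deriv i Q x)"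
proof -
  have "grad_prod (multilinear_poly S a) Q x =
      (\<Sum>\<^sub>\<infinity>i\<in>V. partial_deriv i (multilinear_poly S a) x * partial_deriv i Q x)"
    unfolding grad_prod_def using assms
    by (intro infsum_cong_neutral) (auto simp: partial_deriv_multilinear_poly_eq_0[of V])
  then show ?thesis
    using \<open>finite V\<close> by simp
qed

subsection \<open>Homogeneous polynomials with a given support\<close>

definition supported :: "nat set \<Rightarrow> nat \<Rightarrow> (nat set \<Rightarrow> real) \<Rightarrow> bool" where
  "supported V d a \<longleftrightarrow> finite V \<and> V \<subseteq> {1..} \<and> (\<forall>I\<in>nsets {1..} d. a I \<noteq> 0 \<longrightarrow> I \<subseteq> V)"

lemma supportedD:
  assumes "supported V d a"
  shows "finite V" "V \<subseteq> {1..}" "I \<in> nsets {1..} d \<Longrightarrow> a I \<noteq> 0 \<Longrightarrow> I \<subseteq> V"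
  using assms by (auto simp: supported_def)

lemma supported_superset:
  assumes "supported V d a" "V \<subseteq> W" "finite W" "W \<subseteq> {1..}"
  shows "supported W d a"
  using assms unfolding supported_def by blast

lemma fin_coeffs_supported:
  assumes "fin_coeffs d a"
  obtains V where "supported V d a"
proof
  show "supported (\<Union>{I \<in> nsets {1..} d. a I \<noteq> 0}) d a"
    unfolding supported_def
  proof (intro conjI ballI impI)
    show "finite (\<Union>{I \<in> nsets {1..} d. a I \<noteq> 0})"
      using assms unfolding fin_coeffs_def by (intro finite_Union) (simp_all add: mem_nsets_iff)
    show "\<Union>{I \<in> nsets {1..} d. a I \<noteq> 0} \<subseteq> {1..}"
      by (intro Union_least) (simp add: mem_nsets_iff)
    show "I \<subseteq> \<Union>{I \<in> nsets {1..} d. a I \<noteq> 0}" if "I \<in> nsets {1..} d" "a I \<noteq> 0" for I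
      using that by (intro Union_upper) simp
  qed
qed

lemma fin_coeffs_common_support:
  assumes "fin_coeffs d a" "fin_coeffs k b"
  obtains V where "supported V d a" "supported V k b"
proof -
  obtain V W where supp: "supported V d a" "supported W k b"
    using assms by (metis fin_coeffs_supported)
  note fin_VW = supportedD(1,2)[OF supp(1)] supportedD(1,2)[OF supp(2)]
  have "supported (V \<union> W) d a" "supported (V \<union> W) k b"
    using fin_VW by (intro supported_superset[OF supp(1)] supported_superset[OF supp(2)]; auto)+
  then show thesis
    by (rule that)
qed

lemma hom_poly_eq_multilinear_poly:
  assumes "supported V d a"
  shows "hom_poly d a = multilinear_poly (nsets V d) a"
proof
  fix x
  note fin_V = supportedD(1,2)[OF assms]
  show "hom_poly d a x = multilinear_poly (nsets V d) a x"
    unfolding hom_poly_def multilinear_poly_def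
  proof (rule sum.mono_neutral_left)
    show "finite (nsets V d)"
      using fin_V(1) by (rule finite_imp_finite_nsets)
    show "{I \<in> nsets {1..} d. a I \<noteq> 0} \<subseteq> nsets V d"
      using assms by (auto simp: supported_def mem_nsets_iff)
    show "\<forall>I\<in>nsets V d - {I \<in> nsets {1..} d. a I \<noteq> 0}. a I * (\<Prod>i\<in>I. x i) = 0"
      using nsets_mono[OF fin_V(2), of d] by auto
  qed
qed

lemma partial_deriv_mult_right:
  assumes "\<And>t. Q (x(i := t)) = Q x" "(\<lambda>t. P (x(i := t))) field_differentiable at (x i)"
  shows "partial_deriv i (\<lambda>x. P x * Q x) x = partial_deriv i P x * Q x"
  unfolding partial_deriv_def assms(1) using assms(2) by (rule deriv_cmult_right)

definition mult_monomial :: "'b set \<Rightarrow> ('b set \<Rightarrow> real) \<Rightarrow> 'b set \<Rightarrow> real" where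
  "mult_monomial D b J = (if D \<subseteq> J then b (J - D) else 0)"

lemma support_mult_monomial:
  assumes "finite D" "D \<subseteq> {1..}" "V \<inter> D = {}" "supported V r b"
  shows "{J \<in> nsets {1..} (r + card D). mult_monomial D b J \<noteq> 0} =
    (\<lambda>I. I \<union> D) ` {I \<in> nsets {1..} r. b I \<noteq> 0}" (is "?S = ?f ` ?T")
proof (intro equalityI subsetI)
  fix J assume "J \<in> ?S"
  then have "J \<in> nsets {1..} (r + card D)" "D \<subseteq> J" "b (J - D) \<noteq> 0"
    by (auto simp: mult_monomial_def split: if_splits)
  then have "J - D \<in> ?T" "J = ?f (J - D)"
    using \<open>finite D\<close> by (auto simp: mem_nsets_iff card_Diff_subset)
  then show "J \<in> ?f ` ?T" by (rule rev_image_eqI)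
next
  fix J assume "J \<in> ?f ` ?T"
  then obtain I where I_props: "I \<in> nsets {1..} r" "b I \<noteq> 0" "J = I \<union> D"
    by auto
  then have "I \<inter> D = {}"
    using supportedD(3)[OF assms(4)] assms(3) by blast
  moreover from this have "I \<union> D - D = I" by blast
  ultimately show "J \<in> ?S"
    using I_props assms by (auto simp: mem_nsets_iff mult_monomial_def card_Un_disjoint)
qed

lemma fin_coeffs_mult_monomial:
  assumes "finite D" "D \<subseteq> {1..}" "V \<inter> D = {}" "supported V r b" "fin_coeffs r b"
  shows "fin_coeffs (r + card D) (mult_monomial D b)"
  using assms(5) unfolding fin_coeffs_def support_mult_monomial[OF assms(1-4)] by simp

lemma hom_poly_mult_monomial:
  assumes "finite D" "D \<subseteq> {1..}" "V \<inter> D = {}" "supported V r b"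
  shows "hom_poly (r + card D) (mult_monomial D b) = (\<lambda>x. hom_poly r b x * (\<Prod>i\<in>D. x i))"
proof
  fix x
  let ?T = "{I \<in> nsets {1..} r. b I \<noteq> 0}"
  have disjoint_D: "I \<inter> D = {}" "I \<union> D - D = I" "finite I" if "I \<in> ?T" for I
    using that supportedD(3)[OF assms(4), of I] assms(3) by (auto simp: mem_nsets_iff)
  have "inj_on (\<lambda>I. I \<union> D) ?T"
    by (rule inj_on_inverseI[where g = "\<lambda>J. J - D"]) (rule disjoint_D(2))
  then have "hom_poly (r + card D) (mult_monomial D b) x =
      (\<Sum>I\<in>?T. mult_monomial D b (I \<union> D) * (\<Prod>i\<in>I \<union> D. x i))"
    unfolding hom_poly_def support_mult_monomial[OF assms] by (simp add: sum.reindex)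
  also have "\<dots> = (\<Sum>I\<in>?T. b I * (\<Prod>i\<in>I. x i) * (\<Prod>i\<in>D. x i))"
    using disjoint_D \<open>finite D\<close>
    by (intro sum.cong refl) (simp add: mult_monomial_def prod.union_disjoint)
  finally show "hom_poly (r + card D) (mult_monomial D b) x = hom_poly r b x * (\<Prod>i\<in>D. x i)"
    by (simp add: hom_poly_def sum_distrib_right)
qed

lemma grad_prod_mult_monomial:
  assumes fresh_D: "finite D" "D \<subseteq> {1..}" "V \<inter> D = {}"
    and supp_a: "supported V d a" and supp_b: "supported V r b"
  shows "grad_prod (hom_poly d a) (hom_poly (r + card D) (mult_monomial D b)) x =
    grad_prod (hom_poly d a) (hom_poly r b) x * (\<Prod>i\<in>D. x i)"
proof -
  note fin_V = supportedD(1,2)[OF supp_a]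
  have "partial_deriv i (hom_poly (r + card D) (mult_monomial D b)) x =
      partial_deriv i (hom_poly r b) x * (\<Prod>i\<in>D. x i)" if "i \<in> V" for i
    unfolding hom_poly_mult_monomial[OF fresh_D supp_b]
  proof (rule partial_deriv_mult_right)
    show "(\<Prod>j\<in>D. (x(i := t)) j) = (\<Prod>j\<in>D. x j)" for t
      using that fresh_D(3) by (intro prod.cong) auto
    show "(\<lambda>t. hom_poly r b (x(i := t))) field_differentiable at (x i)"
      unfolding hom_poly_eq_multilinear_poly[OF supp_b]
      unfolding field_differentiable_def
      by (rule exI) (rule DERIV_multilinear_poly[OF fin_V(1) nsets_subset_Pow])
  qed
  then show ?thesis
    unfolding hom_poly_eq_multilinear_poly[OF supp_a] grad_prod_multilinear_poly[OF fin_V nsets_subset_Pow]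
    by (simp add: sum_distrib_right mult.assoc)
qed

section \<open>The Wick expansion of a product\<close>

text \<open>
  \<open>wick (A, B)\<close> is the Wick product of the monomials \<open>G\<^sub>A\<close> and \<open>G\<^sub>B\<close>, and
  \<open>component V d k a b c\<close> is the term \<open>Y\<^sub>c\<close> of \<open>F X\<close>.
\<close>

fun wick :: "nat set \<times> nat set \<Rightarrow> (nat \<Rightarrow> real) \<Rightarrow> real" where
  "wick (A, B) x = (\<Prod>i\<in>sym_diff A B. x i) * (\<Prod>i\<in>A \<inter> B. (x i)\<^sup>2 - 1)"

definition wick_poly ::
  "(nat set \<times> nat set) set \<Rightarrow> (nat set \<times> nat set \<Rightarrow> real) \<Rightarrow> (nat \<Rightarrow> real) \<Rightarrow> real" where
  "wick_poly P u x = (\<Sum>p\<in>P. u p * wick p x)"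

definition component ::
  "nat set \<Rightarrow> nat \<Rightarrow> nat \<Rightarrow> (nat set \<Rightarrow> real) \<Rightarrow> (nat set \<Rightarrow> real) \<Rightarrow> nat \<Rightarrow> (nat \<Rightarrow> real) \<Rightarrow> real" where
  "component V d k a b c = wick_poly (nsets V (d - c) \<times> nsets V (k - c)) (contraction V c a b)"

lemma component_top: "component V d d a a d x = sq_norm V d a"
  by (simp add: component_def wick_poly_def split_coeff_def sq_norm_def power2_eq_square)

lemma prod_mult_prod_eq_sum_wick:
  assumes "finite A" "finite B"
  shows "(\<Prod>i\<in>A. x i) * (\<Prod>i\<in>B. x i) = (\<Sum>D\<in>Pow (A \<inter> B). wick (A - D, B - D) x)"
proof -
  have "(\<Prod>i\<in>A. x i) = (\<Prod>i\<in>A - B. x i) * (\<Prod>i\<in>A \<inter> B. x i)"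
    using assms by (subst prod.union_disjoint[symmetric]) (auto intro!: prod.cong)
  moreover have "(\<Prod>i\<in>B. x i) = (\<Prod>i\<in>B - A. x i) * (\<Prod>i\<in>A \<inter> B. x i)"
    using assms by (subst prod.union_disjoint[symmetric]) (auto intro!: prod.cong)
  moreover have "(\<Prod>i\<in>sym_diff A B. x i) = (\<Prod>i\<in>A - B. x i) * (\<Prod>i\<in>B - A. x i)"
    using assms by (subst prod.union_disjoint) auto
  ultimately have "(\<Prod>i\<in>A. x i) * (\<Prod>i\<in>B. x i) = (\<Prod>i\<in>sym_diff A B. x i) * (\<Prod>i\<in>A \<inter> B. (x i)\<^sup>2)"
    by (simp add: power2_eq_square prod.distrib)
  also have "(\<Prod>i\<in>A \<inter> B. (x i)\<^sup>2) = (\<Prod>i\<in>A \<inter> B. 1 + ((x i)\<^sup>2 - 1))"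
    by simp
  also have "\<dots> = (\<Sum>D\<in>Pow (A \<inter> B). \<Prod>i\<in>A \<inter> B - D. (x i)\<^sup>2 - 1)"
    using assms by (subst prod_add) auto
  also have "(\<Prod>i\<in>sym_diff A B. x i) * \<dots> = (\<Sum>D\<in>Pow (A \<inter> B). wick (A - D, B - D) x)"
    unfolding sum_distrib_left
  proof (rule sum.cong)
    fix D assume "D \<in> Pow (A \<inter> B)"
    then have "sym_diff (A - D) (B - D) = sym_diff A B" "(A - D) \<inter> (B - D) = A \<inter> B - D" by auto
    then show "(\<Prod>i\<in>sym_diff A B. x i) * (\<Prod>i\<in>A \<inter> B - D. (x i)\<^sup>2 - 1) = wick (A - D, B - D) x"
      by simp
  qed simp
  finally show ?thesis .
qed

lemma sum_insert_Pow_remove: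
  fixes h :: "'b set \<Rightarrow> real"
  assumes "finite X"
  shows "(\<Sum>i\<in>X. \<Sum>D\<in>Pow (X - {i}). h (insert i D)) = (\<Sum>C\<in>Pow X. real (card C) * h C)"
proof -
  have "(\<Sum>i\<in>X. \<Sum>D\<in>Pow (X - {i}). h (insert i D)) =
      (\<Sum>(i, D)\<in>Sigma X (\<lambda>i. Pow (X - {i})). h (insert i D))"
    using assms by (intro sum.Sigma) auto
  also have "\<dots> = (\<Sum>(C, i)\<in>Sigma (Pow X) (\<lambda>C. C). h C)"
    by (rule sum.reindex_bij_witness[where i = "\<lambda>(C, i). (i, C - {i})" and j = "\<lambda>(i, D). (insert i D, i)"])
       (auto simp: insert_absorb)
  also have "\<dots> = (\<Sum>C\<in>Pow X. \<Sum>i\<in>C. h C)"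
    using assms by (intro sum.Sigma[symmetric]) (auto intro: finite_subset)
  finally show ?thesis by simp
qed

lemma sum_prod_remove_mult_eq_sum_wick:
  assumes "finite A" "finite B"
  shows "(\<Sum>i\<in>A \<inter> B. (\<Prod>j\<in>A - {i}. x j) * (\<Prod>j\<in>B - {i}. x j)) =
    (\<Sum>C\<in>Pow (A \<inter> B). real (card C) * wick (A - C, B - C) x)"
proof -
  have "(\<Sum>i\<in>A \<inter> B. (\<Prod>j\<in>A - {i}. x j) * (\<Prod>j\<in>B - {i}. x j)) =
      (\<Sum>i\<in>A \<inter> B. \<Sum>D\<in>Pow (A \<inter> B - {i}). wick (A - insert i D, B - insert i D) x)"
  proof (rule sum.cong[OF refl])
    fix i
    have "(A - {i}) \<inter> (B - {i}) = A \<inter> B - {i}" by auto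
    moreover have "A - {i} - D = A - insert i D" "B - {i} - D = B - insert i D" for D by auto
    ultimately show "(\<Prod>j\<in>A - {i}. x j) * (\<Prod>j\<in>B - {i}. x j) =
        (\<Sum>D\<in>Pow (A \<inter> B - {i}). wick (A - insert i D, B - insert i D) x)"
      using assms by (subst prod_mult_prod_eq_sum_wick) (simp_all del: wick.simps)
  qed
  also have "\<dots> = (\<Sum>C\<in>Pow (A \<inter> B). real (card C) * wick (A - C, B - C) x)"
    using assms by (intro sum_insert_Pow_remove) simp
  finally show ?thesis .
qed

lemma sum_wick_eq_sum_component:
  assumes "finite V" and "k \<le> d"
  shows "(\<Sum>I\<in>nsets V d. \<Sum>J\<in>nsets V k. a I * b J * (\<Sum>C\<in>Pow (I \<inter> J). w (card C) * wick (I - C, J - C) x)) =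
    (\<Sum>c\<le>k. w c * component V d k a b c x)" (is "?L = _")
proof -
  let ?h = "\<lambda>I J C. a I * b J * wick (I - C, J - C) x"
  have "?L = (\<Sum>I\<in>nsets V d. \<Sum>J\<in>nsets V k. \<Sum>c\<le>k. w c * (\<Sum>C\<in>nsets (I \<inter> J) c. ?h I J C))"
  proof (intro sum.cong refl)
    fix I J assume "I \<in> nsets V d" "J \<in> nsets V k"
    then have "finite (I \<inter> J)" "card (I \<inter> J) \<le> k"
      by (auto simp: mem_nsets_iff intro: card_mono)
    then show "a I * b J * (\<Sum>C\<in>Pow (I \<inter> J). w (card C) * wick (I - C, J - C) x) =
        (\<Sum>c\<le>k. w c * (\<Sum>C\<in>nsets (I \<inter> J) c. ?h I J C))"
      by (subst sum_Pow_eq_sum_nsets)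
        (auto simp: sum_distrib_left mem_nsets_iff mult_ac simp del: wick.simps intro!: sum.cong)
  qed
  also have "\<dots> = (\<Sum>I\<in>nsets V d. \<Sum>c\<le>k. \<Sum>J\<in>nsets V k. w c * (\<Sum>C\<in>nsets (I \<inter> J) c. ?h I J C))"
    by (intro sum.cong refl sum.swap)
  also have "\<dots> = (\<Sum>c\<le>k. \<Sum>I\<in>nsets V d. \<Sum>J\<in>nsets V k. w c * (\<Sum>C\<in>nsets (I \<inter> J) c. ?h I J C))"
    by (rule sum.swap)
  also have "\<dots> = (\<Sum>c\<le>k. w c * component V d k a b c x)"
    using assms by (intro sum.cong refl)
      (simp add: component_def wick_poly_def sum_contraction_mult sum_distrib_left del: wick.simps)
  finally show ?thesis .
qed

theorem hom_poly_mult_eq_sum_component: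
  assumes "supported V d a" "supported V k b" "k \<le> d"
  shows "hom_poly d a x * hom_poly k b x = (\<Sum>c\<le>k. component V d k a b c x)"
proof -
  have "hom_poly d a x * hom_poly k b x = (\<Sum>I\<in>nsets V d. \<Sum>J\<in>nsets V k.
      a I * b J * ((\<Prod>i\<in>I. x i) * (\<Prod>j\<in>J. x j)))"
    using assms by (simp add: hom_poly_eq_multilinear_poly multilinear_poly_def sum_product mult_ac)
  also have "\<dots> = (\<Sum>I\<in>nsets V d. \<Sum>J\<in>nsets V k.
      a I * b J * (\<Sum>C\<in>Pow (I \<inter> J). 1 * wick (I - C, J - C) x))"
    by (intro sum.cong refl, subst prod_mult_prod_eq_sum_wick)
      (simp_all add: mem_nsets_iff del: wick.simps)
  also have "\<dots> = (\<Sum>c\<le>k. 1 * component V d k a b c x)"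
    using supportedD(1)[OF assms(1)] assms(3) by (rule sum_wick_eq_sum_component)
  finally show ?thesis by simp
qed

theorem grad_prod_eq_sum_component:
  assumes supp_a: "supported V d a" and supp_b: "supported V k b" and "k \<le> d"
  shows "grad_prod (hom_poly d a) (hom_poly k b) x = (\<Sum>c\<le>k. real c * component V d k a b c x)"
proof -
  note fin_V = supportedD(1,2)[OF supp_a]
  let ?D = "\<lambda>c I i. if i \<in> I then c I * (\<Prod>j\<in>I - {i}. x j) else 0"
  have "grad_prod (hom_poly d a) (hom_poly k b) x =
      (\<Sum>i\<in>V. \<Sum>I\<in>nsets V d. \<Sum>J\<in>nsets V k. ?D a I i * ?D b J i)"
    unfolding hom_poly_eq_multilinear_poly[OF supp_a] hom_poly_eq_multilinear_poly[OF supp_b]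
      grad_prod_multilinear_poly[OF fin_V nsets_subset_Pow]
      partial_deriv_multilinear_poly_eq_sum[OF fin_V(1) nsets_subset_Pow] sum_product ..
  also have "\<dots> = (\<Sum>I\<in>nsets V d. \<Sum>i\<in>V. \<Sum>J\<in>nsets V k. ?D a I i * ?D b J i)"
    by (rule sum.swap)
  also have "\<dots> = (\<Sum>I\<in>nsets V d. \<Sum>J\<in>nsets V k. \<Sum>i\<in>V. ?D a I i * ?D b J i)"
    by (intro sum.cong refl sum.swap)
  also have "\<dots> = (\<Sum>I\<in>nsets V d. \<Sum>J\<in>nsets V k.
      a I * b J * (\<Sum>C\<in>Pow (I \<inter> J). real (card C) * wick (I - C, J - C) x))"
  proof (intro sum.cong refl)
    fix I J assume IJ_mem: "I \<in> nsets V d" "J \<in> nsets V k"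
    have "(\<Sum>i\<in>V. ?D a I i * ?D b J i) =
        (\<Sum>i\<in>I \<inter> J. a I * b J * ((\<Prod>j\<in>I - {i}. x j) * (\<Prod>j\<in>J - {i}. x j)))"
      using fin_V(1) IJ_mem by (intro sum.mono_neutral_cong_right) (auto simp: mem_nsets_iff)
    with IJ_mem show "(\<Sum>i\<in>V. ?D a I i * ?D b J i) =
        a I * b J * (\<Sum>C\<in>Pow (I \<inter> J). real (card C) * wick (I - C, J - C) x)"
      by (simp add: mem_nsets_iff sum_prod_remove_mult_eq_sum_wick del: wick.simps flip: sum_distrib_left)
  qed
  also have "\<dots> = (\<Sum>c\<le>k. real c * component V d k a b c x)"
    using fin_V(1) \<open>k \<le> d\<close> by (rule sum_wick_eq_sum_component)
  finally show ?thesis .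
qed

section \<open>Random variables with finite moments\<close>

definition (in prob_space) all_moments :: "('a \<Rightarrow> real) \<Rightarrow> bool" where
  "all_moments f \<longleftrightarrow> f \<in> borel_measurable M \<and> (\<forall>n. integrable M (\<lambda>\<omega>. \<bar>f \<omega>\<bar> ^ n))"

context prob_space
begin

lemma all_moments_integrable: "all_moments f \<Longrightarrow> integrable M f"
  unfolding all_moments_def
  by (rule Bochner_Integration.integrable_bound[of _ "\<lambda>\<omega>. \<bar>f \<omega>\<bar> ^ 1"]) (blast, auto)

lemma all_moments_measurable: "all_moments f \<Longrightarrow> f \<in> borel_measurable M"
  by (simp add: all_moments_def)

lemma all_moments_const: "all_moments (\<lambda>_. c)"
  by (simp add: all_moments_def)

lemma all_moments_add:
  assumes "all_moments f" "all_moments g"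
  shows "all_moments (\<lambda>\<omega>. f \<omega> + g \<omega>)"
  unfolding all_moments_def
proof (intro conjI allI)
  note [measurable] = assms[THEN all_moments_measurable]
  show "(\<lambda>\<omega>. f \<omega> + g \<omega>) \<in> borel_measurable M" by simp
  fix n
  have power_abs_add_le: "\<bar>x + y\<bar> ^ n \<le> 2 ^ n * (\<bar>x\<bar> ^ n + \<bar>y\<bar> ^ n)" for x y :: real
  proof -
    have "\<bar>x + y\<bar> ^ n \<le> (2 * max \<bar>x\<bar> \<bar>y\<bar>) ^ n"
      by (intro power_mono) auto
    also have "\<dots> \<le> 2 ^ n * (\<bar>x\<bar> ^ n + \<bar>y\<bar> ^ n)"
      by (auto simp: power_mult_distrib max_def)
    finally show ?thesis .
  qed
  show "integrable M (\<lambda>\<omega>. \<bar>f \<omega> + g \<omega>\<bar> ^ n)"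
  proof (rule Bochner_Integration.integrable_bound)
    show "integrable M (\<lambda>\<omega>. 2 ^ n * (\<bar>f \<omega>\<bar> ^ n + \<bar>g \<omega>\<bar> ^ n))"
      using assms by (auto simp: all_moments_def)
    show "AE \<omega> in M. norm (\<bar>f \<omega> + g \<omega>\<bar> ^ n) \<le> norm (2 ^ n * (\<bar>f \<omega>\<bar> ^ n + \<bar>g \<omega>\<bar> ^ n))"
      using power_abs_add_le by (auto intro!: AE_I2)
  qed simp
qed

lemma all_moments_mult:
  assumes "all_moments f" "all_moments g"
  shows "all_moments (\<lambda>\<omega>. f \<omega> * g \<omega>)"
  unfolding all_moments_def
proof (intro conjI allI)
  note [measurable] = assms[THEN all_moments_measurable]
  show "(\<lambda>\<omega>. f \<omega> * g \<omega>) \<in> borel_measurable M" by simp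
  fix n
  have power_abs_mult_le: "\<bar>x * y\<bar> ^ n \<le> \<bar>x\<bar> ^ (n * 2) + \<bar>y\<bar> ^ (n * 2)" for x y :: real
    using sum_squares_bound[of "\<bar>x\<bar> ^ n" "\<bar>y\<bar> ^ n"]
      zero_le_power2[of "\<bar>x\<bar> ^ n"] zero_le_power2[of "\<bar>y\<bar> ^ n"]
    unfolding power_mult abs_mult power_mult_distrib by linarith
  show "integrable M (\<lambda>\<omega>. \<bar>f \<omega> * g \<omega>\<bar> ^ n)"
  proof (rule Bochner_Integration.integrable_bound)
    show "integrable M (\<lambda>\<omega>. \<bar>f \<omega>\<bar> ^ (n * 2) + \<bar>g \<omega>\<bar> ^ (n * 2))"
      using assms unfolding all_moments_def by (intro Bochner_Integration.integrable_add) blast+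
    show "AE \<omega> in M. norm (\<bar>f \<omega> * g \<omega>\<bar> ^ n) \<le> norm (\<bar>f \<omega>\<bar> ^ (n * 2) + \<bar>g \<omega>\<bar> ^ (n * 2))"
      using power_abs_mult_le by (auto intro!: AE_I2)
  qed simp
qed

lemma all_moments_diff: "all_moments f \<Longrightarrow> all_moments g \<Longrightarrow> all_moments (\<lambda>\<omega>. f \<omega> - g \<omega>)"
  using all_moments_add[of f "\<lambda>\<omega>. - 1 * g \<omega>"] all_moments_mult[of "\<lambda>_. - 1" g] all_moments_const[of "-1"]
  by simp

lemma all_moments_sum: "(\<And>i. i \<in> I \<Longrightarrow> all_moments (f i)) \<Longrightarrow> all_moments (\<lambda>\<omega>. \<Sum>i\<in>I. f i \<omega>)"
  by (induction I rule: infinite_finite_induct) (auto intro: all_moments_add all_moments_const)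

lemma all_moments_prod: "(\<And>i. i \<in> I \<Longrightarrow> all_moments (f i)) \<Longrightarrow> all_moments (\<lambda>\<omega>. \<Prod>i\<in>I. f i \<omega>)"
  by (induction I rule: infinite_finite_induct) (auto intro: all_moments_mult all_moments_const)

lemma all_moments_power: "all_moments f \<Longrightarrow> all_moments (\<lambda>\<omega>. f \<omega> ^ n)"
  by (induction n) (auto intro: all_moments_mult all_moments_const)

lemma all_moments_poly: "all_moments f \<Longrightarrow> all_moments (\<lambda>\<omega>. poly p (f \<omega>))"
  by (induction p) (auto intro: all_moments_add all_moments_mult all_moments_const)

lemmas all_moments_intros = all_moments_const all_moments_add all_moments_mult all_moments_diff
  all_moments_sum all_moments_prod all_moments_power all_moments_poly

lemma expectation_sum_mult_sum:
  assumes "\<And>i. i \<in> I \<Longrightarrow> all_moments (X i)" "\<And>j. j \<in> J \<Longrightarrow> all_moments (Y j)"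
  shows "expectation (\<lambda>\<omega>. (\<Sum>i\<in>I. u i * X i \<omega>) * (\<Sum>j\<in>J. v j * Y j \<omega>)) =
    (\<Sum>i\<in>I. \<Sum>j\<in>J. u i * v j * expectation (\<lambda>\<omega>. X i \<omega> * Y j \<omega>))"
proof -
  have moments: "all_moments (\<lambda>\<omega>. u i * v j * (X i \<omega> * Y j \<omega>))" if "i \<in> I" "j \<in> J" for i j
    using that by (intro all_moments_intros assms)
  have "expectation (\<lambda>\<omega>. (\<Sum>i\<in>I. u i * X i \<omega>) * (\<Sum>j\<in>J. v j * Y j \<omega>)) =
      expectation (\<lambda>\<omega>. \<Sum>i\<in>I. \<Sum>j\<in>J. u i * v j * (X i \<omega> * Y j \<omega>))"
    by (simp add: sum_product mult_ac)
  also have "\<dots> = (\<Sum>i\<in>I. expectation (\<lambda>\<omega>. \<Sum>j\<in>J. u i * v j * (X i \<omega> * Y j \<omega>)))"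
    by (intro Bochner_Integration.integral_sum all_moments_integrable all_moments_sum moments)
  also have "\<dots> = (\<Sum>i\<in>I. \<Sum>j\<in>J. expectation (\<lambda>\<omega>. u i * v j * (X i \<omega> * Y j \<omega>)))"
    by (intro sum.cong refl Bochner_Integration.integral_sum all_moments_integrable moments)
  finally show ?thesis by simp
qed

lemma expectation_square_sum_orthogonal:
  assumes "finite I" "\<And>i. i \<in> I \<Longrightarrow> all_moments (X i)"
    and "\<And>i j. i \<in> I \<Longrightarrow> j \<in> I \<Longrightarrow> i \<noteq> j \<Longrightarrow> expectation (\<lambda>\<omega>. X i \<omega> * X j \<omega>) = 0"
  shows "expectation (\<lambda>\<omega>. (\<Sum>i\<in>I. u i * X i \<omega>)\<^sup>2) = (\<Sum>i\<in>I. (u i)\<^sup>2 * expectation (\<lambda>\<omega>. (X i \<omega>)\<^sup>2))"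
proof -
  have "expectation (\<lambda>\<omega>. (\<Sum>i\<in>I. u i * X i \<omega>)\<^sup>2) =
      (\<Sum>i\<in>I. \<Sum>j\<in>I. u i * u j * expectation (\<lambda>\<omega>. X i \<omega> * X j \<omega>))"
    using assms(2) by (simp add: power2_eq_square expectation_sum_mult_sum)
  also have "\<dots> = (\<Sum>i\<in>I. \<Sum>j\<in>I. if i = j then (u i)\<^sup>2 * expectation (\<lambda>\<omega>. (X i \<omega>)\<^sup>2) else 0)"
    using assms(3) by (intro sum.cong refl) (auto simp: power2_eq_square)
  finally show ?thesis
    using \<open>finite I\<close> by simp
qed

lemma expectation_abs_le_sqrt:
  assumes "all_moments Z"
  shows "expectation (\<lambda>\<omega>. \<bar>Z \<omega>\<bar>) \<le> sqrt (expectation (\<lambda>\<omega>. (Z \<omega>)\<^sup>2))"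
proof -
  have "integrable M (\<lambda>\<omega>. \<bar>Z \<omega>\<bar>)" "integrable M (\<lambda>\<omega>. (Z \<omega>)\<^sup>2)"
    by (intro integrable_abs all_moments_integrable all_moments_power assms)+
  then have "(expectation (\<lambda>\<omega>. \<bar>Z \<omega>\<bar>))\<^sup>2 \<le> expectation (\<lambda>\<omega>. (Z \<omega>)\<^sup>2)"
    using variance_positive[of "\<lambda>\<omega>. \<bar>Z \<omega>\<bar>"] variance_eq[of "\<lambda>\<omega>. \<bar>Z \<omega>\<bar>"] by simp
  then show ?thesis
    by (rule real_le_rsqrt)
qed

end

section \<open>Hermite polynomials\<close>

primrec hermite :: "nat \<Rightarrow> real poly" where
  "hermite 0 = 1"
| "hermite (Suc n) = [:0, 1:] * hermite n - pderiv (hermite n)"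

lemma pderiv_hermite: "pderiv (hermite n) = smult (real n) (hermite (n - 1))"
proof (induction n)
  case (Suc n)
  have "pderiv (hermite (Suc n)) =
      hermite n + smult (real n) ([:0, 1:] * hermite (n - 1) - pderiv (hermite (n - 1)))"
    using Suc by (simp add: pderiv_diff pderiv_mult pderiv_smult pderiv_pCons smult_diff_right)
  also have "\<dots> = hermite n + smult (real n) (hermite n)"
    by (cases n) simp_all
  finally show ?case
    by (simp add: smult_add_left)
qed simp

lemma integrable_std_normal_poly: "integrable std_normal_distribution (poly p)"
  unfolding poly_altdef
  by (intro Bochner_Integration.integrable_sum Bochner_Integration.integrable_mult_right
      integrable_std_normal_distribution_moment)

lemma integrable_std_normal_poly_mult: "integrable std_normal_distribution (\<lambda>x. poly p x * poly q x)"
  unfolding poly_mult[symmetric] by (rule integrable_std_normal_poly)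

lemma std_normal_moment_Suc:
  "(\<integral>x. x ^ Suc n \<partial>std_normal_distribution) = real n * (\<integral>x. x ^ (n - 1) \<partial>std_normal_distribution)"
proof (cases "even n")
  case True
  then show ?thesis
    using integral_std_normal_distribution_moment_odd[of "Suc n"]
      integral_std_normal_distribution_moment_odd[of "n - 1"]
    by (cases "n = 0") (simp_all del: power_Suc)
next
  case False
  then obtain k where k: "n = 2 * k + 1" by (rule oddE)
  then have "(\<integral>x. x ^ Suc n \<partial>std_normal_distribution) = fact (2 * Suc k) / (2 ^ Suc k * fact (Suc k))"
    using std_normal_distribution_even_moments(1)[of "Suc k"] by simp
  also have "fact (2 * Suc k) = real (2 * k + 2) * (real n * fact (2 * k))"
    by (simp add: k algebra_simps)
  also have "2 ^ Suc k * fact (Suc k) = real (2 * k + 2) * (2 ^ k * fact k)"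
    by (simp add: algebra_simps)
  also have "real (2 * k + 2) * (real n * fact (2 * k)) / (real (2 * k + 2) * (2 ^ k * fact k)) =
      real n * (fact (2 * k) / (2 ^ k * fact k))"
    by (subst mult_divide_mult_cancel_left) simp_all
  finally show ?thesis
    using std_normal_distribution_even_moments(1)[of k] by (simp add: k)
qed

lemma std_normal_integration_by_parts_power_mult:
  "(\<integral>x. x ^ Suc n * poly p x \<partial>std_normal_distribution) =
    (\<integral>x. real n * x ^ (n - 1) * poly p x + x ^ n * poly (pderiv p) x \<partial>std_normal_distribution)"
proof (induction p arbitrary: n)
  case (pCons c p)
  let ?N = std_normal_distribution
  have integrable_mult: "integrable ?N (\<lambda>x. x ^ m * poly q x)" for m q
    using integrable_std_normal_poly_mult[of "monom 1 m" q] by (simp add: poly_monom)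
  have integrable_power: "integrable ?N (\<lambda>x. x ^ m)" for m
    by (rule integrable_std_normal_distribution_moment)
  have "(\<integral>x. x ^ Suc n * poly (pCons c p) x \<partial>?N) = (\<integral>x. c * x ^ Suc n + x ^ Suc (Suc n) * poly p x \<partial>?N)"
    by (simp add: algebra_simps)
  also have "\<dots> = c * (\<integral>x. x ^ Suc n \<partial>?N) + (\<integral>x. x ^ Suc (Suc n) * poly p x \<partial>?N)"
    using integrable_mult[of "Suc (Suc n)" p] integrable_power[of "Suc n"]
    by (subst Bochner_Integration.integral_add) auto
  also have "\<dots> = (\<integral>x. c * (real n * x ^ (n - 1)) \<partial>?N) +
      (\<integral>x. real (Suc n) * x ^ n * poly p x + x ^ Suc n * poly (pderiv p) x \<partial>?N)"
    by (simp add: pCons.IH std_normal_moment_Suc del: power_Suc of_nat_Suc)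
  also have "\<dots> = (\<integral>x. c * (real n * x ^ (n - 1)) +
      (real (Suc n) * x ^ n * poly p x + x ^ Suc n * poly (pderiv p) x) \<partial>?N)"
    using integrable_mult[of n p] integrable_mult[of "Suc n" "pderiv p"] integrable_power[of "n - 1"]
    by (subst Bochner_Integration.integral_add) (auto simp: mult.assoc simp del: of_nat_Suc power_Suc)
  also have "\<dots> = (\<integral>x. real n * x ^ (n - 1) * poly (pCons c p) x + x ^ n * poly (pderiv (pCons c p)) x \<partial>?N)"
    by (cases n) (simp_all add: pderiv_pCons algebra_simps)
  finally show ?case .
qed simp

lemma std_normal_integration_by_parts_poly:
  "(\<integral>x. x * poly p x \<partial>std_normal_distribution) = (\<integral>x. poly (pderiv p) x \<partial>std_normal_distribution)"
  using std_normal_integration_by_parts_power_mult[of 0 p] by simp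

lemma integral_hermite_Suc_mult:
  "(\<integral>x. poly (hermite (Suc m)) x * poly (hermite n) x \<partial>std_normal_distribution) =
    real n * (\<integral>x. poly (hermite m) x * poly (hermite (n - 1)) x \<partial>std_normal_distribution)"
proof -
  let ?N = std_normal_distribution and ?h = "hermite m" and ?g = "hermite n"
  have "(\<integral>x. poly (hermite (Suc m)) x * poly ?g x \<partial>?N) =
      (\<integral>x. x * poly (?h * ?g) x - poly (pderiv ?h) x * poly ?g x \<partial>?N)"
    by (simp add: algebra_simps)
  also have "\<dots> = (\<integral>x. x * poly (?h * ?g) x \<partial>?N) - (\<integral>x. poly (pderiv ?h) x * poly ?g x \<partial>?N)"
    using integrable_std_normal_poly_mult[of "[:0, 1:]" "?h * ?g"]
      integrable_std_normal_poly_mult[of "pderiv ?h" ?g]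
    by (intro Bochner_Integration.integral_diff) simp_all
  also have "(\<integral>x. x * poly (?h * ?g) x \<partial>?N) =
      (\<integral>x. poly ?h x * poly (pderiv ?g) x + poly (pderiv ?h) x * poly ?g x \<partial>?N)"
    unfolding std_normal_integration_by_parts_poly
    by (intro Bochner_Integration.integral_cong refl) (simp add: pderiv_mult mult_ac)
  also have "\<dots> = (\<integral>x. poly ?h x * poly (pderiv ?g) x \<partial>?N) + (\<integral>x. poly (pderiv ?h) x * poly ?g x \<partial>?N)"
    by (intro Bochner_Integration.integral_add integrable_std_normal_poly_mult)
  finally show ?thesis
    by (simp add: pderiv_hermite mult.left_commute)
qed

theorem hermite_orthogonal:
  "(\<integral>x. poly (hermite m) x * poly (hermite n) x \<partial>std_normal_distribution) = (if m = n then fact n else 0)"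
proof (induction m arbitrary: n)
  case 0
  show ?case
  proof (cases n)
    case 0
    interpret N: real_distribution std_normal_distribution
      by (rule real_dist_normal_dist)
    show ?thesis
      using 0 N.prob_space by simp
  next
    case (Suc k)
    then show ?thesis
      using integral_hermite_Suc_mult[of k 0] by (simp del: hermite.simps(2))
  qed
next
  case (Suc m)
  show ?case
    unfolding integral_hermite_Suc_mult Suc.IH by (auto simp: fact_reduce)
qed

section \<open>Polynomials in independent Gaussian variables\<close>

fun multiplicity_in :: "'b set \<times> 'b set \<Rightarrow> 'b \<Rightarrow> nat" where
  "multiplicity_in (A, B) i = of_bool (i \<in> A) + of_bool (i \<in> B)"

lemma poly_hermite_0_1_2:
  "poly (hermite 0) x = 1" "poly (hermite (Suc 0)) x = x" "poly (hermite (Suc (Suc 0))) x = x\<^sup>2 - 1"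
  by (simp_all add: pderiv_pCons power2_eq_square)

lemma wick_eq_prod_hermite:
  assumes "finite V" "p \<in> Pow V \<times> Pow V"
  shows "wick p x = (\<Prod>i\<in>V. poly (hermite (multiplicity_in p i)) (x i))"
proof -
  obtain A B where p_eq: "p = (A, B)" and AB_subset: "A \<subseteq> V" "B \<subseteq> V"
    using assms(2) by (cases p) auto
  define h where "h i = poly (hermite (multiplicity_in p i)) (x i)" for i
  have h_cases: "i \<notin> A \<union> B \<Longrightarrow> h i = 1" "i \<in> sym_diff A B \<Longrightarrow> h i = x i"
    "i \<in> A \<inter> B \<Longrightarrow> h i = (x i)\<^sup>2 - 1" for i
    unfolding h_def p_eq multiplicity_in.simps
    by (cases "i \<in> A"; cases "i \<in> B"; simp add: poly_hermite_0_1_2 del: hermite.simps(2))+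
  have "(\<Prod>i\<in>V. h i) = (\<Prod>i\<in>A \<union> B. h i)"
    using \<open>finite V\<close> AB_subset h_cases(1) by (intro prod.mono_neutral_right) auto
  also have "A \<union> B = sym_diff A B \<union> A \<inter> B"
    by auto
  also have "(\<Prod>i\<in>\<dots>. h i) = (\<Prod>i\<in>sym_diff A B. h i) * (\<Prod>i\<in>A \<inter> B. h i)"
    using AB_subset finite_subset[OF _ \<open>finite V\<close>] by (intro prod.union_disjoint) auto
  also have "\<dots> = wick p x"
    unfolding p_eq wick.simps using h_cases(2,3) by (intro arg_cong2[where f = "(*)"] prod.cong) auto
  finally show ?thesis
    by (simp add: h_def)
qed

lemma prod_fact_multiplicity_eq_gram:
  assumes "finite V" "p \<in> Pow V \<times> Pow V" "q \<in> Pow V \<times> Pow V"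
  shows "(\<Prod>i\<in>V. if multiplicity_in p i = multiplicity_in q i then fact (multiplicity_in p i) else 0) =
    gram p q"
proof -
  obtain A B A' B' where pq_eq: "p = (A, B)" "q = (A', B')"
    and subsets_V: "A \<subseteq> V" "B \<subseteq> V" "A' \<subseteq> V" "B' \<subseteq> V"
    using assms by auto
  have multiplicity_eq_iff: "multiplicity_in p i = multiplicity_in q i \<longleftrightarrow>
      (i \<in> A \<union> B \<longleftrightarrow> i \<in> A' \<union> B') \<and> (i \<in> A \<inter> B \<longleftrightarrow> i \<in> A' \<inter> B')" for i
    by (cases "i \<in> A"; cases "i \<in> B"; cases "i \<in> A'"; cases "i \<in> B'") (simp_all add: pq_eq)
  show ?thesis
  proof (cases "A \<union> B = A' \<union> B' \<and> A \<inter> B = A' \<inter> B'")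
    case True
    then have "multiplicity_in p i = multiplicity_in q i" for i
      unfolding multiplicity_eq_iff by simp
    then have "(\<Prod>i\<in>V. if multiplicity_in p i = multiplicity_in q i then fact (multiplicity_in p i) else 0) =
        (\<Prod>i\<in>V. fact (multiplicity_in p i) :: real)"
      by simp
    also have "\<dots> = (\<Prod>i\<in>A \<inter> B. 2)"
      using subsets_V \<open>finite V\<close> by (intro prod.mono_neutral_cong_right) (auto simp: pq_eq)
    finally show ?thesis
      using True by (simp add: pq_eq)
  next
    case False
    then obtain i where differ: "multiplicity_in p i \<noteq> multiplicity_in q i"
      unfolding multiplicity_eq_iff by (auto simp: set_eq_iff)
    moreover from differ have "i \<in> V"
      using subsets_V unfolding multiplicity_eq_iff by blast
    ultimately have "i \<in> V" "multiplicity_in p i \<noteq> multiplicity_in q i"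
      by simp_all
    with \<open>finite V\<close> have "(\<Prod>i\<in>V. if multiplicity_in p i = multiplicity_in q i
        then fact (multiplicity_in p i) else 0) = (0 :: real)"
      by (intro prod_zero) auto
    then show ?thesis
      unfolding pq_eq gram.simps if_not_P[OF False] .
  qed
qed

definition measurable_in_coords :: "nat set \<Rightarrow> ((nat \<Rightarrow> real) \<Rightarrow> real) \<Rightarrow> bool" where
  "measurable_in_coords V P \<longleftrightarrow>
    P \<in> borel_measurable (PiM V (\<lambda>_. borel)) \<and> (\<forall>x. P (restrict x V) = P x)"

lemma measurable_in_coords_mult:
  "measurable_in_coords V P \<Longrightarrow> measurable_in_coords V Q \<Longrightarrow> measurable_in_coords V (\<lambda>x. P x * Q x)"
  by (auto simp: measurable_in_coords_def)

lemma measurable_in_coords_power: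
  "measurable_in_coords V P \<Longrightarrow> measurable_in_coords V (\<lambda>x. P x ^ n)"
  by (auto simp: measurable_in_coords_def)

lemma measurable_in_coords_sum:
  "(\<And>i. i \<in> A \<Longrightarrow> measurable_in_coords V (P i)) \<Longrightarrow> measurable_in_coords V (\<lambda>x. \<Sum>i\<in>A. P i x)"
  unfolding measurable_in_coords_def by (intro conjI borel_measurable_sum allI sum.cong refl) auto

lemma measurable_in_coords_multilinear_poly:
  assumes "S \<subseteq> Pow V"
  shows "measurable_in_coords V (multilinear_poly S a)"
proof -
  have "multilinear_poly S a \<in> borel_measurable (PiM V (\<lambda>_. borel))"
    unfolding multilinear_poly_def using assms
    by (intro borel_measurable_sum borel_measurable_times borel_measurable_prod
        measurable_component_singleton) auto
  moreover have "multilinear_poly S a (restrict x V) = multilinear_poly S a x" for x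
    using assms by (rule multilinear_poly_cong) simp
  ultimately show ?thesis
    by (simp add: measurable_in_coords_def)
qed

locale gaussian_sequence = prob_space M for M :: "'a measure" +
  fixes G :: "nat \<Rightarrow> 'a \<Rightarrow> real"
  assumes indep_G: "indep_vars (\<lambda>_. borel) G {1..}"
    and distributed_G: "i \<ge> 1 \<Longrightarrow> distributed M lborel (G i) std_normal_density"
begin

abbreviation ev :: "((nat \<Rightarrow> real) \<Rightarrow> real) \<Rightarrow> 'a \<Rightarrow> real" where
  "ev P \<equiv> at_vars G P"

lemma G_measurable[measurable]: "i \<ge> 1 \<Longrightarrow> G i \<in> borel_measurable M"
  using distributed_measurable[OF distributed_G] by simp

lemma distr_G: "i \<ge> 1 \<Longrightarrow> distr M borel (G i) = std_normal_distribution"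
  using distributed_distr_eq_density[OF distributed_G]
  by (metis distr_cong sets_lborel)

lemma expectation_G:
  fixes f :: "real \<Rightarrow> 'b::{banach, second_countable_topology}"
  assumes "i \<ge> 1" "f \<in> borel_measurable borel"
  shows "(\<integral>\<omega>. f (G i \<omega>) \<partial>M) = (\<integral>x. f x \<partial>std_normal_distribution)"
  using assms unfolding distr_G[OF assms(1), symmetric] by (intro integral_distr[symmetric]) auto

lemma all_moments_G: "i \<ge> 1 \<Longrightarrow> all_moments (G i)"
  unfolding all_moments_def
proof (intro conjI allI)
  fix n assume i_pos: "i \<ge> 1"
  have "integrable (distr M borel (G i)) (\<lambda>x. \<bar>x\<bar> ^ n)"
    using integrable_std_normal_moment_abs[of n]
    by (simp add: distr_G[OF i_pos] integrable_density normal_density_nonneg)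
  then show "integrable M (\<lambda>\<omega>. \<bar>G i \<omega>\<bar> ^ n)"
    using i_pos by (subst (asm) integrable_distr_eq) auto
qed simp

lemma all_moments_multilinear_poly:
  assumes "S \<subseteq> Pow V" "V \<subseteq> {1..}"
  shows "all_moments (ev (multilinear_poly S a))"
  using assms unfolding at_vars_def multilinear_poly_def
  by (intro all_moments_intros all_moments_G) auto

lemma all_moments_hom_poly: "all_moments (ev (hom_poly d a))"
  unfolding at_vars_def hom_poly_def
  by (auto intro!: all_moments_intros all_moments_G simp: mem_nsets_iff)

lemma all_moments_partial_deriv:
  assumes "finite V" "S \<subseteq> Pow V" "V \<subseteq> {1..}"
  shows "all_moments (ev (partial_deriv i (multilinear_poly S a)))"
  unfolding partial_deriv_multilinear_poly[OF assms(1,2)]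
  using link_subset_Pow[OF assms(2)] assms(3) by (intro all_moments_multilinear_poly) auto

lemma all_moments_wick:
  assumes "V \<subseteq> {1..}" "p \<in> Pow V \<times> Pow V"
  shows "all_moments (ev (wick p))"
  using assms unfolding at_vars_def by (cases p) (auto intro!: all_moments_intros all_moments_G)

lemma all_moments_wick_poly:
  assumes "V \<subseteq> {1..}" "P \<subseteq> Pow V \<times> Pow V"
  shows "all_moments (ev (wick_poly P u))"
  using assms unfolding at_vars_def wick_poly_def
  by (intro all_moments_intros all_moments_wick[unfolded at_vars_def]) auto

lemma expectation_mult_disjoint:
  assumes "U \<inter> V = {}" "U \<subseteq> {1..}" "V \<subseteq> {1..}"
    and P_props: "measurable_in_coords U P" "integrable M (ev P)"
    and Q_props: "measurable_in_coords V Q" "integrable M (ev Q)"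
  shows "expectation (\<lambda>\<omega>. ev P \<omega> * ev Q \<omega>) = expectation (ev P) * expectation (ev Q)"
proof (rule indep_var_lebesgue_integral)
  have "indep_var borel (P \<circ> (\<lambda>\<omega>. restrict (\<lambda>i. G i \<omega>) U)) borel (Q \<circ> (\<lambda>\<omega>. restrict (\<lambda>i. G i \<omega>) V))"
    using assms unfolding measurable_in_coords_def
    by (intro indep_var_compose[OF indep_var_restrict[OF indep_G]]) auto
  then show "indep_var borel (ev P) borel (ev Q)"
    using P_props Q_props by (simp add: comp_def at_vars_def[abs_def] measurable_in_coords_def)
qed (use P_props Q_props in auto)

subsection \<open>Orthogonality of Wick products\<close>

lemma expectation_wick_mult:
  assumes "finite V" "V \<subseteq> {1..}" "p \<in> Pow V \<times> Pow V" "q \<in> Pow V \<times> Pow V"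
  shows "expectation (\<lambda>\<omega>. ev (wick p) \<omega> * ev (wick q) \<omega>) = gram p q"
proof -
  let ?h = "\<lambda>i x. poly (hermite (multiplicity_in p i)) x * poly (hermite (multiplicity_in q i)) x"
  have [measurable]: "?h i \<in> borel_measurable borel" for i
    by (intro borel_measurable_continuous_onI continuous_intros)
  have "expectation (\<lambda>\<omega>. ev (wick p) \<omega> * ev (wick q) \<omega>) = expectation (\<lambda>\<omega>. \<Prod>i\<in>V. ?h i (G i \<omega>))"
    using assms by (simp add: at_vars_def wick_eq_prod_hermite[of V] prod.distrib)
  also have "\<dots> = (\<Prod>i\<in>V. expectation (\<lambda>\<omega>. ?h i (G i \<omega>)))"
  proof (rule indep_vars_lebesgue_integral[OF \<open>finite V\<close>])
    show "indep_vars (\<lambda>_. borel) (\<lambda>i \<omega>. ?h i (G i \<omega>)) V"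
      using assms(2) by (intro indep_vars_compose2[OF indep_vars_subset[OF indep_G]]) auto
    show "integrable M (\<lambda>\<omega>. ?h i (G i \<omega>))" if "i \<in> V" for i
      using that assms(2) by (intro all_moments_integrable all_moments_intros all_moments_G) auto
  qed
  also have "\<dots> = (\<Prod>i\<in>V. if multiplicity_in p i = multiplicity_in q i
      then fact (multiplicity_in p i) else 0)"
    using assms(2) by (intro prod.cong refl, subst expectation_G) (auto simp: hermite_orthogonal)
  also have "\<dots> = gram p q"
    using assms by (intro prod_fact_multiplicity_eq_gram)
  finally show ?thesis .
qed

lemma expectation_wick_poly_mult:
  assumes "finite V" "V \<subseteq> {1..}" "P \<subseteq> Pow V \<times> Pow V" "Q \<subseteq> Pow V \<times> Pow V"
  shows "expectation (\<lambda>\<omega>. ev (wick_poly P u) \<omega> * ev (wick_poly Q v) \<omega>) =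
    (\<Sum>p\<in>P. \<Sum>q\<in>Q. u p * v q * gram p q)"
proof -
  have moments: "all_moments (ev (wick p))" if "p \<in> P \<union> Q" for p
    using that assms by (intro all_moments_wick[OF assms(2)]) auto
  have "expectation (\<lambda>\<omega>. ev (wick_poly P u) \<omega> * ev (wick_poly Q v) \<omega>) =
      (\<Sum>p\<in>P. \<Sum>q\<in>Q. u p * v q * expectation (\<lambda>\<omega>. ev (wick p) \<omega> * ev (wick q) \<omega>))"
    using moments unfolding at_vars_def wick_poly_def by (intro expectation_sum_mult_sum) auto
  also have "\<dots> = (\<Sum>p\<in>P. \<Sum>q\<in>Q. u p * v q * gram p q)"
    using assms by (intro sum.cong refl, subst expectation_wick_mult[of V]) auto
  finally show ?thesis .
qed

lemma expectation_wick_poly_square_le: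
  assumes "finite V" "V \<subseteq> {1..}" "P \<subseteq> Pow V \<times> Pow V"
    and "\<And>A B. (A, B) \<in> P \<Longrightarrow> card A + card B \<le> n"
  shows "expectation (\<lambda>\<omega>. (ev (wick_poly P u) \<omega>)\<^sup>2) \<le> 8 ^ n * (\<Sum>p\<in>P. (u p)\<^sup>2)"
  unfolding power2_eq_square[of "ev _ _"] expectation_wick_poly_mult[OF assms(1-3,3)]
proof (rule quadratic_form_le_row_sum)
  show "gram p q \<ge> 0" "gram p q = gram q p" for p q :: "nat set \<times> nat set"
    by (rule gram_nonneg gram_commute)+
  have fin_P: "finite P"
    using assms(1) by (intro finite_subset[OF assms(3)]) simp
  show "(\<Sum>q\<in>P. gram p q) \<le> 8 ^ n" if "p \<in> P" for p
    using that assms finite_subset[OF _ \<open>finite V\<close>] by (cases p) (auto intro!: sum_gram_le fin_P)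
qed

lemma expectation_hom_poly_square:
  assumes "supported V d a"
  shows "expectation (\<lambda>\<omega>. (ev (hom_poly d a) \<omega>)\<^sup>2) = sq_norm V d a"
proof -
  note fin_V = supportedD(1,2)[OF assms]
  have finite_nsets: "finite (nsets V d)"
    using fin_V(1) by (rule finite_imp_finite_nsets)
  have hom_poly_eq_wick: "hom_poly d a = wick_poly (nsets V d \<times> {{}}) (\<lambda>(I, _). a I)"
    unfolding hom_poly_eq_multilinear_poly[OF assms]
    by (simp add: fun_eq_iff multilinear_poly_def wick_poly_def sum.cartesian_product')
  have "expectation (\<lambda>\<omega>. (ev (hom_poly d a) \<omega>)\<^sup>2) =
      (\<Sum>I\<in>nsets V d. \<Sum>J\<in>nsets V d. a I * a J * gram (I, {}) (J, {}))"
    using fin_V unfolding hom_poly_eq_wick power2_eq_square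
    by (subst expectation_wick_poly_mult[of V])
      (auto simp: sum.cartesian_product' mem_nsets_iff simp del: gram.simps)
  also have "\<dots> = (\<Sum>I\<in>nsets V d. \<Sum>J\<in>nsets V d. if I = J then (a I)\<^sup>2 else 0)"
    by (intro sum.cong refl) (simp add: power2_eq_square)
  finally show ?thesis
    using finite_nsets by (simp add: sq_norm_def)
qed

lemma all_moments_component: "V \<subseteq> {1..} \<Longrightarrow> all_moments (ev (component V d k a b c))"
  unfolding component_def by (intro all_moments_wick_poly[OF _ nsets_Times_subset])

lemma expectation_component_mult:
  assumes "finite V" "V \<subseteq> {1..}"
  shows "expectation (\<lambda>\<omega>. ev (component V d k a b c) \<omega> * ev (component V d k a b c') \<omega>) =
    (\<Sum>p\<in>nsets V (d - c) \<times> nsets V (k - c). \<Sum>q\<in>nsets V (d - c') \<times> nsets V (k - c').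
      contraction V c a b p * contraction V c' a b q * gram p q)"
  unfolding component_def using assms
  by (rule expectation_wick_poly_mult[OF _ _ nsets_Times_subset nsets_Times_subset])

lemma component_orthogonal:
  assumes fin_V: "finite V" "V \<subseteq> {1..}" and "c \<le> k" "c' \<le> k" "k \<le> d" "c \<noteq> c'"
  shows "expectation (\<lambda>\<omega>. ev (component V d k a b c) \<omega> * ev (component V d k a b c') \<omega>) = 0"
proof -
  have "gram p q = 0"
    if "p \<in> nsets V (d - c) \<times> nsets V (k - c)" "q \<in> nsets V (d - c') \<times> nsets V (k - c')" for p q
    using that assms
    by (cases p; cases q; simp only:) (rule gram_eq_0_if_card_neq; auto simp: mem_nsets_iff)
  then show ?thesis
    unfolding expectation_component_mult[OF fin_V] by (intro sum.neutral ballI) simp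
qed

lemma expectation_sum_component_square:
  assumes "finite V" "V \<subseteq> {1..}" and "k \<le> d" and S_le: "S \<subseteq> {..k}"
  shows "expectation (\<lambda>\<omega>. (\<Sum>c\<in>S. w c * ev (component V d k a b c) \<omega>)\<^sup>2) =
    (\<Sum>c\<in>S. (w c)\<^sup>2 * expectation (\<lambda>\<omega>. (ev (component V d k a b c) \<omega>)\<^sup>2))"
  using assms finite_subset[OF S_le]
  by (intro expectation_square_sum_orthogonal all_moments_component component_orthogonal) auto

lemma expectation_component_square_le:
  assumes fin_V: "finite V" "V \<subseteq> {1..}" and "c \<le> k" "K \<ge> 0" "contraction_bound V d a c K"
  shows "expectation (\<lambda>\<omega>. (ev (component V d k a b c) \<omega>)\<^sup>2) \<le> 8 ^ (d + k) * 2 ^ k * K * sq_norm V k b"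
proof -
  have "expectation (\<lambda>\<omega>. (ev (component V d k a b c) \<omega>)\<^sup>2) \<le>
      8 ^ (d + k) * (\<Sum>p\<in>nsets V (d - c) \<times> nsets V (k - c). (contraction V c a b p)\<^sup>2)"
    unfolding component_def
    by (intro expectation_wick_poly_square_le[OF fin_V nsets_Times_subset]) (auto simp: mem_nsets_iff)
  also have "\<dots> \<le> 8 ^ (d + k) * (K * 2 ^ k * sq_norm V k b)"
    using assms by (intro mult_left_mono sum_contraction_squares_le) auto
  finally show ?thesis
    by (simp add: mult_ac)
qed

theorem fourth_moment_ge:
  assumes supp: "supported V d a" and "d \<ge> 1"
  shows "3 * (sq_norm V d a)\<^sup>2 + (\<Sum>r\<in>{1..<d}. contraction_energy V d a r) \<le>
    expectation (\<lambda>\<omega>. ev (hom_poly d a) \<omega> ^ 4)"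
proof -
  note fin_V = supportedD(1,2)[OF supp]
  let ?Y = "\<lambda>c. ev (component V d d a a c)"
  have "expectation (\<lambda>\<omega>. (?Y 0 \<omega>)\<^sup>2) = (\<Sum>r\<le>d. contraction_energy V d a r)"
    unfolding power2_eq_square[of "ev _ _"] expectation_component_mult[OF fin_V]
    using fin_V(1) by (simp flip: sum_gram_eq_sum_contraction_energy)
  also have "\<dots> = 2 * (sq_norm V d a)\<^sup>2 + (\<Sum>r\<in>{1..<d}. contraction_energy V d a r)"
  proof -
    have "{..d} = insert 0 (insert d {1..<d})"
      using \<open>d \<ge> 1\<close> by auto
    then show ?thesis
      using \<open>d \<ge> 1\<close> by (simp add: contraction_energy_extreme)
  qed
  finally have "3 * (sq_norm V d a)\<^sup>2 + (\<Sum>r\<in>{1..<d}. contraction_energy V d a r) =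
      (\<Sum>c\<in>{0, d}. 1\<^sup>2 * expectation (\<lambda>\<omega>. (?Y c \<omega>)\<^sup>2))"
    using \<open>d \<ge> 1\<close> by (simp add: at_vars_def component_top prob_space)
  also have "\<dots> \<le> (\<Sum>c\<in>{..d}. 1\<^sup>2 * expectation (\<lambda>\<omega>. (?Y c \<omega>)\<^sup>2))"
    by (intro sum_mono2) auto
  also have "\<dots> = expectation (\<lambda>\<omega>. (\<Sum>c\<in>{..d}. 1 * ?Y c \<omega>)\<^sup>2)"
    by (rule expectation_sum_component_square[OF fin_V, symmetric]) auto
  also have "\<dots> = expectation (\<lambda>\<omega>. ev (hom_poly d a) \<omega> ^ 4)"
    by (simp add: at_vars_def power2_eq_square power4_eq_xxxx mult.assoc
        flip: hom_poly_mult_eq_sum_component[OF supp supp])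
  finally show ?thesis .
qed

end

section \<open>Gradient products and operator norms\<close>

definition grad_prod_const :: "nat \<Rightarrow> nat \<Rightarrow> real" where
  "grad_prod_const d k = (\<Sum>c\<le>k. (real c)\<^sup>2) * (8 ^ (d + k) * 2 ^ k)"

lemma grad_prod_const_nonneg: "grad_prod_const d k \<ge> 0"
  unfolding grad_prod_const_def by (intro mult_nonneg_nonneg sum_nonneg) auto

context gaussian_sequence
begin

lemma expectation_lower_components_square_le:
  assumes "finite V" "V \<subseteq> {1..}" and "k \<le> d" "K \<ge> 0"
    and bound: "\<And>c. 1 \<le> c \<Longrightarrow> c < d \<Longrightarrow> contraction_bound V d a c K"
  shows "expectation (\<lambda>\<omega>. (\<Sum>c\<in>{..k} - {d}. real c * ev (component V d k a b c) \<omega>)\<^sup>2) \<le>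
    grad_prod_const d k * K * sq_norm V k b"
proof -
  let ?B = "8 ^ (d + k) * 2 ^ k * K * sq_norm V k b"
  have B_nonneg: "?B \<ge> 0"
    using \<open>K \<ge> 0\<close> by (intro mult_nonneg_nonneg sq_norm_nonneg) auto
  have "expectation (\<lambda>\<omega>. (\<Sum>c\<in>{..k} - {d}. real c * ev (component V d k a b c) \<omega>)\<^sup>2) =
      (\<Sum>c\<in>{..k} - {d}. (real c)\<^sup>2 * expectation (\<lambda>\<omega>. (ev (component V d k a b c) \<omega>)\<^sup>2))"
    using assms by (intro expectation_sum_component_square) auto
  also have "\<dots> \<le> (\<Sum>c\<in>{..k} - {d}. (real c)\<^sup>2 * ?B)"
  proof (rule sum_mono)
    fix c assume c_mem: "c \<in> {..k} - {d}"
    show "(real c)\<^sup>2 * expectation (\<lambda>\<omega>. (ev (component V d k a b c) \<omega>)\<^sup>2) \<le> (real c)\<^sup>2 * ?B"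
    proof (cases "c = 0")
      case False
      with c_mem assms show ?thesis
        by (intro mult_left_mono expectation_component_square_le bound) auto
    qed simp
  qed
  also have "\<dots> \<le> (\<Sum>c\<in>{..k}. (real c)\<^sup>2 * ?B)"
    using B_nonneg by (intro sum_mono2) auto
  also have "\<dots> = grad_prod_const d k * K * sq_norm V k b"
    unfolding grad_prod_const_def sum_distrib_right by (intro sum.cong refl) (simp add: mult_ac)
  finally show ?thesis .
qed

lemma expectation_grad_prod_square_le:
  assumes supp_a: "supported V d a" and supp_b: "supported V k b" and "k < d" "K \<ge> 0"
    and "\<And>c. 1 \<le> c \<Longrightarrow> c < d \<Longrightarrow> contraction_bound V d a c K"
  shows "expectation (\<lambda>\<omega>. (ev (grad_prod (hom_poly d a) (hom_poly k b)) \<omega>)\<^sup>2) \<le>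
    grad_prod_const d k * K * sq_norm V k b"
proof -
  have "{..k} - {d} = {..k}"
    using \<open>k < d\<close> by auto
  then show ?thesis
    using expectation_lower_components_square_le[OF supportedD(1,2)[OF supp_a], of k d K a b] assms
    by (simp add: at_vars_def grad_prod_eq_sum_component[OF supp_a supp_b])
qed

lemma expectation_grad_prod_self_deviation_le:
  assumes supp: "supported V d a" and "d \<ge> 1" "K \<ge> 0"
    and bound: "\<And>c. 1 \<le> c \<Longrightarrow> c < d \<Longrightarrow> contraction_bound V d a c K"
  shows "expectation (\<lambda>\<omega>. (ev (grad_prod (hom_poly d a) (hom_poly d a)) \<omega> / d - sq_norm V d a)\<^sup>2) \<le>
    grad_prod_const d d * K * sq_norm V d a"
proof -
  let ?S = "\<lambda>\<omega>. \<Sum>c\<in>{..d} - {d}. real c * ev (component V d d a a c) \<omega>"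
  have "ev (grad_prod (hom_poly d a) (hom_poly d a)) \<omega> = d * sq_norm V d a + ?S \<omega>" for \<omega>
    using sum.remove[of "{..d}" d "\<lambda>c. real c * component V d d a a c (\<lambda>i. G i \<omega>)"]
    by (simp add: at_vars_def grad_prod_eq_sum_component[OF supp supp] component_top)
  then have "ev (grad_prod (hom_poly d a) (hom_poly d a)) \<omega> / d - sq_norm V d a = ?S \<omega> / d" for \<omega>
    using \<open>d \<ge> 1\<close> by (simp add: add_divide_distrib)
  then have "expectation (\<lambda>\<omega>. (ev (grad_prod (hom_poly d a) (hom_poly d a)) \<omega> / d - sq_norm V d a)\<^sup>2) =
      expectation (\<lambda>\<omega>. (?S \<omega>)\<^sup>2) / (real d)\<^sup>2"
    by (simp add: power_divide)
  also have "\<dots> \<le> expectation (\<lambda>\<omega>. (?S \<omega>)\<^sup>2) / 1"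
    using \<open>d \<ge> 1\<close> by (intro divide_left_mono) auto
  also have "\<dots> \<le> grad_prod_const d d * K * sq_norm V d a"
    using expectation_lower_components_square_le[OF supportedD(1,2)[OF supp] order_refl \<open>K \<ge> 0\<close> bound]
    by simp
  finally show ?thesis .
qed

lemma expectation_full_contraction_square:
  assumes fin_V: "finite V" "V \<subseteq> {1..}"
  shows "expectation (\<lambda>\<omega>. (ev (component V d r a b r) \<omega>)\<^sup>2) =
    (\<Sum>A\<in>nsets V (d - r). (\<Sum>C\<in>nsets V r. split_coeff a A C * b C)\<^sup>2)"
proof -
  have "expectation (\<lambda>\<omega>. (ev (component V d r a b r) \<omega>)\<^sup>2) =
      (\<Sum>A\<in>nsets V (d - r). \<Sum>A'\<in>nsets V (d - r).
        contraction V r a b (A, {}) * contraction V r a b (A', {}) * gram (A, {}) (A', {}))"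
    unfolding power2_eq_square expectation_component_mult[OF fin_V]
    by (simp add: sum.cartesian_product' del: gram.simps)
  also have "\<dots> = (\<Sum>A\<in>nsets V (d - r). \<Sum>A'\<in>nsets V (d - r).
      if A = A' then (contraction V r a b (A, {}))\<^sup>2 else 0)"
    by (intro sum.cong refl) (simp add: power2_eq_square)
  finally show ?thesis
    using fin_V(1) by (simp add: finite_imp_finite_nsets split_coeff_def)
qed

lemma expectation_full_contraction_square_le_grad_prod:
  assumes supp_a: "supported V d a" and supp_b: "supported V r b" and r_range: "1 \<le> r" "r \<le> d"
  shows "expectation (\<lambda>\<omega>. (ev (component V d r a b r) \<omega>)\<^sup>2) \<le>
    expectation (\<lambda>\<omega>. (ev (grad_prod (hom_poly d a) (hom_poly r b)) \<omega>)\<^sup>2)"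
proof -
  let ?E = "\<lambda>c. expectation (\<lambda>\<omega>. (ev (component V d r a b c) \<omega>)\<^sup>2)"
  have "1 * ?E r \<le> (real r)\<^sup>2 * ?E r"
    using r_range by (intro mult_right_mono) auto
  also have "\<dots> \<le> (\<Sum>c\<le>r. (real c)\<^sup>2 * ?E c)"
    by (rule member_le_sum) auto
  also have "\<dots> = expectation (\<lambda>\<omega>. (\<Sum>c\<le>r. real c * ev (component V d r a b c) \<omega>)\<^sup>2)"
    using supportedD(1,2)[OF supp_a] r_range by (intro expectation_sum_component_square[symmetric]) auto
  finally show ?thesis
    using r_range by (simp add: at_vars_def grad_prod_eq_sum_component[OF supp_a supp_b])
qed

section \<open>The semi-norms\<close>

lemma rho_tilde_le_iff:
  assumes "\<epsilon> \<ge> 0"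
  shows "rho_tilde M G k P \<le> ennreal \<epsilon> \<longleftrightarrow>
    (\<forall>b. fin_coeffs k b \<longrightarrow> expectation (\<lambda>\<omega>. (ev (hom_poly k b) \<omega>)\<^sup>2) \<le> 1 \<longrightarrow>
      expectation (\<lambda>\<omega>. (ev (grad_prod P (hom_poly k b)) \<omega>)\<^sup>2) \<le> \<epsilon>\<^sup>2)"
proof -
  have "sqrt x \<le> \<epsilon> \<longleftrightarrow> x \<le> \<epsilon>\<^sup>2" for x
    using real_sqrt_le_iff[of x "\<epsilon>\<^sup>2"] assms by simp
  then show ?thesis
    using assms unfolding rho_tilde_def SUP_le_iff L2_norm_def by (auto simp: ennreal_le_iff)
qed

lemma grad_prod_hom_poly_eq_sum:
  assumes supp_a: "supported V d a" and supp_b: "supported V k b"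
  shows "grad_prod (hom_poly d a) (hom_poly k b) = (\<lambda>x. \<Sum>i\<in>V.
    partial_deriv i (multilinear_poly (nsets V d) a) x *
    partial_deriv i (multilinear_poly (nsets V k) b) x)"
  unfolding hom_poly_eq_multilinear_poly[OF supp_a] hom_poly_eq_multilinear_poly[OF supp_b]
  using supportedD(1,2)[OF supp_a] by (intro ext grad_prod_multilinear_poly nsets_subset_Pow)

lemma all_moments_grad_prod:
  assumes supp_a: "supported V d a" and supp_b: "supported V k b"
  shows "all_moments (ev (grad_prod (hom_poly d a) (hom_poly k b)))"
  unfolding grad_prod_hom_poly_eq_sum[OF supp_a supp_b] at_vars_def using supportedD(1,2)[OF supp_a]
  by (intro all_moments_intros all_moments_partial_deriv[OF _ nsets_subset_Pow, unfolded at_vars_def])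

lemma measurable_in_coords_partial_deriv:
  assumes "finite V"
  shows "measurable_in_coords V (partial_deriv i (multilinear_poly (nsets V d) a))"
  unfolding partial_deriv_multilinear_poly[OF assms nsets_subset_Pow]
  using link_subset_Pow[OF nsets_subset_Pow[of V d], of i]
  by (intro measurable_in_coords_multilinear_poly) auto

lemma expectation_square_mult_fresh_monomial:
  assumes "V \<inter> D = {}" "V \<subseteq> {1..}" "finite D" "D \<subseteq> {1..}"
    and "measurable_in_coords V P" "all_moments (ev P)"
  shows "expectation (\<lambda>\<omega>. (ev (\<lambda>x. P x * (\<Prod>i\<in>D. x i)) \<omega>)\<^sup>2) = expectation (\<lambda>\<omega>. (ev P \<omega>)\<^sup>2)"
proof -
  let ?m = "\<lambda>x :: nat \<Rightarrow> real. \<Prod>i\<in>D. x i"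
  have monomial_eq: "?m = multilinear_poly {D} (\<lambda>_. 1)" "?m = wick (D, {})"
    by (simp_all add: fun_eq_iff multilinear_poly_def)
  have "measurable_in_coords D ?m" "all_moments (ev ?m)"
    using assms unfolding monomial_eq(1)
    by (auto intro!: measurable_in_coords_multilinear_poly all_moments_multilinear_poly)
  then have "expectation (\<lambda>\<omega>. ev (\<lambda>x. (P x)\<^sup>2) \<omega> * ev (\<lambda>x. (?m x)\<^sup>2) \<omega>) =
      expectation (ev (\<lambda>x. (P x)\<^sup>2)) * expectation (ev (\<lambda>x. (?m x)\<^sup>2))"
    using assms unfolding at_vars_def[abs_def]
    by (intro expectation_mult_disjoint[unfolded at_vars_def[abs_def]] measurable_in_coords_power
        all_moments_integrable all_moments_power)
  moreover have "expectation (ev (\<lambda>x. (?m x)\<^sup>2)) = 1"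
    using assms expectation_wick_mult[of D "(D, {})" "(D, {})"] unfolding monomial_eq(2)
    by (simp add: at_vars_def[abs_def] power2_eq_square)
  ultimately show ?thesis
    by (simp add: at_vars_def[abs_def] power_mult_distrib)
qed

text \<open>
  A test polynomial of degree \<open>r\<close> multiplied by \<open>k - r\<close> variables that occur neither in it nor in
  \<open>F\<close> is a test polynomial of degree \<open>k\<close>, and both norms are unchanged.
\<close>

theorem rho_tilde_mono:
  assumes coeffs_a: "fin_coeffs d a" and "r \<le> k"
  shows "rho_tilde M G r (hom_poly d a) \<le> rho_tilde M G k (hom_poly d a)"
  unfolding rho_tilde_def
proof (rule SUP_mono, clarify)
  fix b assume b_admissible: "fin_coeffs r b" "L2_norm M (ev (hom_poly r b)) \<le> 1"
  obtain V where supp: "supported V d a" "supported V r b"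
    using coeffs_a b_admissible(1) by (rule fin_coeffs_common_support)
  note fin_V = supportedD(1,2)[OF supp(1)]
  have "infinite ({1 :: nat..} - V)"
    using fin_V(1) by (intro Diff_infinite_finite) (auto simp: infinite_Ici)
  then obtain D where "D \<subseteq> {1..} - V" "finite D" "card D = k - r"
    using infinite_arbitrarily_large by blast
  then have fresh_D: "finite D" "D \<subseteq> {1..}" "V \<inter> D = {}" and k_eq: "k = r + card D"
    using \<open>r \<le> k\<close> by auto
  note fresh = expectation_square_mult_fresh_monomial[OF fresh_D(3) fin_V(2) fresh_D(1,2)]
  have "expectation (\<lambda>\<omega>. (ev (hom_poly k (mult_monomial D b)) \<omega>)\<^sup>2) =
      expectation (\<lambda>\<omega>. (ev (hom_poly r b) \<omega>)\<^sup>2)"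
    unfolding k_eq hom_poly_mult_monomial[OF fresh_D supp(2)]
    using measurable_in_coords_multilinear_poly[OF nsets_subset_Pow, of V r b] all_moments_hom_poly[of r b]
    by (intro fresh) (simp_all add: hom_poly_eq_multilinear_poly[OF supp(2)])
  moreover have "expectation (\<lambda>\<omega>. (ev (grad_prod (hom_poly d a) (hom_poly k (mult_monomial D b))) \<omega>)\<^sup>2) =
      expectation (\<lambda>\<omega>. (ev (grad_prod (hom_poly d a) (hom_poly r b)) \<omega>)\<^sup>2)"
    unfolding k_eq grad_prod_mult_monomial[OF fresh_D supp, abs_def]
  proof (rule fresh)
    show "measurable_in_coords V (grad_prod (hom_poly d a) (hom_poly r b))"
      unfolding grad_prod_hom_poly_eq_sum[OF supp] using fin_V(1)
      by (intro measurable_in_coords_sum measurable_in_coords_mult measurable_in_coords_partial_deriv)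
  qed (rule all_moments_grad_prod[OF supp])
  moreover have "fin_coeffs k (mult_monomial D b)"
    unfolding k_eq using fresh_D supp(2) b_admissible(1) by (rule fin_coeffs_mult_monomial)
  ultimately show "\<exists>c\<in>{c. fin_coeffs k c \<and> L2_norm M (ev (hom_poly k c)) \<le> 1}.
      ennreal (L2_norm M (ev (grad_prod (hom_poly d a) (hom_poly r b)))) \<le>
      ennreal (L2_norm M (ev (grad_prod (hom_poly d a) (hom_poly k c))))"
    using b_admissible(2) by (intro bexI[of _ "mult_monomial D b"]) (simp_all add: L2_norm_def)
qed

lemma contraction_bound_of_rho_tilde_same_degree:
  assumes supp_a: "supported V d a" and r_range: "1 \<le> r" "r \<le> d"
    and \<rho>: "rho_tilde M G r (hom_poly d a) \<le> ennreal \<epsilon>" and "\<epsilon> \<ge> 0"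
  shows "contraction_bound V d a r (\<epsilon>\<^sup>2)"
  unfolding contraction_bound_def
proof (rule matrix_boundI_unit)
  note fin_V = supportedD(1,2)[OF supp_a]
  show finite_nsets: "finite (nsets V r)"
    using fin_V(1) by (rule finite_imp_finite_nsets)
  fix v assume v_unit: "(\<Sum>C\<in>nsets V r. (v C)\<^sup>2) = (1 :: real)"
  define b where "b C = (if C \<in> nsets V r then v C else 0)" for C
  have supp_b: "supported V r b"
    using fin_V by (auto simp: supported_def b_def mem_nsets_iff)
  have "fin_coeffs r b"
    unfolding fin_coeffs_def by (rule finite_subset[OF _ finite_nsets]) (auto simp: b_def)
  moreover have "expectation (\<lambda>\<omega>. (ev (hom_poly r b) \<omega>)\<^sup>2) = 1"
    unfolding expectation_hom_poly_square[OF supp_b] sq_norm_def using v_unit by (simp add: b_def)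
  ultimately have "expectation (\<lambda>\<omega>. (ev (grad_prod (hom_poly d a) (hom_poly r b)) \<omega>)\<^sup>2) \<le> \<epsilon>\<^sup>2"
    using \<rho> unfolding rho_tilde_le_iff[OF \<open>\<epsilon> \<ge> 0\<close>] by simp
  then have "expectation (\<lambda>\<omega>. (ev (component V d r a b r) \<omega>)\<^sup>2) \<le> \<epsilon>\<^sup>2"
    using expectation_full_contraction_square_le_grad_prod[OF supp_a supp_b r_range] by linarith
  then show "(\<Sum>A\<in>nsets V (d - r). (\<Sum>C\<in>nsets V r. split_coeff a A C * v C)\<^sup>2) \<le> \<epsilon>\<^sup>2"
    unfolding expectation_full_contraction_square[OF fin_V] by (simp add: b_def)
qed

lemma contraction_bound_of_rho_tilde:
  assumes coeffs_supp: "fin_coeffs d a" "supported V d a" and k_range: "d div 2 \<le> k" "k < d"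
    and \<rho>: "rho_tilde M G k (hom_poly d a) \<le> ennreal \<epsilon>" and "\<epsilon> \<ge> 0" and r_range: "1 \<le> r" "r < d"
  shows "contraction_bound V d a r (\<epsilon>\<^sup>2)"
proof -
  have bound_le_k: "contraction_bound V d a c (\<epsilon>\<^sup>2)" if "1 \<le> c" "c \<le> k" for c
  proof (rule contraction_bound_of_rho_tilde_same_degree)
    show "rho_tilde M G c (hom_poly d a) \<le> ennreal \<epsilon>"
      using rho_tilde_mono[OF coeffs_supp(1) \<open>c \<le> k\<close>] \<rho> by (rule order_trans)
  qed (use that k_range coeffs_supp(2) \<open>\<epsilon> \<ge> 0\<close> in auto)
  show ?thesis
  proof (cases "r \<le> k")
    case True
    then show ?thesis using r_range by (intro bound_le_k)
  next
    case False
    then have "contraction_bound V d a (d - r) (\<epsilon>\<^sup>2)"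
      using r_range k_range by (intro bound_le_k) auto
    then have "contraction_bound V d a (d - (d - r)) (\<epsilon>\<^sup>2)"
      by (rule contraction_bound_transpose) auto
    then show ?thesis using r_range by simp
  qed
qed

lemma contraction_bound_of_fourth_moment:
  assumes supp: "supported V d a" and c_range: "1 \<le> c" "c < d"
  shows "contraction_bound V d a c
    (sqrt (expectation (\<lambda>\<omega>. ev (hom_poly d a) \<omega> ^ 4) - 3 * (sq_norm V d a)\<^sup>2))"
  unfolding contraction_bound_def
proof (rule matrix_bound_mono[OF contraction_bound_energy[unfolded contraction_bound_def]])
  have "contraction_energy V d a c \<le> (\<Sum>r\<in>{1..<d}. contraction_energy V d a r)"
    using c_range by (intro member_le_sum contraction_energy_nonneg) auto
  also have "\<dots> \<le> expectation (\<lambda>\<omega>. ev (hom_poly d a) \<omega> ^ 4) - 3 * (sq_norm V d a)\<^sup>2"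
    using fourth_moment_ge[OF supp] c_range by simp
  finally show "sqrt (contraction_energy V d a c) \<le>
      sqrt (expectation (\<lambda>\<omega>. ev (hom_poly d a) \<omega> ^ 4) - 3 * (sq_norm V d a)\<^sup>2)"
    by simp
qed

theorem rho_tilde_le_fourth_moment:
  assumes normalized: "fin_coeffs d a" "expectation (\<lambda>\<omega>. (ev (hom_poly d a) \<omega>)\<^sup>2) = 1" and "d \<ge> 1"
  shows "rho_tilde M G (d - 1) (hom_poly d a) \<le>
    ennreal (sqrt (grad_prod_const d (d - 1) * sqrt (expectation (\<lambda>\<omega>. ev (hom_poly d a) \<omega> ^ 4) - 3)))"
proof -
  define m where "m = expectation (\<lambda>\<omega>. ev (hom_poly d a) \<omega> ^ 4) - 3"
  have sq_norm_eq_1: "sq_norm V d a = 1" if "supported V d a" for V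
    using normalized(2) expectation_hom_poly_square[OF that] by simp
  obtain U where supp_U: "supported U d a"
    using normalized(1) by (rule fin_coeffs_supported)
  have "(\<Sum>r\<in>{1..<d}. contraction_energy U d a r) \<ge> 0"
    by (intro sum_nonneg contraction_energy_nonneg)
  then have "m \<ge> 0"
    using fourth_moment_ge[OF supp_U \<open>d \<ge> 1\<close>] sq_norm_eq_1[OF supp_U] by (simp add: m_def)
  have "expectation (\<lambda>\<omega>. (ev (grad_prod (hom_poly d a) (hom_poly (d - 1) b)) \<omega>)\<^sup>2) \<le>
      grad_prod_const d (d - 1) * sqrt m"
    if b_admissible: "fin_coeffs (d - 1) b" "expectation (\<lambda>\<omega>. (ev (hom_poly (d - 1) b) \<omega>)\<^sup>2) \<le> 1" for b
  proof -
    obtain V where supp_V: "supported V d a" "supported V (d - 1) b"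
      using normalized(1) b_admissible(1) by (rule fin_coeffs_common_support)
    have "expectation (\<lambda>\<omega>. (ev (grad_prod (hom_poly d a) (hom_poly (d - 1) b)) \<omega>)\<^sup>2) \<le>
        grad_prod_const d (d - 1) * sqrt m * sq_norm V (d - 1) b"
      using contraction_bound_of_fourth_moment[OF supp_V(1)] sq_norm_eq_1[OF supp_V(1)] \<open>d \<ge> 1\<close> \<open>m \<ge> 0\<close>
      by (intro expectation_grad_prod_square_le[OF supp_V]) (auto simp: m_def)
    also have "\<dots> \<le> grad_prod_const d (d - 1) * sqrt m * 1"
      using b_admissible(2) expectation_hom_poly_square[OF supp_V(2)] \<open>m \<ge> 0\<close> grad_prod_const_nonneg
      by (intro mult_left_mono) auto
    finally show ?thesis by simp
  qed
  then show ?thesis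
    using \<open>m \<ge> 0\<close> grad_prod_const_nonneg[of d "d - 1"] by (subst rho_tilde_le_iff) (auto simp: m_def)
qed

end

section \<open>Hypercontractivity\<close>

lemma power2_mult_le_weighted:
  fixes p q \<alpha> :: real
  assumes "p \<ge> 0" "q \<ge> 0" "\<alpha> > 0"
  shows "p\<^sup>2 * q \<le> (2 * \<alpha> * p ^ 3 + q ^ 3 / \<alpha>\<^sup>2) / 3"
proof -
  define r where "r = q / \<alpha>"
  have q_eq: "q = \<alpha> * r" and "r \<ge> 0"
    using assms by (simp_all add: r_def)
  have "(2 * \<alpha> * p ^ 3 + q ^ 3 / \<alpha>\<^sup>2) / 3 - p\<^sup>2 * q = \<alpha> * ((p - r)\<^sup>2 * (2 * p + r)) / 3"
    using \<open>\<alpha> > 0\<close> unfolding q_eq by (simp add: power2_eq_square power3_eq_cube field_simps)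
  moreover have "\<alpha> * ((p - r)\<^sup>2 * (2 * p + r)) / 3 \<ge> 0"
    using assms \<open>r \<ge> 0\<close> by simp
  ultimately show ?thesis by linarith
qed

text \<open>The optimal weight is \<open>v / u\<close>; the perturbation by \<open>e\<close> covers the case that \<open>u\<close> or \<open>v\<close> is 0.\<close>

lemma le_power2_mult_if_le_weighted:
  fixes u v z :: real
  assumes "u \<ge> 0" "v \<ge> 0" and weighted_le: "\<And>\<alpha>. \<alpha> > 0 \<Longrightarrow> z \<le> (2 * \<alpha> * u ^ 3 + v ^ 3 / \<alpha>\<^sup>2) / 3"
  shows "z \<le> u\<^sup>2 * v"
proof -
  have "z \<le> (u + e)\<^sup>2 * (v + e)" if "e > 0" for e
  proof -
    let ?\<alpha> = "(v + e) / (u + e)"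
    have shift_pos: "u + e > 0" "v + e > 0"
      using assms that by auto
    then have "z \<le> (2 * ?\<alpha> * u ^ 3 + v ^ 3 / ?\<alpha>\<^sup>2) / 3"
      by (intro weighted_le) simp
    also have "\<dots> \<le> (2 * ?\<alpha> * (u + e) ^ 3 + (v + e) ^ 3 / ?\<alpha>\<^sup>2) / 3"
      using assms that shift_pos by (intro divide_right_mono add_mono mult_left_mono power_mono) auto
    also have "\<dots> = (u + e)\<^sup>2 * (v + e)"
      using shift_pos by (simp add: power2_eq_square power3_eq_cube)
    finally show ?thesis .
  qed
  moreover have "((\<lambda>e. (u + e)\<^sup>2 * (v + e)) \<longlongrightarrow> (u + 0)\<^sup>2 * (v + 0)) (at_right 0)"
    by (intro tendsto_intros)
  ultimately have "z \<le> (u + 0)\<^sup>2 * (v + 0)"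
    by (intro tendsto_lowerbound[of _ _ "at_right 0"]) (auto intro!: eventually_at_rightI[of 0 1])
  then show ?thesis by simp
qed

lemma (in prob_space) expectation_power2_mult_le:
  assumes moments: "all_moments U" "all_moments V" and nonneg: "\<And>\<omega>. U \<omega> \<ge> 0" "\<And>\<omega>. V \<omega> \<ge> 0"
    and cube_le: "expectation (\<lambda>\<omega>. U \<omega> ^ 3) \<le> u ^ 3" "expectation (\<lambda>\<omega>. V \<omega> ^ 3) \<le> v ^ 3"
    and "u \<ge> 0" "v \<ge> 0"
  shows "expectation (\<lambda>\<omega>. (U \<omega>)\<^sup>2 * V \<omega>) \<le> u\<^sup>2 * v"
proof (rule le_power2_mult_if_le_weighted[OF \<open>u \<ge> 0\<close> \<open>v \<ge> 0\<close>])
  fix \<alpha> :: real assume "\<alpha> > 0"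
  have integrable_cube: "integrable M (\<lambda>\<omega>. U \<omega> ^ 3)" "integrable M (\<lambda>\<omega>. V \<omega> ^ 3)"
    by (intro all_moments_integrable all_moments_intros moments)+
  have "expectation (\<lambda>\<omega>. (U \<omega>)\<^sup>2 * V \<omega>) \<le>
      expectation (\<lambda>\<omega>. (2 * \<alpha> * U \<omega> ^ 3 + V \<omega> ^ 3 / \<alpha>\<^sup>2) / 3)"
  proof (rule integral_mono)
    show "integrable M (\<lambda>\<omega>. (U \<omega>)\<^sup>2 * V \<omega>)"
      by (intro all_moments_integrable all_moments_intros moments)
    show "integrable M (\<lambda>\<omega>. (2 * \<alpha> * U \<omega> ^ 3 + V \<omega> ^ 3 / \<alpha>\<^sup>2) / 3)"
      using integrable_cube by simp
  qed (use nonneg \<open>\<alpha> > 0\<close> in \<open>rule power2_mult_le_weighted\<close>)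
  also have "\<dots> = (2 * \<alpha> * expectation (\<lambda>\<omega>. U \<omega> ^ 3) + expectation (\<lambda>\<omega>. V \<omega> ^ 3) / \<alpha>\<^sup>2) / 3"
    using integrable_cube by simp
  also have "\<dots> \<le> (2 * \<alpha> * u ^ 3 + v ^ 3 / \<alpha>\<^sup>2) / 3"
    using cube_le \<open>\<alpha> > 0\<close> by (intro divide_right_mono add_mono mult_left_mono) auto
  finally show "expectation (\<lambda>\<omega>. (U \<omega>)\<^sup>2 * V \<omega>) \<le> (2 * \<alpha> * u ^ 3 + v ^ 3 / \<alpha>\<^sup>2) / 3" .
qed

context gaussian_sequence
begin

lemma moment_G:
  assumes "i \<ge> 1"
  shows "expectation (\<lambda>\<omega>. G i \<omega> ^ n) = (if even n then fact n / (2 ^ (n div 2) * fact (n div 2)) else 0)"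
  using expectation_G[OF assms, of "\<lambda>x. x ^ n"] std_normal_distribution_even_moments(1)[of "n div 2"]
  by (cases "even n") (simp_all add: integral_std_normal_distribution_moment_odd)

lemma sixth_moment_add_G_mult:
  assumes i_fresh: "i \<notin> W" "i \<ge> 1" "W \<subseteq> {1..}"
    and P_props: "measurable_in_coords W P" "all_moments (ev P)"
    and Q_props: "measurable_in_coords W Q" "all_moments (ev Q)"
  shows "expectation (\<lambda>\<omega>. (ev P \<omega> + G i \<omega> * ev Q \<omega>) ^ 6) =
    expectation (\<lambda>\<omega>. ev P \<omega> ^ 6) + 15 * expectation (\<lambda>\<omega>. ev P \<omega> ^ 4 * ev Q \<omega> ^ 2) +
    45 * expectation (\<lambda>\<omega>. ev P \<omega> ^ 2 * ev Q \<omega> ^ 4) + 15 * expectation (\<lambda>\<omega>. ev Q \<omega> ^ 6)"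
proof -
  have coords_i: "measurable_in_coords {i} (\<lambda>x. x i)"
    by (simp add: measurable_in_coords_def)
  have expectation_factor: "expectation (\<lambda>\<omega>. G i \<omega> ^ j * (ev P \<omega> ^ m * ev Q \<omega> ^ n)) =
      expectation (\<lambda>\<omega>. G i \<omega> ^ j) * expectation (\<lambda>\<omega>. ev P \<omega> ^ m * ev Q \<omega> ^ n)" for j m n
  proof -
    have "integrable M (\<lambda>\<omega>. G i \<omega> ^ j)" "integrable M (\<lambda>\<omega>. ev P \<omega> ^ m * ev Q \<omega> ^ n)"
      using P_props Q_props i_fresh
      by (intro all_moments_integrable all_moments_intros all_moments_G; simp)+
    then show ?thesis
      using expectation_mult_disjoint[of "{i}" W "\<lambda>x. x i ^ j" "\<lambda>x. P x ^ m * Q x ^ n"] i_fresh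
        measurable_in_coords_power[OF coords_i, of j]
        measurable_in_coords_mult[OF measurable_in_coords_power[OF P_props(1), of m]
          measurable_in_coords_power[OF Q_props(1), of n]]
      by (simp add: at_vars_def[abs_def])
  qed
  have "integrable M (\<lambda>\<omega>. G i \<omega> ^ j * (ev P \<omega> ^ m * ev Q \<omega> ^ n))" for j m n
    using P_props Q_props i_fresh by (intro all_moments_integrable all_moments_intros all_moments_G)
  then have "expectation (\<lambda>\<omega>. \<Sum>j\<le>6. real (6 choose j) * (G i \<omega> ^ j * (ev P \<omega> ^ (6 - j) * ev Q \<omega> ^ j))) =
      (\<Sum>j\<le>6. real (6 choose j) *
        (expectation (\<lambda>\<omega>. G i \<omega> ^ j) * expectation (\<lambda>\<omega>. ev P \<omega> ^ (6 - j) * ev Q \<omega> ^ j)))"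
    by (subst Bochner_Integration.integral_sum) (auto simp: expectation_factor)
  moreover have "(ev P \<omega> + G i \<omega> * ev Q \<omega>) ^ 6 =
      (\<Sum>j\<le>6. real (6 choose j) * (G i \<omega> ^ j * (ev P \<omega> ^ (6 - j) * ev Q \<omega> ^ j)))" for \<omega>
    unfolding add.commute[of "ev P \<omega>"] by (simp only: binomial_ring power_mult_distrib mult_ac)
  moreover have "{..6 :: nat} = {0, 1, 2, 3, 4, 5, 6}"
    by auto
  moreover have "(6 :: nat) choose 2 = 15" "(6 :: nat) choose 4 = 15" "(6 :: nat) choose 6 = 1"
    by (simp_all add: numeral_eq_Suc)
  moreover have "expectation (\<lambda>\<omega>. G i \<omega>) = 0"
    using moment_G[OF i_fresh(2), of 1] by simp
  ultimately show ?thesis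
    by (simp add: moment_G[OF i_fresh(2)] fact_numeral prob_space)
qed

text \<open>The constant 5 is such that \<open>(x + 5 y)\<^sup>3\<close> dominates the binomial expansion of the sixth moment.\<close>

lemma sixth_moment_add_G_mult_le:
  assumes i_fresh: "i \<notin> W" "i \<ge> 1" "W \<subseteq> {1..}"
    and P_props: "measurable_in_coords W P" "all_moments (ev P)" "expectation (\<lambda>\<omega>. ev P \<omega> ^ 6) \<le> x ^ 3"
    and Q_props: "measurable_in_coords W Q" "all_moments (ev Q)" "expectation (\<lambda>\<omega>. ev Q \<omega> ^ 6) \<le> y ^ 3"
    and xy_nonneg: "x \<ge> 0" "y \<ge> 0"
  shows "expectation (\<lambda>\<omega>. (ev P \<omega> + G i \<omega> * ev Q \<omega>) ^ 6) \<le> (x + 5 * y) ^ 3"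
proof -
  have power_eq_square_power: "z ^ 6 = (z\<^sup>2) ^ 3" "z ^ 4 = (z\<^sup>2)\<^sup>2" for z :: real
    by (simp_all flip: power_mult)
  have "expectation (\<lambda>\<omega>. ev P \<omega> ^ 4 * ev Q \<omega> ^ 2) \<le> x\<^sup>2 * y"
    using P_props Q_props xy_nonneg unfolding power_eq_square_power
    by (intro expectation_power2_mult_le all_moments_power) auto
  moreover have "expectation (\<lambda>\<omega>. ev P \<omega> ^ 2 * ev Q \<omega> ^ 4) \<le> y\<^sup>2 * x"
    using P_props Q_props xy_nonneg unfolding power_eq_square_power mult.commute[of "ev P _ ^ 2"]
    by (intro expectation_power2_mult_le all_moments_power) auto
  ultimately have "expectation (\<lambda>\<omega>. (ev P \<omega> + G i \<omega> * ev Q \<omega>) ^ 6) \<le>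
      x ^ 3 + 15 * (x\<^sup>2 * y) + 45 * (y\<^sup>2 * x) + 15 * y ^ 3"
    unfolding sixth_moment_add_G_mult[OF i_fresh P_props(1,2) Q_props(1,2)]
    using P_props(3) Q_props(3) by (intro add_mono mult_left_mono) auto
  also have "\<dots> \<le> (x + 5 * y) ^ 3"
  proof -
    have "(x + 5 * y) ^ 3 =
        x ^ 3 + 15 * (x\<^sup>2 * y) + 45 * (y\<^sup>2 * x) + 15 * y ^ 3 + (30 * (y\<^sup>2 * x) + 110 * y ^ 3)"
      by (simp add: power2_eq_square power3_eq_cube algebra_simps)
    then show ?thesis using xy_nonneg by simp
  qed
  finally show ?thesis .
qed

theorem sixth_moment_multilinear_poly_le:
  assumes "finite W" "W \<subseteq> {1..}" "S \<subseteq> Pow W"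
  shows "expectation (\<lambda>\<omega>. ev (multilinear_poly S a) \<omega> ^ 6) \<le> (\<Sum>I\<in>S. 5 ^ card I * (a I)\<^sup>2) ^ 3"
  using assms
proof (induction W arbitrary: S a rule: finite_induct)
  case empty
  then have "S = {} \<or> S = {{}}" by auto
  then show ?case
    by (auto simp: at_vars_def multilinear_poly_def prob_space simp flip: power_mult)
next
  case (insert i W)
  let ?S = "deletion i S" and ?T = "link i S" and ?a = "\<lambda>I. a (insert i I)"
  have vars: "finite (insert i W)" "W \<subseteq> {1..}" "i \<ge> 1"
    using insert.hyps insert.prems by auto
  have subset_W: "?S \<subseteq> Pow W" "?T \<subseteq> Pow W"
    using deletion_subset_Pow[OF insert.prems(2), of i] link_subset_Pow[OF insert.prems(2), of i]
      insert.hyps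
    by auto
  have "expectation (\<lambda>\<omega>. ev (multilinear_poly S a) \<omega> ^ 6) =
      expectation (\<lambda>\<omega>. (ev (multilinear_poly ?S a) \<omega> + G i \<omega> * ev (multilinear_poly ?T ?a) \<omega>) ^ 6)"
    by (simp add: at_vars_def multilinear_poly_decompose[OF vars(1) insert.prems(2), of a _ i])
  also have "\<dots> \<le> ((\<Sum>I\<in>?S. 5 ^ card I * (a I)\<^sup>2) + 5 * (\<Sum>I\<in>?T. 5 ^ card I * (?a I)\<^sup>2)) ^ 3"
    using insert.hyps(2) vars subset_W
    by (intro sixth_moment_add_G_mult_le[of i W] measurable_in_coords_multilinear_poly
        all_moments_multilinear_poly[of _ W] insert.IH sum_nonneg) auto
  also have "5 * (\<Sum>I\<in>?T. 5 ^ card I * (?a I)\<^sup>2) = (\<Sum>I\<in>?T. 5 ^ card (insert i I) * (?a I)\<^sup>2)"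
    unfolding sum_distrib_left
  proof (rule sum.cong[OF refl])
    fix I assume "I \<in> ?T"
    then have "finite I" "i \<notin> I"
      using subset_W(2) insert.hyps finite_subset by (auto simp: link_def)
    then show "5 * (5 ^ card I * (?a I)\<^sup>2) = 5 ^ card (insert i I) * (?a I)\<^sup>2"
      by simp
  qed
  also have "(\<Sum>I\<in>?S. 5 ^ card I * (a I)\<^sup>2) + \<dots> = (\<Sum>I\<in>S. 5 ^ card I * (a I)\<^sup>2)"
    using vars(1) finite_subset[OF insert.prems(2)] by (intro sum_deletion_link[symmetric]) simp
  finally show ?case .
qed

lemma sixth_moment_hom_poly_le:
  assumes "supported V d a"
  shows "expectation (\<lambda>\<omega>. ev (hom_poly d a) \<omega> ^ 6) \<le> (5 ^ d * sq_norm V d a) ^ 3"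
proof -
  have "(\<Sum>I\<in>nsets V d. 5 ^ card I * (a I)\<^sup>2) = 5 ^ d * sq_norm V d a"
    unfolding sq_norm_def sum_distrib_left by (intro sum.cong refl) (simp add: mem_nsets_iff)
  then show ?thesis
    using sixth_moment_multilinear_poly_le[OF supportedD(1,2)[OF assms] nsets_subset_Pow, of d a]
    by (simp add: hom_poly_eq_multilinear_poly[OF assms])
qed

end

section \<open>Characteristic functions and Stein kernels\<close>

lemma has_vector_derivative_of_quadratic_bound:
  fixes f :: "real \<Rightarrow> 'b::real_normed_vector"
  assumes bound: "\<And>h. norm (f (t + h) - f t - h *\<^sub>R D) \<le> C * h\<^sup>2"
  shows "(f has_vector_derivative D) (at t)"
proof -
  have "(\<lambda>h. norm (f (t + h) - f t - h *\<^sub>R D) / norm h) \<midarrow>0\<rightarrow> 0"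
  proof (rule tendsto_sandwich[where f = "\<lambda>_. 0" and h = "\<lambda>h. C * \<bar>h\<bar>"])
    have "norm (f (t + h) - f t - h *\<^sub>R D) / norm h \<le> C * \<bar>h\<bar>" if "h \<noteq> 0" for h
      using that bound[of h] by (simp add: pos_divide_le_eq mult.assoc flip: power2_eq_square)
    then show "eventually (\<lambda>h. norm (f (t + h) - f t - h *\<^sub>R D) / norm h \<le> C * \<bar>h\<bar>) (at 0)"
      by (auto simp: eventually_at_filter)
    show "(\<lambda>h. C * \<bar>h\<bar>) \<midarrow>0\<rightarrow> 0"
      by (auto intro!: tendsto_eq_intros)
  qed auto
  then show ?thesis
    unfolding has_vector_derivative_def has_derivative_at
    by (simp add: bounded_linear_scaleR_left)
qed

lemma norm_iexp_add_taylor_le: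
  "norm (iexp ((t + h) * x) - iexp (t * x) - h * (\<i> * (x * iexp (t * x)))) \<le> h\<^sup>2 / 2 * x\<^sup>2"
proof -
  have "iexp ((t + h) * x) - iexp (t * x) - h * (\<i> * (x * iexp (t * x))) =
      iexp (t * x) * (iexp (h * x) - (\<Sum>k\<le>1. (\<i> * complex_of_real (h * x)) ^ k / fact k))"
    by (simp add: algebra_simps flip: exp_add)
  then have "norm (iexp ((t + h) * x) - iexp (t * x) - h * (\<i> * (x * iexp (t * x)))) =
      cmod (iexp (h * x) - (\<Sum>k\<le>1. (\<i> * complex_of_real (h * x)) ^ k / fact k))"
    by (simp only: norm_mult norm_exp_i_times mult_1_left)
  also have "\<dots> \<le> \<bar>h * x\<bar> ^ Suc 1 / fact (Suc 1)"
    by (rule iexp_approx1)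
  also have "\<dots> = h\<^sup>2 / 2 * x\<^sup>2"
    by (simp add: power_mult_distrib abs_mult flip: numeral_2_eq_2)
  finally show ?thesis .
qed

context prob_space
begin

lemma integrable_mult_iexp:
  assumes "integrable M Z" "U \<in> borel_measurable M"
  shows "integrable M (\<lambda>\<omega>. complex_of_real (Z \<omega>) * iexp (U \<omega>))"
proof (rule Bochner_Integration.integrable_bound)
  show "(\<lambda>\<omega>. complex_of_real (Z \<omega>) * iexp (U \<omega>)) \<in> borel_measurable M"
    using assms borel_measurable_integrable[OF assms(1)] by measurable
  show "AE \<omega> in M. norm (complex_of_real (Z \<omega>) * iexp (U \<omega>)) \<le> norm (Z \<omega>)"
    by (auto simp: norm_mult)
qed (rule assms(1))

lemma has_vector_derivative_expectation_iexp:
  assumes moments: "all_moments X"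
  shows "((\<lambda>t. CLINT \<omega>|M. iexp (t * X \<omega>)) has_vector_derivative
    (\<i> * (CLINT \<omega>|M. complex_of_real (X \<omega>) * iexp (t * X \<omega>)))) (at t)"
proof (rule has_vector_derivative_of_quadratic_bound)
  note [measurable] = all_moments_measurable[OF moments]
  let ?\<phi> = "\<lambda>t. CLINT \<omega>|M. iexp (t * X \<omega>)"
  let ?D = "\<i> * (CLINT \<omega>|M. complex_of_real (X \<omega>) * iexp (t * X \<omega>))"
  fix h
  let ?f = "\<lambda>\<omega>. iexp ((t + h) * X \<omega>) - iexp (t * X \<omega>) - h * (\<i> * (X \<omega> * iexp (t * X \<omega>)))"
  have integrable_iexp: "integrable M (\<lambda>\<omega>. iexp (s * X \<omega>))" for s
    using integrable_mult_iexp[of "\<lambda>_. 1" "\<lambda>\<omega>. s * X \<omega>"] by simp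
  have integrable_X_iexp: "integrable M (\<lambda>\<omega>. complex_of_real (X \<omega>) * iexp (t * X \<omega>))"
    by (intro integrable_mult_iexp all_moments_integrable moments) simp
  have "?\<phi> (t + h) - ?\<phi> t - h *\<^sub>R ?D = (CLINT \<omega>|M. ?f \<omega>)"
    using integrable_iexp[of "t + h"] integrable_iexp[of t] integrable_X_iexp
    by (simp add: scaleR_conv_of_real)
  then have "norm (?\<phi> (t + h) - ?\<phi> t - h *\<^sub>R ?D) \<le> (\<integral>\<omega>. norm (?f \<omega>) \<partial>M)"
    by (simp only: integral_norm_bound)
  also have "\<dots> \<le> (\<integral>\<omega>. h\<^sup>2 / 2 * (X \<omega>)\<^sup>2 \<partial>M)"
  proof (rule integral_mono)
    show "integrable M (\<lambda>\<omega>. norm (?f \<omega>))"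
      using integrable_iexp[of "t + h"] integrable_iexp[of t] integrable_X_iexp
      by (intro integrable_norm Bochner_Integration.integrable_diff integrable_mult_right)
    show "integrable M (\<lambda>\<omega>. h\<^sup>2 / 2 * (X \<omega>)\<^sup>2)"
      by (intro all_moments_integrable all_moments_intros moments)
  qed (rule norm_iexp_add_taylor_le)
  also have "\<dots> = (expectation (\<lambda>\<omega>. (X \<omega>)\<^sup>2) / 2) * h\<^sup>2"
    by simp
  finally show "norm (?\<phi> (t + h) - ?\<phi> t - h *\<^sub>R ?D) \<le> (expectation (\<lambda>\<omega>. (X \<omega>)\<^sup>2) / 2) * h\<^sup>2" .
qed

end

lemma has_vector_derivative_exp_square_scaleR:
  fixes \<phi> :: "real \<Rightarrow> 'b::real_normed_vector"
  assumes "(\<phi> has_vector_derivative \<phi>') (at s)"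
  shows "((\<lambda>s. exp (s\<^sup>2 / 2) *\<^sub>R \<phi> s) has_vector_derivative exp (s\<^sup>2 / 2) *\<^sub>R (\<phi>' + s *\<^sub>R \<phi> s)) (at s)"
proof -
  have "((\<lambda>s. exp (s\<^sup>2 / 2)) has_real_derivative exp (s\<^sup>2 / 2) * s) (at s)"
    by (auto intro!: derivative_eq_intros)
  from has_vector_derivative_scaleR[OF this assms] show ?thesis
    by (simp add: scaleR_add_right)
qed

text \<open>
  The hypothesis controls the derivative of \<open>exp (s\<^sup>2 / 2) \<phi> s\<close>, which vanishes exactly for multiples
  of the Gaussian characteristic function.
\<close>

lemma gaussian_ode_stable_nonneg:
  fixes \<phi> :: "real \<Rightarrow> 'b::real_normed_vector"
  assumes deriv: "\<And>s. (\<phi> has_vector_derivative \<phi>' s) (at s)"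
    and bound: "\<And>s. norm (\<phi>' s + s *\<^sub>R \<phi> s) \<le> \<bar>s\<bar> * \<delta>" and "\<delta> \<ge> 0" "t \<ge> 0"
  shows "norm (\<phi> t - exp (- (t\<^sup>2 / 2)) *\<^sub>R \<phi> 0) \<le> \<delta>"
proof (cases "t = 0")
  case True
  then show ?thesis using \<open>\<delta> \<ge> 0\<close> by simp
next
  case False
  then have t_pos: "t > 0" using \<open>t \<ge> 0\<close> by simp
  define f where "f s = exp (s\<^sup>2 / 2) *\<^sub>R \<phi> s" for s
  have f_deriv: "(f has_vector_derivative exp (s\<^sup>2 / 2) *\<^sub>R (\<phi>' s + s *\<^sub>R \<phi> s)) (at s)" for s
    unfolding f_def[abs_def] by (rule has_vector_derivative_exp_square_scaleR[OF deriv])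
  have "norm (f t - f 0) \<le> \<delta> * exp (t\<^sup>2 / 2) - \<delta> * exp (0\<^sup>2 / 2)"
  proof (rule differentiable_bound_general[OF t_pos _ _ f_deriv])
    show "continuous_on {0..t} f"
      by (rule continuous_on_vector_derivative) (use f_deriv has_vector_derivative_at_within in blast)
    show "continuous_on {0..t} (\<lambda>s. \<delta> * exp (s\<^sup>2 / 2))"
      by (intro continuous_intros) auto
    show "((\<lambda>s. \<delta> * exp (s\<^sup>2 / 2)) has_vector_derivative \<delta> * (s * exp (s\<^sup>2 / 2))) (at s)" for s
      unfolding has_real_derivative_iff_has_vector_derivative[symmetric]
      by (auto intro!: derivative_eq_intros)
    show "norm (exp (s\<^sup>2 / 2) *\<^sub>R (\<phi>' s + s *\<^sub>R \<phi> s)) \<le> \<delta> * (s * exp (s\<^sup>2 / 2))" if "0 < s" for s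
      using bound[of s] that by (simp add: mult_ac)
  qed
  also have "\<dots> \<le> \<delta> * exp (t\<^sup>2 / 2)"
    using \<open>\<delta> \<ge> 0\<close> by simp
  finally have "norm (f t - f 0) / exp (t\<^sup>2 / 2) \<le> \<delta>"
    by (simp add: pos_divide_le_eq)
  then have "norm (exp (- (t\<^sup>2 / 2)) *\<^sub>R (f t - f 0)) \<le> \<delta>"
    unfolding divide_inverse_commute by (simp add: exp_minus)
  moreover have "\<phi> t - exp (- (t\<^sup>2 / 2)) *\<^sub>R \<phi> 0 = exp (- (t\<^sup>2 / 2)) *\<^sub>R (f t - f 0)"
    by (simp add: f_def scaleR_diff_right flip: exp_add)
  ultimately show ?thesis
    by (simp only:)
qed

lemma gaussian_ode_stable:
  fixes \<phi> :: "real \<Rightarrow> 'b::real_normed_vector"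
  assumes deriv: "\<And>s. (\<phi> has_vector_derivative \<phi>' s) (at s)"
    and bound: "\<And>s. norm (\<phi>' s + s *\<^sub>R \<phi> s) \<le> \<bar>s\<bar> * \<delta>" and "\<delta> \<ge> 0"
  shows "norm (\<phi> t - exp (- (t\<^sup>2 / 2)) *\<^sub>R \<phi> 0) \<le> \<delta>"
proof (cases "t \<ge> 0")
  case True
  then show ?thesis
    using assms by (intro gaussian_ode_stable_nonneg)
next
  case False
  have "norm (\<phi> (- (- t)) - exp (- ((- t)\<^sup>2 / 2)) *\<^sub>R \<phi> (- 0)) \<le> \<delta>"
  proof (rule gaussian_ode_stable_nonneg[where \<phi> = "\<lambda>s. \<phi> (- s)" and \<phi>' = "\<lambda>s. - \<phi>' (- s)"])
    fix s :: real
    have "((\<phi> \<circ> uminus) has_vector_derivative (- 1) *\<^sub>R \<phi>' (- s)) (at s)"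
      by (rule vector_diff_chain_at[OF _ deriv]) (auto intro!: derivative_eq_intros)
    then show "((\<lambda>s. \<phi> (- s)) has_vector_derivative - \<phi>' (- s)) (at s)"
      by (simp add: comp_def)
    show "norm (- \<phi>' (- s) + s *\<^sub>R \<phi> (- s)) \<le> \<bar>s\<bar> * \<delta>"
      using bound[of "- s"] norm_minus_cancel[of "\<phi>' (- s) - s *\<^sub>R \<phi> (- s)"] by simp
  qed (use False \<open>\<delta> \<ge> 0\<close> in auto)
  then show ?thesis by simp
qed

context prob_space
begin

definition stein_kernel :: "('a \<Rightarrow> real) \<Rightarrow> ('a \<Rightarrow> real) \<Rightarrow> bool" where
  "stein_kernel F T \<longleftrightarrow> (\<forall>t :: real. (CLINT \<omega>|M. complex_of_real (F \<omega>) * iexp (t * F \<omega>)) =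
    \<i> * t * (CLINT \<omega>|M. complex_of_real (T \<omega>) * iexp (t * F \<omega>)))"

lemma stein_kernel_sum:
  assumes F_eq_sum: "\<And>\<omega>. F \<omega> = (\<Sum>i\<in>V. A i \<omega>)" "F \<in> borel_measurable M"
    and integrable: "\<And>i. i \<in> V \<Longrightarrow> integrable M (A i)" "\<And>i. i \<in> V \<Longrightarrow> integrable M (B i)"
    and by_parts: "\<And>i t. i \<in> V \<Longrightarrow> (CLINT \<omega>|M. complex_of_real (A i \<omega>) * iexp (t * F \<omega>)) =
      \<i> * t * (CLINT \<omega>|M. complex_of_real (B i \<omega>) * iexp (t * F \<omega>))"
  shows "stein_kernel F (\<lambda>\<omega>. \<Sum>i\<in>V. B i \<omega>)"
  unfolding stein_kernel_def
proof
  fix t :: real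
  let ?e = "\<lambda>\<omega>. iexp (t * F \<omega>)"
  have sum: "(CLINT \<omega>|M. complex_of_real (\<Sum>i\<in>V. C i \<omega>) * ?e \<omega>) =
      (\<Sum>i\<in>V. CLINT \<omega>|M. complex_of_real (C i \<omega>) * ?e \<omega>)"
    if "\<And>i. i \<in> V \<Longrightarrow> integrable M (C i)" for C
    unfolding of_real_sum sum_distrib_right using F_eq_sum(2) that
    by (intro Bochner_Integration.integral_sum integrable_mult_iexp) simp_all
  have "(CLINT \<omega>|M. complex_of_real (F \<omega>) * ?e \<omega>) = (CLINT \<omega>|M. complex_of_real (\<Sum>i\<in>V. A i \<omega>) * ?e \<omega>)"
    by (simp only: F_eq_sum(1))
  also have "\<dots> = (\<Sum>i\<in>V. CLINT \<omega>|M. complex_of_real (A i \<omega>) * ?e \<omega>)"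
    by (rule sum) (rule integrable(1))
  also have "\<dots> = \<i> * t * (\<Sum>i\<in>V. CLINT \<omega>|M. complex_of_real (B i \<omega>) * ?e \<omega>)"
    unfolding sum_distrib_left by (intro sum.cong refl by_parts)
  also have "(\<Sum>i\<in>V. CLINT \<omega>|M. complex_of_real (B i \<omega>) * ?e \<omega>) =
      (CLINT \<omega>|M. complex_of_real (\<Sum>i\<in>V. B i \<omega>) * ?e \<omega>)"
    by (rule sum[symmetric]) (rule integrable(2))
  finally show "(CLINT \<omega>|M. complex_of_real (F \<omega>) * ?e \<omega>) =
      \<i> * t * (CLINT \<omega>|M. complex_of_real (\<Sum>i\<in>V. B i \<omega>) * ?e \<omega>)" .
qed

lemma norm_char_ode_defect_le:
  assumes "stein_kernel F T" and moments: "all_moments F" "all_moments T"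
  shows "norm (\<i> * (CLINT \<omega>|M. complex_of_real (F \<omega>) * iexp (s * F \<omega>)) + s *\<^sub>R (CLINT \<omega>|M. iexp (s * F \<omega>)))
    \<le> \<bar>s\<bar> * sqrt (expectation (\<lambda>\<omega>. (T \<omega> - 1)\<^sup>2))"
proof -
  note [measurable] = moments[THEN all_moments_measurable]
  have integrable_T_iexp: "integrable M (\<lambda>\<omega>. complex_of_real (T \<omega>) * iexp (s * F \<omega>))"
    by (intro integrable_mult_iexp all_moments_integrable moments) simp
  have integrable_iexp: "integrable M (\<lambda>\<omega>. iexp (s * F \<omega>))"
    using integrable_mult_iexp[of "\<lambda>_. 1" "\<lambda>\<omega>. s * F \<omega>"] by simp
  have moments_dev: "all_moments (\<lambda>\<omega>. T \<omega> - 1)"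
    by (intro all_moments_intros moments)
  have "(CLINT \<omega>|M. complex_of_real (F \<omega>) * iexp (s * F \<omega>)) =
      \<i> * s * (CLINT \<omega>|M. complex_of_real (T \<omega>) * iexp (s * F \<omega>))"
    using assms(1) unfolding stein_kernel_def by blast
  then have "\<i> * (CLINT \<omega>|M. complex_of_real (F \<omega>) * iexp (s * F \<omega>)) + s *\<^sub>R (CLINT \<omega>|M. iexp (s * F \<omega>)) =
      - s *\<^sub>R ((CLINT \<omega>|M. complex_of_real (T \<omega>) * iexp (s * F \<omega>)) - (CLINT \<omega>|M. iexp (s * F \<omega>)))"
    by (simp add: scaleR_conv_of_real right_diff_distrib flip: mult.assoc)
  also have "(CLINT \<omega>|M. complex_of_real (T \<omega>) * iexp (s * F \<omega>)) - (CLINT \<omega>|M. iexp (s * F \<omega>)) =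
      (CLINT \<omega>|M. complex_of_real (T \<omega> - 1) * iexp (s * F \<omega>))"
    using integrable_T_iexp integrable_iexp by (simp add: left_diff_distrib)
  also have "norm (- s *\<^sub>R \<dots>) \<le> \<bar>s\<bar> * (\<integral>\<omega>. norm (complex_of_real (T \<omega> - 1) * iexp (s * F \<omega>)) \<partial>M)"
    unfolding norm_scaleR abs_minus_cancel by (intro mult_left_mono integral_norm_bound) simp
  also have "(\<integral>\<omega>. norm (complex_of_real (T \<omega> - 1) * iexp (s * F \<omega>)) \<partial>M) = expectation (\<lambda>\<omega>. \<bar>T \<omega> - 1\<bar>)"
    by (simp only: norm_mult norm_exp_i_times norm_of_real mult_1_right)
  also have "\<bar>s\<bar> * expectation (\<lambda>\<omega>. \<bar>T \<omega> - 1\<bar>) \<le> \<bar>s\<bar> * sqrt (expectation (\<lambda>\<omega>. (T \<omega> - 1)\<^sup>2))"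
    by (intro mult_left_mono expectation_abs_le_sqrt moments_dev) simp
  finally show ?thesis .
qed

theorem norm_char_diff_std_normal_le:
  assumes "stein_kernel F T" and moments: "all_moments F" "all_moments T"
  shows "norm (char (distr M borel F) t - char std_normal_distribution t) \<le>
    sqrt (expectation (\<lambda>\<omega>. (T \<omega> - 1)\<^sup>2))"
proof -
  note [measurable] = all_moments_measurable[OF moments(1)]
  let ?\<phi> = "\<lambda>s. CLINT \<omega>|M. iexp (s * F \<omega>)"
  have "norm (?\<phi> t - exp (- (t\<^sup>2 / 2)) *\<^sub>R ?\<phi> 0) \<le> sqrt (expectation (\<lambda>\<omega>. (T \<omega> - 1)\<^sup>2))"
    by (rule gaussian_ode_stable[where \<phi> = ?\<phi>, OF has_vector_derivative_expectation_iexp[OF moments(1)]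
          norm_char_ode_defect_le[OF assms]]) simp
  moreover have "char (distr M borel F) t = ?\<phi> t"
    unfolding char_def by (subst integral_distr) auto
  ultimately show ?thesis
    by (simp add: char_std_normal_distribution prob_space scaleR_conv_of_real)
qed

end

section \<open>Gaussian integration by parts\<close>

lemma std_normal_iexp_moment:
  "(CLINT x|std_normal_distribution. complex_of_real x * iexp (s * x)) =
    \<i> * s * (CLINT x|std_normal_distribution. iexp (s * x))"
proof -
  interpret N: prob_space std_normal_distribution
    using real_dist_normal_dist by (rule real_distribution.axioms)
  let ?g = "\<lambda>s. complex_of_real (exp (- (s\<^sup>2) / 2))"
  have moments: "N.all_moments (\<lambda>x. x)"
    unfolding N.all_moments_def
    using integrable_std_normal_moment_abs by (auto simp: integrable_density normal_density_nonneg)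
  have char_eq: "(CLINT x|std_normal_distribution. iexp (s * x)) = ?g s" for s
    using fun_cong[OF char_std_normal_distribution, of s] by (simp add: char_def)
  have "(?g has_vector_derivative complex_of_real (- s * exp (- (s\<^sup>2) / 2))) (at s)"
    by (rule has_vector_derivative_of_real)
      (auto intro!: derivative_eq_intros simp flip: has_real_derivative_iff_has_vector_derivative)
  moreover have "(?g has_vector_derivative
      \<i> * (CLINT x|std_normal_distribution. complex_of_real x * iexp (s * x))) (at s)"
    using N.has_vector_derivative_expectation_iexp[OF moments, of s] unfolding char_eq .
  ultimately have "\<i> * (CLINT x|std_normal_distribution. complex_of_real x * iexp (s * x)) =
      complex_of_real (- s * exp (- (s\<^sup>2) / 2))"
    by (rule vector_derivative_unique_at[symmetric])
  then have "\<i> * (\<i> * (CLINT x|std_normal_distribution. complex_of_real x * iexp (s * x))) =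
      - (\<i> * s * ?g s)"
    by simp
  then show ?thesis
    unfolding char_eq by (simp flip: mult.assoc)
qed

lemma std_normal_integration_by_parts_affine:
  fixes p q t :: real
  shows "(CLINT x|std_normal_distribution. complex_of_real (x * q) * iexp (t * (p + x * q))) =
    \<i> * t * (CLINT x|std_normal_distribution. complex_of_real (q\<^sup>2) * iexp (t * (p + x * q)))"
proof -
  let ?N = std_normal_distribution
  have iexp_split: "iexp (t * (p + x * q)) = iexp (t * p) * iexp (t * q * x)" for x
    by (simp add: algebra_simps flip: exp_add)
  have "(CLINT x|?N. complex_of_real (x * q) * iexp (t * (p + x * q))) =
      q * iexp (t * p) * (CLINT x|?N. complex_of_real x * iexp (t * q * x))"
    unfolding iexp_split by (simp add: mult_ac flip: integral_mult_right_zero)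
  also have "\<dots> = \<i> * t * (q\<^sup>2 * iexp (t * p) * (CLINT x|?N. iexp (t * q * x)))"
    unfolding std_normal_iexp_moment[of "t * q"] by (simp add: power2_eq_square)
  also have "q\<^sup>2 * iexp (t * p) * (CLINT x|?N. iexp (t * q * x)) =
      (CLINT x|?N. complex_of_real (q\<^sup>2) * iexp (t * (p + x * q)))"
    unfolding iexp_split by (simp add: mult_ac flip: integral_mult_right_zero)
  finally show ?thesis .
qed

context prob_space
begin

lemma integral_indep_var:
  fixes f :: "'b \<Rightarrow> 'b \<Rightarrow> complex"
  assumes indep: "indep_var S X T Y" and [measurable]: "case_prod f \<in> borel_measurable (S \<Otimes>\<^sub>M T)"
    and integrable_f: "integrable M (\<lambda>\<omega>. f (X \<omega>) (Y \<omega>))"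
  shows "(CLINT \<omega>|M. f (X \<omega>) (Y \<omega>)) = (CLINT y|distr M T Y. CLINT x|distr M S X. f x y)"
proof -
  have [measurable]: "X \<in> measurable M S" "Y \<in> measurable M T"
    and joint_distr: "distr M S X \<Otimes>\<^sub>M distr M T Y = distr M (S \<Otimes>\<^sub>M T) (\<lambda>\<omega>. (X \<omega>, Y \<omega>))"
    using indep unfolding indep_var_distribution_eq by auto
  interpret X: prob_space "distr M S X"
    by (rule prob_space_distr) measurable
  interpret Y: prob_space "distr M T Y"
    by (rule prob_space_distr) measurable
  interpret XY: pair_prob_space "distr M S X" "distr M T Y" ..
  have "integrable (distr M S X \<Otimes>\<^sub>M distr M T Y) (case_prod f)"
    using integrable_f unfolding joint_distr by (simp add: integrable_distr_eq)
  then have "(CLINT y|distr M T Y. CLINT x|distr M S X. f x y) =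
      integral\<^sup>L (distr M S X \<Otimes>\<^sub>M distr M T Y) (case_prod f)"
    by (rule XY.integral_snd)
  also have "\<dots> = (CLINT \<omega>|M. f (X \<omega>) (Y \<omega>))"
    unfolding joint_distr by (subst integral_distr) auto
  finally show ?thesis ..
qed

lemma gaussian_integration_by_parts:
  assumes indep: "indep_var S X T Y" and gauss: "distr M borel (\<lambda>\<omega>. g (X \<omega>)) = std_normal_distribution"
    and [measurable]: "g \<in> borel_measurable S" "p \<in> borel_measurable T" "q \<in> borel_measurable T"
    and integrable_q: "integrable M (\<lambda>\<omega>. g (X \<omega>) * q (Y \<omega>))" "integrable M (\<lambda>\<omega>. (q (Y \<omega>))\<^sup>2)"
  shows "(CLINT \<omega>|M. complex_of_real (g (X \<omega>) * q (Y \<omega>)) * iexp (t * (p (Y \<omega>) + g (X \<omega>) * q (Y \<omega>)))) =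
    \<i> * t * (CLINT \<omega>|M. complex_of_real ((q (Y \<omega>))\<^sup>2) * iexp (t * (p (Y \<omega>) + g (X \<omega>) * q (Y \<omega>))))"
proof -
  have [measurable]: "X \<in> measurable M S" "Y \<in> measurable M T"
    using indep unfolding indep_var_distribution_eq by auto
  let ?N = std_normal_distribution
  let ?e = "\<lambda>x y. iexp (t * (p y + x * q y))"
  have integral_distr_X: "(CLINT x|distr M S X. h (g x)) = (CLINT x|?N. h x)"
    if "h \<in> borel_measurable borel" for h :: "real \<Rightarrow> complex"
    using that by (simp add: integral_distr flip: gauss)
  have "(CLINT \<omega>|M. complex_of_real (g (X \<omega>) * q (Y \<omega>)) * ?e (g (X \<omega>)) (Y \<omega>)) =
      (CLINT y|distr M T Y. CLINT x|distr M S X. complex_of_real (g x * q y) * ?e (g x) y)"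
    by (rule integral_indep_var[OF indep])
      (measurable, intro integrable_mult_iexp integrable_q, measurable)
  also have "\<dots> = (CLINT y|distr M T Y. CLINT x|?N. complex_of_real (x * q y) * ?e x y)"
    by (subst integral_distr_X) simp_all
  also have "\<dots> = \<i> * t * (CLINT y|distr M T Y. CLINT x|?N. complex_of_real ((q y)\<^sup>2) * ?e x y)"
    unfolding std_normal_integration_by_parts_affine by (rule integral_mult_right_zero)
  also have "(CLINT y|distr M T Y. CLINT x|?N. complex_of_real ((q y)\<^sup>2) * ?e x y) =
      (CLINT y|distr M T Y. CLINT x|distr M S X. complex_of_real ((q y)\<^sup>2) * ?e (g x) y)"
    by (subst integral_distr_X) simp_all
  also have "\<dots> = (CLINT \<omega>|M. complex_of_real ((q (Y \<omega>))\<^sup>2) * ?e (g (X \<omega>)) (Y \<omega>))"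
    by (rule integral_indep_var[OF indep, symmetric])
      (measurable, intro integrable_mult_iexp integrable_q, measurable)
  finally show ?thesis .
qed

end

context gaussian_sequence
begin

lemma integration_by_parts_multilinear_poly:
  fixes S a
  defines "F \<equiv> multilinear_poly S a"
  assumes fin_V: "finite V" "V \<subseteq> {1..}" "S \<subseteq> Pow V" and "i \<in> V"
  shows "(CLINT \<omega>|M. complex_of_real (G i \<omega> * ev (partial_deriv i F) \<omega>) * iexp (t * ev F \<omega>)) =
    \<i> * t * (CLINT \<omega>|M. complex_of_real ((ev (partial_deriv i F) \<omega>)\<^sup>2) * iexp (t * ev F \<omega>))"
proof -
  define P where "P = multilinear_poly (deletion i S) a"
  define Q where "Q = multilinear_poly (link i S) (\<lambda>I. a (insert i I))"
  let ?Y = "\<lambda>\<omega>. restrict (\<lambda>j. G j \<omega>) (V - {i})"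
  have i_pos: "i \<ge> 1"
    using \<open>i \<in> V\<close> fin_V by auto
  have ev_F_eq: "ev F \<omega> = ev P \<omega> + G i \<omega> * ev Q \<omega>" and deriv_eq: "partial_deriv i F = Q" for \<omega>
    unfolding F_def P_def Q_def
    by (simp_all add: at_vars_def multilinear_poly_decompose[OF fin_V(1,3), of a _ i]
        partial_deriv_multilinear_poly[OF fin_V(1,3)])
  have coords: "measurable_in_coords (V - {i}) P" "measurable_in_coords (V - {i}) Q"
    unfolding P_def Q_def
    by (intro measurable_in_coords_multilinear_poly deletion_subset_Pow link_subset_Pow fin_V)+
  then have ev_eq_restrict: "ev P \<omega> = P (?Y \<omega>)" "ev Q \<omega> = Q (?Y \<omega>)" for \<omega>
    by (simp_all add: at_vars_def measurable_in_coords_def)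
  have moments_Q: "all_moments (ev Q)"
    unfolding deriv_eq[symmetric] F_def by (rule all_moments_partial_deriv[OF fin_V(1,3,2)])
  have "indep_var (PiM {i} (\<lambda>_. borel)) (\<lambda>\<omega>. restrict (\<lambda>j. G j \<omega>) {i}) (PiM (V - {i}) (\<lambda>_. borel)) ?Y"
    using i_pos fin_V by (intro indep_var_restrict[OF indep_G]) auto
  then show ?thesis
    using gaussian_integration_by_parts[of _ "\<lambda>\<omega>. restrict (\<lambda>j. G j \<omega>) {i}" _ ?Y "\<lambda>x. x i" P Q t]
      coords i_pos
      all_moments_integrable[OF all_moments_mult[OF all_moments_G[OF i_pos] moments_Q]]
      all_moments_integrable[OF all_moments_power[OF moments_Q, of 2]]
    unfolding ev_F_eq deriv_eq ev_eq_restrict by (simp add: distr_G measurable_in_coords_def)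
qed

theorem stein_kernel_hom_poly:
  assumes supp: "supported V d a" and "d \<ge> 1"
  shows "stein_kernel (ev (hom_poly d a)) (\<lambda>\<omega>. ev (grad_prod (hom_poly d a) (hom_poly d a)) \<omega> / d)"
proof -
  note fin_V = supportedD(1,2)[OF supp]
  define F where "F = multilinear_poly (nsets V d) a"
  let ?D = "\<lambda>i. ev (partial_deriv i F)"
  have moments: "all_moments (ev F)" "all_moments (?D i)" for i
    unfolding F_def
    by (rule all_moments_multilinear_poly[OF nsets_subset_Pow fin_V(2)],
        rule all_moments_partial_deriv[OF fin_V(1) nsets_subset_Pow fin_V(2)])
  have euler: "ev F \<omega> = (\<Sum>i\<in>V. G i \<omega> * ?D i \<omega> / d)" for \<omega>
    using euler_homogeneous[OF fin_V(1), of "\<lambda>i. G i \<omega>" d a] \<open>d \<ge> 1\<close>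
    by (simp add: F_def at_vars_def flip: sum_divide_distrib)
  have "stein_kernel (ev F) (\<lambda>\<omega>. \<Sum>i\<in>V. (?D i \<omega>)\<^sup>2 / d)"
  proof (rule stein_kernel_sum[OF euler all_moments_measurable[OF moments(1)]])
    fix i t assume i_mem: "i \<in> V"
    show "integrable M (\<lambda>\<omega>. G i \<omega> * ?D i \<omega> / d)" "integrable M (\<lambda>\<omega>. (?D i \<omega>)\<^sup>2 / d)"
      using i_mem fin_V moments(2) unfolding divide_inverse
      by (auto intro!: all_moments_integrable all_moments_intros all_moments_G)
    show "(CLINT \<omega>|M. complex_of_real (G i \<omega> * ?D i \<omega> / d) * iexp (t * ev F \<omega>)) =
        \<i> * t * (CLINT \<omega>|M. complex_of_real ((?D i \<omega>)\<^sup>2 / d) * iexp (t * ev F \<omega>))"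
      using integration_by_parts_multilinear_poly[OF fin_V nsets_subset_Pow i_mem, of d a t]
      by (simp flip: F_def)
  qed
  also have "(\<lambda>\<omega>. \<Sum>i\<in>V. (?D i \<omega>)\<^sup>2 / d) = (\<lambda>\<omega>. ev (grad_prod F F) \<omega> / d)"
    unfolding F_def at_vars_def grad_prod_multilinear_poly[OF fin_V nsets_subset_Pow]
    by (simp add: power2_eq_square sum_divide_distrib)
  finally show ?thesis
    by (simp add: F_def hom_poly_eq_multilinear_poly[OF supp])
qed

end

section \<open>Convergence of moments\<close>

lemma even_power_le_truncated:
  fixes x L :: real
  assumes "L > 0"
  shows "x ^ (2 * m) \<le> min (x ^ (2 * m)) (L ^ (2 * m)) + x ^ (2 * m + 2) / L\<^sup>2"
proof (cases "\<bar>x\<bar> \<le> L")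
  case True
  then have "\<bar>x\<bar> ^ (2 * m) \<le> L ^ (2 * m)"
    by (intro power_mono) auto
  then have "min (x ^ (2 * m)) (L ^ (2 * m)) = x ^ (2 * m)"
    by (simp add: power_even_abs min_absorb1)
  moreover have "x ^ (2 * m + 2) / L\<^sup>2 \<ge> 0"
    by (intro divide_nonneg_nonneg zero_le_even_power) auto
  ultimately show ?thesis by linarith
next
  case False
  with \<open>L > 0\<close> have "L\<^sup>2 \<le> x\<^sup>2"
    by (simp add: power_mono flip: abs_le_square_iff)
  then have "x ^ (2 * m) * L\<^sup>2 \<le> x ^ (2 * m + 2)"
    unfolding power_add by (intro mult_left_mono zero_le_even_power) simp_all
  then have "x ^ (2 * m) \<le> x ^ (2 * m + 2) / L\<^sup>2"
    using \<open>L > 0\<close> by (simp add: pos_le_divide_eq)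
  moreover have "min (x ^ (2 * m)) (L ^ (2 * m)) \<ge> 0"
    by (simp add: power_mult)
  ultimately show ?thesis by linarith
qed

lemma (in real_distribution) integrable_truncated_moment:
  "integrable M (\<lambda>x. min (x ^ (2 * m)) (L ^ (2 * m)))"
  by (rule integrable_const_bound[where B = "L ^ (2 * m)"]) (auto simp: power_mult)

lemma (in real_distribution) integrable_even_power:
  assumes "integrable M (\<lambda>x. x ^ (2 * m + 2))"
  shows "integrable M (\<lambda>x. x ^ (2 * m))"
proof (rule Bochner_Integration.integrable_bound)
  show "integrable M (\<lambda>x. min (x ^ (2 * m)) (1 ^ (2 * m)) + x ^ (2 * m + 2) / 1\<^sup>2)"
    using assms integrable_truncated_moment[of m 1] by simp
  have "norm (x ^ (2 * m)) \<le> norm (min (x ^ (2 * m)) (1 ^ (2 * m)) + x ^ (2 * m + 2) / 1\<^sup>2)" for x :: real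
    using order_trans[OF even_power_le_truncated[OF zero_less_one, of x m] abs_ge_self]
    by (simp only: real_norm_def abs_of_nonneg zero_le_even_power dvd_triv_left)
  then show "AE x in M. norm (x ^ (2 * m)) \<le> norm (min (x ^ (2 * m)) (1 ^ (2 * m)) + x ^ (2 * m + 2) / 1\<^sup>2)"
    by (rule AE_I2)
qed simp

lemma (in real_distribution) truncated_moment_close:
  assumes integrable_higher: "integrable M (\<lambda>x. x ^ (2 * m + 2))" and "L > 0"
  shows "\<bar>(\<integral>x. x ^ (2 * m) \<partial>M) - (\<integral>x. min (x ^ (2 * m)) (L ^ (2 * m)) \<partial>M)\<bar> \<le>
    (\<integral>x. x ^ (2 * m + 2) \<partial>M) / L\<^sup>2"
proof -
  let ?h = "\<lambda>x. min (x ^ (2 * m)) (L ^ (2 * m))"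
  have "(\<integral>x. x ^ (2 * m) \<partial>M) \<le> (\<integral>x. ?h x + x ^ (2 * m + 2) / L\<^sup>2 \<partial>M)"
    using integrable_higher integrable_truncated_moment[of m L]
    by (intro integral_mono integrable_even_power even_power_le_truncated \<open>L > 0\<close>) auto
  also have "\<dots> = (\<integral>x. ?h x \<partial>M) + (\<integral>x. x ^ (2 * m + 2) \<partial>M) / L\<^sup>2"
    using integrable_higher integrable_truncated_moment[of m L] by simp
  moreover have "(\<integral>x. ?h x \<partial>M) \<le> (\<integral>x. x ^ (2 * m) \<partial>M)"
    using integrable_higher
    by (intro integral_mono integrable_truncated_moment integrable_even_power) auto
  ultimately show ?thesis by linarith
qed

theorem weak_conv_imp_even_moment_conv:
  assumes \<mu>: "\<And>n. real_distribution (\<mu> n)" and \<nu>: "real_distribution \<nu>" and conv: "weak_conv_m \<mu> \<nu>"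
    and integrable_higher: "\<And>n. integrable (\<mu> n) (\<lambda>x. x ^ (2 * m + 2))" "integrable \<nu> (\<lambda>x. x ^ (2 * m + 2))"
    and bound: "\<And>n. (\<integral>x. x ^ (2 * m + 2) \<partial>\<mu> n) \<le> B"
  shows "(\<lambda>n. \<integral>x. x ^ (2 * m) \<partial>\<mu> n) \<longlonglongrightarrow> (\<integral>x. x ^ (2 * m) \<partial>\<nu>)"
proof (rule tendstoI)
  fix e :: real assume "e > 0"
  define C where "C = max B (\<integral>x. x ^ (2 * m + 2) \<partial>\<nu>)"
  have "(\<integral>x. x ^ (2 * m + 2) \<partial>\<nu>) \<ge> 0"
    by (intro Bochner_Integration.integral_nonneg zero_le_even_power) simp
  then have "C \<ge> 0"
    by (simp add: C_def)
  define L where "L = sqrt (3 * C / e + 1)"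
  have L_square: "L\<^sup>2 = 3 * C / e + 1" and L_pos: "L > 0"
    using \<open>C \<ge> 0\<close> \<open>e > 0\<close> by (auto simp: L_def add_nonneg_pos)
  have tail_less: "C / L\<^sup>2 < e / 3"
    using \<open>C \<ge> 0\<close> \<open>e > 0\<close> unfolding L_square by (simp add: field_simps add_nonneg_pos)
  let ?h = "\<lambda>x :: real. min (x ^ (2 * m)) (L ^ (2 * m))"
  have truncation_close: "\<bar>(\<integral>x. x ^ (2 * m) \<partial>\<kappa>) - (\<integral>x. ?h x \<partial>\<kappa>)\<bar> < e / 3"
    if "real_distribution \<kappa>" "integrable \<kappa> (\<lambda>x. x ^ (2 * m + 2))" "(\<integral>x. x ^ (2 * m + 2) \<partial>\<kappa>) \<le> C" for \<kappa>
    using real_distribution.truncated_moment_close[OF that(1,2) L_pos]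
      divide_right_mono[OF that(3) zero_le_power2[of L]] tail_less
    by linarith
  have "(\<lambda>n. \<integral>x. ?h x \<partial>\<mu> n) \<longlonglongrightarrow> (\<integral>x. ?h x \<partial>\<nu>)"
  proof (rule weak_conv_imp_integral_bdd_continuous_conv[OF \<mu> \<nu> conv])
    show "isCont ?h x" for x
      by (intro continuous_intros)
    show "norm (?h x) \<le> L ^ (2 * m)" for x
      by (simp add: power_mult)
  qed
  then have "eventually (\<lambda>n. dist (\<integral>x. ?h x \<partial>\<mu> n) (\<integral>x. ?h x \<partial>\<nu>) < e / 3) sequentially"
    using \<open>e > 0\<close> by (intro tendstoD) auto
  then show "eventually (\<lambda>n. dist (\<integral>x. x ^ (2 * m) \<partial>\<mu> n) (\<integral>x. x ^ (2 * m) \<partial>\<nu>) < e) sequentially"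
  proof eventually_elim
    case (elim n)
    have "\<bar>(\<integral>x. x ^ (2 * m) \<partial>\<mu> n) - (\<integral>x. ?h x \<partial>\<mu> n)\<bar> < e / 3"
      using bound[of n]
      by (intro truncation_close \<mu> integrable_higher) (simp only: C_def max.coboundedI1)
    moreover have "\<bar>(\<integral>x. x ^ (2 * m) \<partial>\<nu>) - (\<integral>x. ?h x \<partial>\<nu>)\<bar> < e / 3"
      by (intro truncation_close \<nu> integrable_higher) (simp only: C_def max.cobounded2)
    ultimately show ?case
      using elim unfolding dist_real_def by linarith
  qed
qed

section \<open>The equivalence\<close>

context gaussian_sequence
begin

theorem norm_char_hom_poly_diff_le_rho_tilde:
  assumes normalized: "fin_coeffs d a" "expectation (\<lambda>\<omega>. (ev (hom_poly d a) \<omega>)\<^sup>2) = 1"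
    and k_range: "d div 2 \<le> k" "k < d"
    and \<rho>: "rho_tilde M G k (hom_poly d a) \<le> ennreal \<epsilon>" and "\<epsilon> \<ge> 0"
  shows "norm (char (distr M borel (ev (hom_poly d a))) t - char std_normal_distribution t) \<le>
    sqrt (grad_prod_const d d) * \<epsilon>"
proof -
  obtain V where supp: "supported V d a"
    using normalized(1) by (rule fin_coeffs_supported)
  let ?T = "\<lambda>\<omega>. ev (grad_prod (hom_poly d a) (hom_poly d a)) \<omega> / d"
  have sq_norm_eq_1: "sq_norm V d a = 1"
    using normalized(2) expectation_hom_poly_square[OF supp] by simp
  have "all_moments ?T"
    unfolding divide_inverse by (intro all_moments_intros all_moments_grad_prod[OF supp supp])
  then have "norm (char (distr M borel (ev (hom_poly d a))) t - char std_normal_distribution t) \<le>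
      sqrt (expectation (\<lambda>\<omega>. (?T \<omega> - 1)\<^sup>2))"
    using k_range
    by (intro norm_char_diff_std_normal_le stein_kernel_hom_poly[OF supp] all_moments_hom_poly) auto
  also have "expectation (\<lambda>\<omega>. (?T \<omega> - 1)\<^sup>2) \<le> grad_prod_const d d * \<epsilon>\<^sup>2"
    using expectation_grad_prod_self_deviation_le[OF supp, of "\<epsilon>\<^sup>2"]
      contraction_bound_of_rho_tilde[OF normalized(1) supp k_range \<rho> \<open>\<epsilon> \<ge> 0\<close>] k_range
    by (simp add: sq_norm_eq_1)
  finally show ?thesis
    using \<open>\<epsilon> \<ge> 0\<close> by (simp add: real_sqrt_mult)
qed

theorem weak_conv_of_rho_tilde_tendsto_0:
  assumes normalized: "\<And>n. fin_coeffs d (a n)" "\<And>n. expectation (\<lambda>\<omega>. (ev (hom_poly d (a n)) \<omega>)\<^sup>2) = 1"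
    and k_range: "d div 2 \<le> k" "k < d"
    and lim: "(\<lambda>n. rho_tilde M G k (hom_poly d (a n))) \<longlonglongrightarrow> 0"
  shows "weak_conv_m (\<lambda>n. distr M borel (ev (hom_poly d (a n)))) std_normal_distribution"
proof (rule levy_continuity[OF _ real_dist_normal_dist])
  show "real_distribution (distr M borel (ev (hom_poly d (a n))))" for n
    by (intro real_distribution_distr all_moments_measurable all_moments_hom_poly)
  fix t
  let ?\<rho> = "\<lambda>n. rho_tilde M G k (hom_poly d (a n))"
  have "eventually (\<lambda>n.
      norm (char (distr M borel (ev (hom_poly d (a n)))) t - char std_normal_distribution t) \<le>
      sqrt (grad_prod_const d d) * enn2real (?\<rho> n)) sequentially"
    using order_tendstoD(2)[OF lim zero_less_one]
  proof eventually_elim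
    case (elim n)
    then have "?\<rho> n < top"
      by (rule less_trans) simp
    then show ?case
      by (intro norm_char_hom_poly_diff_le_rho_tilde[OF normalized k_range]) simp_all
  qed
  moreover have "(\<lambda>n. enn2real (?\<rho> n)) \<longlonglongrightarrow> 0"
    using lim by (intro tendsto_enn2real) (simp_all only: ennreal_0 order_refl)
  then have "(\<lambda>n. sqrt (grad_prod_const d d) * enn2real (?\<rho> n)) \<longlonglongrightarrow> 0"
    by (rule tendsto_mult_right_zero)
  ultimately have "(\<lambda>n. char (distr M borel (ev (hom_poly d (a n)))) t -
      char std_normal_distribution t) \<longlonglongrightarrow> 0"
    by (rule Lim_null_comparison)
  then show "(\<lambda>n. char (distr M borel (ev (hom_poly d (a n)))) t) \<longlonglongrightarrow> char std_normal_distribution t"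
    by (rule LIM_zero_cancel)
qed

lemma fourth_moment_tendsto_3_of_weak_conv:
  assumes normalized: "\<And>n. fin_coeffs d (a n)" "\<And>n. expectation (\<lambda>\<omega>. (ev (hom_poly d (a n)) \<omega>)\<^sup>2) = 1"
    and conv: "weak_conv_m (\<lambda>n. distr M borel (ev (hom_poly d (a n)))) std_normal_distribution"
  shows "(\<lambda>n. expectation (\<lambda>\<omega>. ev (hom_poly d (a n)) \<omega> ^ 4)) \<longlonglongrightarrow> 3"
proof -
  let ?F = "\<lambda>n. ev (hom_poly d (a n))"
  have [measurable]: "?F n \<in> borel_measurable M" for n
    by (intro all_moments_measurable all_moments_hom_poly)
  have moment_eq: "(\<integral>x. x ^ j \<partial>distr M borel (?F n)) = expectation (\<lambda>\<omega>. ?F n \<omega> ^ j)" for n j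
    by (simp add: integral_distr)
  have "(\<lambda>n. \<integral>x. x ^ (2 * 2) \<partial>distr M borel (?F n)) \<longlonglongrightarrow> (\<integral>x. x ^ (2 * 2) \<partial>std_normal_distribution)"
  proof (rule weak_conv_imp_even_moment_conv[OF _ real_dist_normal_dist conv])
    show "real_distribution (distr M borel (?F n))" for n
      by (rule real_distribution_distr) simp
    show "integrable (distr M borel (?F n)) (\<lambda>x. x ^ (2 * 2 + 2))" for n
      by (subst integrable_distr_eq)
        (simp_all add: all_moments_integrable all_moments_power all_moments_hom_poly)
    show "integrable std_normal_distribution (\<lambda>x. x ^ (2 * 2 + 2))"
      by (rule integrable_std_normal_distribution_moment)
    show "(\<integral>x. x ^ (2 * 2 + 2) \<partial>distr M borel (?F n)) \<le> (5 ^ d) ^ 3" for n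
    proof -
      obtain V where supp: "supported V d (a n)"
        using normalized(1) by (rule fin_coeffs_supported)
      show ?thesis
        using sixth_moment_hom_poly_le[OF supp] normalized(2)[of n] expectation_hom_poly_square[OF supp]
        by (simp add: moment_eq)
    qed
  qed
  then show ?thesis
    using std_normal_distribution_even_moments(1)[of 2] by (simp add: moment_eq fact_numeral)
qed

theorem rho_tilde_tendsto_0_of_weak_conv:
  assumes normalized: "\<And>n. fin_coeffs d (a n)" "\<And>n. expectation (\<lambda>\<omega>. (ev (hom_poly d (a n)) \<omega>)\<^sup>2) = 1"
    and "d \<ge> 1"
    and conv: "weak_conv_m (\<lambda>n. distr M borel (ev (hom_poly d (a n)))) std_normal_distribution"
  shows "(\<lambda>n. rho_tilde M G (d - 1) (hom_poly d (a n))) \<longlonglongrightarrow> 0"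
proof (rule tendsto_sandwich[where f = "\<lambda>_. 0"])
  let ?m = "\<lambda>n. expectation (\<lambda>\<omega>. ev (hom_poly d (a n)) \<omega> ^ 4) - 3"
  show "eventually (\<lambda>n. rho_tilde M G (d - 1) (hom_poly d (a n)) \<le>
      ennreal (sqrt (grad_prod_const d (d - 1) * sqrt (?m n)))) sequentially"
    by (intro always_eventually allI rho_tilde_le_fourth_moment normalized \<open>d \<ge> 1\<close>)
  have "(\<lambda>n. ennreal (sqrt (grad_prod_const d (d - 1) * sqrt (?m n)))) \<longlonglongrightarrow>
      ennreal (sqrt (grad_prod_const d (d - 1) * sqrt (3 - 3)))"
    by (intro tendsto_intros fourth_moment_tendsto_3_of_weak_conv[OF normalized conv])
  then show "(\<lambda>n. ennreal (sqrt (grad_prod_const d (d - 1) * sqrt (?m n)))) \<longlonglongrightarrow> 0"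
    by simp
qed simp_all

end

theorem theorem1p3:
  fixes M :: "'a measure"
    and G :: "nat \<Rightarrow> 'a \<Rightarrow> real"
    and d :: nat
    and a :: "nat \<Rightarrow> nat set \<Rightarrow> real"
  assumes "prob_space M"
    and "prob_space.indep_vars M (\<lambda>_. borel) G {1..}"
    and "\<And>i. i \<ge> 1 \<Longrightarrow> distributed M lborel (G i) std_normal_density"
    and "d \<ge> 1"
    and "\<And>n. fin_coeffs d (a n)"
    and "\<And>n. (\<integral>\<omega>. (at_vars G (hom_poly d (a n)) \<omega>)\<^sup>2 \<partial>M) = 1"
  shows "weak_conv_m (\<lambda>n. distr M borel (at_vars G (hom_poly d (a n)))) std_normal_distribution
    \<longleftrightarrow> (\<exists>k\<in>{d div 2..d - 1}. (\<lambda>n. rho_tilde M G k (hom_poly d (a n))) \<longlonglongrightarrow> 0)"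
    (is "?normal \<longleftrightarrow> ?small")
proof -
  interpret gaussian_sequence M G
    using assms(1-3) by (intro gaussian_sequence.intro gaussian_sequence_axioms.intro)
  show ?thesis
  proof
    assume ?normal
    then have "(\<lambda>n. rho_tilde M G (d - 1) (hom_poly d (a n))) \<longlonglongrightarrow> 0"
      by (rule rho_tilde_tendsto_0_of_weak_conv[OF assms(5,6,4)])
    moreover have "d - 1 \<in> {d div 2..d - 1}"
      using \<open>d \<ge> 1\<close> by auto
    ultimately show ?small by blast
  next
    assume ?small
    then obtain k where "d div 2 \<le> k" "k < d" "(\<lambda>n. rho_tilde M G k (hom_poly d (a n))) \<longlonglongrightarrow> 0"
      using \<open>d \<ge> 1\<close> by auto
    then show ?normal
      by (rule weak_conv_of_rho_tilde_tendsto_0[OF assms(5,6)])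
  qed
qed

end
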